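(* Assume (H). Let $\rho^0\in\mathcal{P}_c(\mathbb{R})$, $u^0\in L^\infty(d\rho^0)$, $P^0:=\rho^0u^0$. Define $M^0(x):=\rho^0((-\infty,x])$, $\psi^0:=u^0+\omega\ast\rho^0$, and the flux $$A(m):=\int_0^m\psi^0\big((M^0)^{-1}(m')\big)\,dm',\qquad m\in[0,1],$$ where $(M^0)^{-1}(m):=\inf\{x\in\mathbb{R}:M^0(x)\ge m\}$. Then $A$ is Lipschitz, and, letting $M$ be the unique entropy solution of $\partial_tM+\partial_x(A(M))=(\phi\ast M)\partial_xM$, $M(\cdot,0)=M^0$, and defining $$\rho:=\partial_xM,\qquad P:=-\partial_tM=\partial_x(A\circ M)-(\phi\ast M)\partial_xM,$$ the pair $(\rho,P)$ is a weak solution of the nonlocal Aw–Rascle–Zhang system $$\partial_t\rho+\partial_x(\rho u)=0,\qquad \partial_t(\rho u)+\partial_x(\rho u^2)=\rho\,(\phi\ast(\rho u))-\rho u\,(\phi\ast\rho),$$ with initial data $(\rho^0,P^0)$, in the sense defined in the context, where $u(\cdot,t)=\frac{dP(\cdot,t)}{d\rho(\cdot,t)}$ is the Radon–Nikodym derivative of $P(t)$ with respect to $\rho(t)$.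
   Context: Standing assumption (H): $\omega:\mathbb{R}\to[0,+\infty)$, $\omega\in W^{1,1}(\mathbb{R})\cap W^{1,\infty}(\mathbb{R})$, $\int_{\mathbb{R}}\omega\,dx=1$, and $\phi:=\omega'\in L^1(\mathbb{R})\cap L^\infty(\mathbb{R})$. $\mathcal{P}_c(\mathbb{R})$ is the set of compactly supported probability measures on $\mathbb{R}$, equipped with the Wasserstein-1 distance $\mathcal{W}_1(\rho,\mu)=\sup_{\mathrm{Lip}(f)\le1}|\int f\,d\rho-\int f\,d\mu|$. Convolutions: $(\phi\ast M)(x,t)=\int\phi(x-y)M(y,t)dy$, $(\omega\ast\rho)(x)=\int\omega(x-y)\,d\rho(y)$. Entropy solution of $\partial_tM+\partial_x(A(M))=(\phi\ast M)\partial_xM$, $M(\cdot,0)=M^0$ (for Lipschitz $A:[0,1]\to\mathbb{R}$, on $\mathbb{R}\times[0,T]$ for every $T>0$): (1) for every $\alpha\in\mathbb{R}$, with $\eta(m)=|m-\alpha|$, $q(m)=\mathrm{sgn}(m-\alpha)(A(m)-A(\alpha))$, and every nonnegative $\varphi\in C_c^\infty(\mathbb{R}\times(0,T))$, $\int_0^T\!\int[\eta(M)\partial_t\varphi+q(M)\partial_x\varphi]dx\,dt+\int_0^T\!\int\varphi(\phi\ast M)\,d(\partial_x\eta(M(\cdot,t)))\,dt\ge0$; (2) $M(\cdot,t)$ nondecreasing for each $t$; (3) there is $R>0$ with $M=0$ for $x<-R$ and $M=1$ for $x>R$ for all $t\in[0,T]$. (Existence and uniqueness of this entropy solution for nondecreasing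 $M^0$ equal to $0$ near $-\infty$ and $1$ near $+\infty$ outside a compact set, and Lipschitz $A$, is known.) Weak solution: $(\rho,P)$ is a weak solution with initial data $(\rho^0,P^0)$ if for every $T>0$: $\rho\in C([0,T];\mathcal{P}_c(\mathbb{R}))$; for every $t\in[0,T]$, $P(\cdot,t)$ is a finite signed measure, absolutely continuous w.r.t. $\rho(\cdot,t)$ with Radon–Nikodym derivative $u(\cdot,t)\in L^\infty(d\rho(t))$; $(\rho,u)$ satisfies the system in the sense of distributions; and for every $f\in C_c^\infty(\mathbb{R})$, $\lim_{t\to0+}\int f\,d\rho(t)=\int f\,d\rho^0$ and $\lim_{t\to0+}\int f\,dP(t)=\int f\,dP^0$.
   Formalization: The entropy solution M is also required to be jointly Borel measurable with t↦M(·,t) continuous in L¹ on [0,T]; without this, (1)–(3) and M(·,0)=M⁰ permit altering M at a single time, so uniqueness and continuity of ρ in W₁ fail. *)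

theory Defs
  imports "HOL-Probability.Probability"
begin

text \<open>omega is the (continuous) W^{1,1} cap W^{1,infinity} kernel, phi a fixed bounded
  integrable representative of its derivative: omega b - omega a = int_a^b phi.\<close>
definition hypH :: "(real \<Rightarrow> real) \<Rightarrow> (real \<Rightarrow> real) \<Rightarrow> bool" where
  "hypH \<omega> \<phi> \<longleftrightarrow>
     (\<forall>x. 0 \<le> \<omega> x) \<and> integrable lborel \<omega> \<and> integral\<^sup>L lborel \<omega> = 1 \<and>
     integrable lborel \<phi> \<and> (\<exists>C. \<forall>x. \<bar>\<phi> x\<bar> \<le> C) \<and>
     (\<forall>a b. \<omega> b - \<omega> a = (LBINT x=a..b. \<phi> x))"

definition Pc :: "real measure \<Rightarrow> bool" where
  "Pc \<mu> \<longleftrightarrow> sets \<mu> = sets borel \<and> prob_space \<mu> \<and>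
     (\<exists>K. compact K \<and> emeasure \<mu> (space \<mu> - K) = 0)"

definition W1 :: "real measure \<Rightarrow> real measure \<Rightarrow> real" where
  "W1 \<rho> \<mu> = Sup ((\<lambda>f. \<bar>integral\<^sup>L \<rho> f - integral\<^sup>L \<mu> f\<bar>) ` {f. lipschitz_on 1 UNIV f})"

text \<open>Distributional derivative of a nondecreasing function f: the Lebesgue--Stieltjes
  measure of its right-continuous version.\<close>
definition LS :: "(real \<Rightarrow> real) \<Rightarrow> real measure" where
  "LS f = interval_measure (\<lambda>x. Lim (at_right x) f)"

definition conv_fun :: "(real \<Rightarrow> real) \<Rightarrow> (real \<Rightarrow> real \<Rightarrow> real) \<Rightarrow> real \<Rightarrow> real \<Rightarrow> real" where
  "conv_fun \<phi> M x t = integral\<^sup>L lborel (\<lambda>y. \<phi> (x - y) * M y t)"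

definition conv_meas :: "(real \<Rightarrow> real) \<Rightarrow> real measure \<Rightarrow> real \<Rightarrow> real" where
  "conv_meas \<omega> \<rho> x = integral\<^sup>L \<rho> (\<lambda>y. \<omega> (x - y))"

definition supp1 :: "(real \<Rightarrow> real) \<Rightarrow> real set" where
  "supp1 f = closure {x. f x \<noteq> 0}"

definition test1 :: "(real \<Rightarrow> real) \<Rightarrow> bool" where
  "test1 f \<longleftrightarrow> (\<forall>n x. (deriv ^^ n) f differentiable (at x)) \<and> compact (supp1 f)"

definition pdx :: "(real \<Rightarrow> real \<Rightarrow> real) \<Rightarrow> real \<Rightarrow> real \<Rightarrow> real" where
  "pdx \<zeta> x t = deriv (\<lambda>y. \<zeta> y t) x"

definition pdt :: "(real \<Rightarrow> real \<Rightarrow> real) \<Rightarrow> real \<Rightarrow> real \<Rightarrow> real" where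
  "pdt \<zeta> x t = deriv (\<lambda>s. \<zeta> x s) t"

fun iter_pd :: "bool list \<Rightarrow> (real \<Rightarrow> real \<Rightarrow> real) \<Rightarrow> real \<Rightarrow> real \<Rightarrow> real" where
  "iter_pd [] \<zeta> = \<zeta>"
| "iter_pd (b # bs) \<zeta> = (if b then pdx else pdt) (iter_pd bs \<zeta>)"

definition smooth2 :: "(real \<Rightarrow> real \<Rightarrow> real) \<Rightarrow> bool" where
  "smooth2 \<zeta> \<longleftrightarrow> (\<forall>bs.
     continuous_on UNIV (\<lambda>p. iter_pd bs \<zeta> (fst p) (snd p)) \<and>
     (\<forall>x t. (\<lambda>y. iter_pd bs \<zeta> y t) differentiable (at x) \<and>
            (\<lambda>s. iter_pd bs \<zeta> x s) differentiable (at t)))"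

definition supp2 :: "(real \<Rightarrow> real \<Rightarrow> real) \<Rightarrow> (real \<times> real) set" where
  "supp2 \<zeta> = closure {p. \<zeta> (fst p) (snd p) \<noteq> 0}"

definition test_st :: "real \<Rightarrow> (real \<Rightarrow> real \<Rightarrow> real) \<Rightarrow> bool" where
  "test_st T \<zeta> \<longleftrightarrow> smooth2 \<zeta> \<and> compact (supp2 \<zeta>) \<and> supp2 \<zeta> \<subseteq> UNIV \<times> {0<..<T}"

text \<open>Entropy solution of  M_t + (A(M))_x = (phi * M) M_x,  M(.,0) = M0.
  The measure d(partial_x |M(.,t) - alpha|) is written as the difference of the
  distributional derivatives of the nondecreasing functions max(M - alpha,0) and
  min(M - alpha,0).  Besides (1)--(3) we require the standard regularity of the
  (known, unique) entropy solution: joint Borel measurability and continuity of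
  t |-> M(.,t) in L^1.\<close>
definition entropy_sol ::
  "(real \<Rightarrow> real) \<Rightarrow> (real \<Rightarrow> real) \<Rightarrow> (real \<Rightarrow> real) \<Rightarrow> (real \<Rightarrow> real \<Rightarrow> real) \<Rightarrow> bool" where
  "entropy_sol \<phi> A M0 M \<longleftrightarrow>
     (\<lambda>p. M (fst p) (snd p)) \<in> borel_measurable borel \<and>
     (\<forall>x. M x 0 = M0 x) \<and>
     (\<forall>T>0.
        (\<forall>\<alpha> \<zeta>. test_st T \<zeta> \<and> (\<forall>x t. 0 \<le> \<zeta> x t) \<longrightarrow>
           0 \<le> integral\<^sup>L lborel (\<lambda>t. integral\<^sup>L lborel (\<lambda>x.
                   \<bar>M x t - \<alpha>\<bar> * pdt \<zeta> x t
                   + sgn (M x t - \<alpha>) * (A (M x t) - A \<alpha>) * pdx \<zeta> x t))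
              + integral\<^sup>L lborel (\<lambda>t.
                   integral\<^sup>L (LS (\<lambda>x. max (M x t - \<alpha>) 0)) (\<lambda>x. \<zeta> x t * conv_fun \<phi> M x t)
                 - integral\<^sup>L (LS (\<lambda>x. min (M x t - \<alpha>) 0)) (\<lambda>x. \<zeta> x t * conv_fun \<phi> M x t))) \<and>
        (\<forall>t\<in>{0..T}. mono (\<lambda>x. M x t)) \<and>
        (\<exists>R>0. \<forall>t\<in>{0..T}. \<forall>x. (x < -R \<longrightarrow> M x t = 0) \<and> (R < x \<longrightarrow> M x t = 1)) \<and>
        (\<forall>t\<in>{0..T}. ((\<lambda>s. integral\<^sup>L lborel (\<lambda>x. \<bar>M x s - M x t\<bar>)) \<longlongrightarrow> 0)
                        (at t within {0..T})))"

text \<open>rho t is the measure rho(.,t); P t is the distribution f |-> int f dP(t);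
  P0 the distribution f |-> int f dP^0.  "P(t) is a finite signed measure, absolutely
  continuous w.r.t. rho(t) with Radon--Nikodym derivative u(.,t) in L^infinity(d rho(t))"
  is expressed as: P t f = int f u(.,t) d rho(t) for all f in C_c^infinity(R).\<close>
definition weak_sol ::
  "(real \<Rightarrow> real) \<Rightarrow> (real \<Rightarrow> real measure) \<Rightarrow> (real \<Rightarrow> (real \<Rightarrow> real) \<Rightarrow> real)
     \<Rightarrow> real measure \<Rightarrow> ((real \<Rightarrow> real) \<Rightarrow> real) \<Rightarrow> bool" where
  "weak_sol \<phi> \<rho> P \<rho>0 P0 \<longleftrightarrow>
     (\<forall>T>0. \<forall>t\<in>{0..T}. Pc (\<rho> t) \<and>
        ((\<lambda>s. W1 (\<rho> s) (\<rho> t)) \<longlongrightarrow> 0) (at t within {0..T})) \<and>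
     (\<exists>u :: real \<Rightarrow> real \<Rightarrow> real.
        (\<forall>t\<ge>0. (\<lambda>x. u x t) \<in> borel_measurable (\<rho> t) \<and>
                (\<exists>C. AE x in \<rho> t. \<bar>u x t\<bar> \<le> C) \<and>
                (\<forall>f. test1 f \<longrightarrow> P t f = integral\<^sup>L (\<rho> t) (\<lambda>x. f x * u x t))) \<and>
        (\<forall>T>0. \<forall>\<zeta>. test_st T \<zeta> \<longrightarrow>
           (let g = (\<lambda>x t. pdt \<zeta> x t + u x t * pdx \<zeta> x t) in
              (\<forall>t. integrable (\<rho> t) (\<lambda>x. g x t)) \<and>
              integrable lborel (\<lambda>t. integral\<^sup>L (\<rho> t) (\<lambda>x. g x t)) \<and>
              integral\<^sup>L lborel (\<lambda>t. integral\<^sup>L (\<rho> t) (\<lambda>x. g x t)) = 0) \<and>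
           (let h = (\<lambda>x t. u x t * pdt \<zeta> x t + (u x t)\<^sup>2 * pdx \<zeta> x t
                      + \<zeta> x t * (integral\<^sup>L (\<rho> t) (\<lambda>y. \<phi> (x - y) * u y t)
                                  - u x t * integral\<^sup>L (\<rho> t) (\<lambda>y. \<phi> (x - y)))) in
              (\<forall>t. integrable (\<rho> t) (\<lambda>x. h x t)) \<and>
              integrable lborel (\<lambda>t. integral\<^sup>L (\<rho> t) (\<lambda>x. h x t)) \<and>
              integral\<^sup>L lborel (\<lambda>t. integral\<^sup>L (\<rho> t) (\<lambda>x. h x t)) = 0))) \<and>
     (\<forall>f. test1 f \<longrightarrow>
        ((\<lambda>t. integral\<^sup>L (\<rho> t) f) \<longlongrightarrow> integral\<^sup>L \<rho>0 f) (at_right 0) \<and>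
        ((\<lambda>t. P t f) \<longlongrightarrow> P0 f) (at_right 0))"

end

theory Submission
  imports Defs "HOL-Computational_Algebra.Polynomial"
begin

text \<open>Let \<open>X(m,t)\<close> be the quantile function of \<open>M(\<sqdot>,t)\<close>, so that \<open>\<rho>(t)\<close> is the image of Lebesgue measure on
  \<open>(0,1)\<close> under \<open>X(\<sqdot>,t)\<close>. Writing \<open>A\<close> as a primitive of \<open>a = \<psi>\<^sup>0 \<circ> (M\<^sup>0)\<^sup>-\<^sup>1\<close>, the momentum \<open>P(t)\<close> has the
  density \<open>u = E[a | X] - \<omega> * \<rho>\<close>, where the conditional expectation averages \<open>a\<close> over the jumps of \<open>M\<close>.
  Of the entropy inequalities only the two with \<open>\<alpha>\<close> outside \<open>[0,1]\<close> are used; together they say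
  that \<open>\<partial>\<^sub>t M = - P\<close> weakly. A chain rule for \<open>G(M)\<close>, obtained by averaging \<open>M\<close> in space, turns this
  into \<open>\<partial>\<^sub>t X(m,t) = u(X(m,t),t)\<close> for almost every \<open>m\<close>: where \<open>M\<close> jumps, the averaged chain rule yields
  precisely the mean of \<open>G'\<close> over the jump. Both conservation laws now follow by differentiating
  \<open>\<zeta>(X(m,t),t)\<close> and \<open>\<zeta>(X(m,t),t) \<omega>(X(m,t) - X(m',t))\<close> in \<open>t\<close> and integrating over \<open>m\<close> and \<open>m'\<close>. The
  result does not depend on the representative of \<open>\<phi>\<close>, because two trajectories that keep a constant
  distance have equal velocities.\<close>

section \<open>Lebesgue measure on intervals\<close>

text \<open>The momentum law rests on a conserved quantity: where \<open>M\<close> does not jump,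
  \<open>U + c\<close> equals the label value \<open>a m\<close>, which does not change along the
  trajectory, while \<open>c\<close> varies only through differences of trajectories, and its time
  derivative is the nonlocal source. At jumps \<open>U + c\<close> is only a conditional expectation
  of \<open>a\<close>. The obstacle is then the product \<open>u * u\<close> in the momentum flux.
  One factor is absorbed into the derivative of \<open>\<zeta>\<close> along the flow, which is a
  function of \<open>X\<close>; against functions of \<open>X\<close>, the other factor may be
  traded for \<open>a - c\<close>. The same duality gives the trajectory equation: the chain rule
  for \<open>G(M)\<close> puts the jump average on \<open>G'\<close>, and since \<open>U\<close> is
  a function of \<open>X\<close> the average can be removed again. Regularity is low: velocities and
  \<open>\<phi>\<close> are only bounded and Borel, and the trajectory equation holds at each time
  for almost every \<open>m\<close>. Hence all chain rules are in integrated form, and they are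
  applied to explicit Lipschitz paths that agree with \<open>X\<close> almost everywhere.\<close>

definition Leb :: "real set \<Rightarrow> real measure" where
  "Leb A = density lborel (indicator A)"

lemma sets_Leb [simp, measurable_cong]: "sets (Leb A) = sets borel"
  by (simp add: Leb_def)

lemma space_Leb [simp]: "space (Leb A) = UNIV"
  by (simp add: Leb_def)

text \<open>Since \<open>Leb\<close> is a density on the whole line and not a restricted space,
  measurability never refers to the interval; only null sets do.\<close>

lemma borel_measurable_Leb [simp]: "borel_measurable (Leb A) = borel_measurable borel"
  by (intro measurable_cong_sets) auto

lemma emeasure_Leb: "A \<in> sets borel \<Longrightarrow> B \<in> sets borel \<Longrightarrow> emeasure (Leb A) B = emeasure lborel (A \<inter> B)"
  unfolding Leb_def by (simp add: emeasure_density indicator_inter_arith[symmetric])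

lemma finite_measure_Leb_Icc: "finite_measure (Leb {a..b})"
  by (rule finite_measureI) (simp add: emeasure_Leb emeasure_lborel_Icc_eq)

lemma prob_space_Leb01: "prob_space (Leb {0<..<1})"
  by (rule prob_spaceI) (simp add: emeasure_Leb)

interpretation L01: prob_space "Leb {0<..<1}"
  by (rule prob_space_Leb01)

interpretation LI: finite_measure "Leb {a..b}" for a b
  by (rule finite_measure_Leb_Icc)

lemma integral_Leb:
  fixes f :: "real \<Rightarrow> real"
  assumes "A \<in> sets borel" "f \<in> borel_measurable borel"
  shows "integral\<^sup>L (Leb A) f = (LBINT x. indicator A x * f x)"
proof -
  have "Leb A = density lborel (\<lambda>x. ennreal (indicator A x))"
    by (simp add: Leb_def ennreal_indicator)
  then show ?thesis
    using assms by (simp add: integral_density)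
qed

lemma AE_Leb: "A \<in> sets borel \<Longrightarrow> (AE x in Leb A. P x) \<longleftrightarrow> (AE x in lborel. x \<in> A \<longrightarrow> P x)"
proof -
  assume "A \<in> sets borel"
  then have *: "(AE x in Leb A. P x) \<longleftrightarrow> (AE x in lborel. 0 < (indicator A x :: ennreal) \<longrightarrow> P x)"
    unfolding Leb_def by (simp add: AE_density)
  show ?thesis
    unfolding * by (intro AE_cong) (auto simp: indicator_def)
qed

lemma AE_Leb_mem: "A \<in> sets borel \<Longrightarrow> AE x in Leb A. x \<in> A"
  by (simp add: AE_Leb)

lemma bounded_Fubini:
  fixes f :: "'a \<Rightarrow> 'b \<Rightarrow> real"
  assumes "finite_measure M1" "finite_measure M2"
    and [measurable]: "(\<lambda>(x, y). f x y) \<in> borel_measurable (M1 \<Otimes>\<^sub>M M2)"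
    and "\<And>x y. \<bar>f x y\<bar> \<le> B"
  shows "(\<integral>x. (\<integral>y. f x y \<partial>M2) \<partial>M1) = (\<integral>y. (\<integral>x. f x y \<partial>M1) \<partial>M2)"
proof -
  interpret M1: finite_measure M1 by fact
  interpret M2: finite_measure M2 by fact
  interpret P: pair_sigma_finite M1 M2 ..
  interpret P: finite_measure "M1 \<Otimes>\<^sub>M M2"
    by (rule finite_measure_pair_measure) fact+
  have "integrable (M1 \<Otimes>\<^sub>M M2) (\<lambda>(x, y). f x y)"
    by (rule P.integrable_const_bound[where B=B]) (use assms in \<open>auto intro!: AE_I2\<close>)
  then show ?thesis
    by (rule P.Fubini_integral[symmetric])
qed

section \<open>Signed image measures determined by continuous functions\<close>

lemma indicator_atMost_limit:
  fixes x r :: real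
  shows "(\<lambda>n. max 0 (min 1 (1 - real n * (r - x)))) \<longlonglongrightarrow> indicator {..x} r"
proof (cases "r \<le> x")
  case True
  then have "real n * (r - x) \<le> 0" for n
    by (simp add: mult_nonneg_nonpos)
  then have "max 0 (min 1 (1 - real n * (r - x))) = 1" for n
    by (smt (verit))
  then show ?thesis using True by simp
next
  case False
  have "eventually (\<lambda>n. real n \<ge> 1 / (r - x)) sequentially"
    using filterlim_real_sequentially by (auto simp: filterlim_at_top)
  then have "eventually (\<lambda>n. max 0 (min 1 (1 - real n * (r - x))) = 0) sequentially"
    by eventually_elim (use False in \<open>auto simp: field_simps\<close>)
  then show ?thesis using False
    by (auto intro!: tendsto_eventually)
qed

lemma borel_measurable_bounded_integrable:
  fixes f :: "'a \<Rightarrow> real"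
  assumes "finite_measure M" "f \<in> borel_measurable M" "\<And>x. \<bar>f x\<bar> \<le> B"
  shows "integrable M f"
  using finite_measure.integrable_const_bound[OF assms(1), of f B] assms by auto

text \<open>The image of \<open>v dM\<close> under \<open>y\<close> and that of \<open>w dN\<close>
  under \<open>z\<close> are signed measures that agree on bounded continuous functions. Because the
  weights may change sign, equality is carried to bounded Borel functions by a Dynkin argument on
  half lines followed by monotone limits, each limit dominated by a multiple of the weights.\<close>

lemma weighted_pushforward_eq_borel:
  fixes y :: "'a \<Rightarrow> real" and z :: "'b \<Rightarrow> real" and v :: "'a \<Rightarrow> real" and w :: "'b \<Rightarrow> real"
  assumes y [measurable]: "y \<in> borel_measurable M" and z [measurable]: "z \<in> borel_measurable N"
    and v: "integrable M v" and w: "integrable N w"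
    and cont: "\<And>g. continuous_on UNIV g \<Longrightarrow> (\<And>x. \<bar>g x\<bar> \<le> 1) \<Longrightarrow>
      (\<integral>s. g (y s) * v s \<partial>M) = (\<integral>s. g (z s) * w s \<partial>N)"
    and g: "g \<in> borel_measurable borel" "\<And>x. \<bar>g x\<bar> \<le> B"
  shows "(\<integral>s. g (y s) * v s \<partial>M) = (\<integral>s. g (z s) * w s \<partial>N)"
proof -
  note [measurable] = borel_measurable_integrable[OF v] borel_measurable_integrable[OF w]
  let ?P = "\<lambda>g. (\<integral>s. g (y s) * v s \<partial>M) = (\<integral>s. g (z s) * w s \<partial>N)"
  have int: "integrable M (\<lambda>s. h (y s) * v s)" "integrable N (\<lambda>s. h (z s) * w s)"
    if [measurable]: "h \<in> borel_measurable borel" and b: "\<And>x. \<bar>h x\<bar> \<le> C" for h C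
    by (rule Bochner_Integration.integrable_bound[where f="\<lambda>s. C * v s"];
        use v b in \<open>auto intro!: AE_I2 mult_mono simp: abs_mult intro: order_trans[OF _ abs_ge_self]\<close>)
       (rule Bochner_Integration.integrable_bound[where f="\<lambda>s. C * w s"];
        use w b in \<open>auto intro!: AE_I2 mult_mono simp: abs_mult intro: order_trans[OF _ abs_ge_self]\<close>)
  have lim: "?P h" if [measurable]: "\<And>n. hs n \<in> borel_measurable borel" "h \<in> borel_measurable borel"
    and b: "\<And>n x. \<bar>hs n x\<bar> \<le> C" and l: "\<And>x. (\<lambda>n. hs n x) \<longlonglongrightarrow> h x" and P: "\<And>n. ?P (hs n)" for hs :: "nat \<Rightarrow> real \<Rightarrow> real" and h C
  proof (rule LIMSEQ_unique)
    have C: "\<bar>C\<bar> = C" using b[of 0 0] by linarith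
    show "(\<lambda>n. \<integral>s. hs n (y s) * v s \<partial>M) \<longlonglongrightarrow> (\<integral>s. h (y s) * v s \<partial>M)"
      by (rule integral_dominated_convergence[where w="\<lambda>s. C * \<bar>v s\<bar>"])
         (use v b C in \<open>auto intro!: AE_I2 tendsto_intros l mult_right_mono simp: abs_mult\<close>)
    show "(\<lambda>n. \<integral>s. hs n (y s) * v s \<partial>M) \<longlonglongrightarrow> (\<integral>s. h (z s) * w s \<partial>N)"
      unfolding P
      by (rule integral_dominated_convergence[where w="\<lambda>s. C * \<bar>w s\<bar>"])
         (use w b C in \<open>auto intro!: AE_I2 tendsto_intros l mult_right_mono simp: abs_mult\<close>)
  qed
  have lin: "?P (\<lambda>x. f x + c * h x)"
    if "f \<in> borel_measurable borel" "\<And>x. \<bar>f x\<bar> \<le> C" "?P f"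
      "h \<in> borel_measurable borel" "\<And>x. \<bar>h x\<bar> \<le> C'" "?P h" for f h c C C'
    using int[OF that(1,2)] int[OF that(4,5)] that(3,6)
    by (simp add: distrib_right mult.assoc)
  have const: "?P (\<lambda>x. 1)"
    by (rule cont) auto
  have ind: "?P (indicator A)" if "A \<in> sets borel" for A
  proof -
    have "Int_stable (range (\<lambda>x::real. {..x}))" "range (\<lambda>x::real. {..x}) \<subseteq> Pow UNIV"
      by (auto simp: Int_stable_def)
    moreover have "A \<in> sigma_sets UNIV (range (\<lambda>x::real. {..x}))"
      using that by (simp add: borel_eq_atMost)
    ultimately show ?thesis
    proof (induction rule: sigma_sets_induct_disjoint)
      case empty
      then show ?case by simp
    next
      case (basic A)
      then obtain x where A: "A = {..x}" by auto
      \<comment> \<open>The half line is closed, so continuous ramps equal to 1 on it and vanishing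
        from \<open>x + 1 / n\<close> on converge to its indicator at every point.\<close>
      show ?case unfolding A
        by (rule lim[OF _ _ _ indicator_atMost_limit, where C=1])
           (auto intro!: cont continuous_intros borel_measurable_continuous_onI)
    next
      case (compl A)
      have [measurable]: "A \<in> sets borel" using compl by (simp add: borel_eq_atMost)
      have eq: "1 + (-1) * indicator A x = (indicator (UNIV - A) x :: real)" for x
        by (auto simp: indicator_def)
      have "?P (\<lambda>x. 1 + (-1) * indicator A x)"
        by (rule lin[where C=1 and C'=1]) (use compl const in auto)
      then show ?case unfolding eq .
    next
      case (union A)
      have [measurable]: "A i \<in> sets borel" for i using union by (auto simp: borel_eq_atMost)
      have fin: "?P (indicator (\<Union>i<n. A i))" for n
      proof (induction n)
        case (Suc n)
        have eq: "indicator (\<Union>i<n. A i) x + 1 * indicator (A n) x = (indicator (\<Union>i<Suc n. A i) x :: real)" for x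
        proof -
          have "A i \<inter> A n = {}" if "i < n" for i
            using union(1) that by (auto simp: disjoint_family_on_def)
          then have "x \<in> A n \<Longrightarrow> x \<notin> (\<Union>i<n. A i)"
            by blast
          then show ?thesis by (simp add: lessThan_Suc split: split_indicator)
        qed
        have "?P (\<lambda>x. indicator (\<Union>i<n. A i) x + 1 * indicator (A n) x)"
          by (rule lin[where C=1 and C'=1]) (use Suc union(3) in auto)
        then show ?case unfolding eq .
      qed simp
      show ?case
        by (rule lim[where C=1 and hs="\<lambda>n. indicator (\<Union>i<n. A i)"])
           (auto intro!: fin LIMSEQ_indicator_UN)
    qed
  qed
  have nn: "?P h" if "h \<in> borel_measurable borel" "\<And>x. 0 \<le> h x" "\<And>x. h x \<le> C" for h C
  proof -
    \<comment> \<open>Boundedness is part of the induction statement: for nonnegative functions it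
      passes to summands and to the members of an increasing sequence.\<close>
    have "(\<exists>C. \<forall>x. h x \<le> C) \<longrightarrow> ?P h"
      using that(1,2)
    proof (induction rule: borel_measurable_induct_real)
      case (set A)
      then show ?case using ind by simp
    next
      case (mult u c)
      show ?case
      proof
        assume "\<exists>C. \<forall>x. c * u x \<le> C"
        then obtain C where *: "\<And>x. c * u x \<le> C" by blast
        show "?P (\<lambda>x. c * u x)"
        \<comment> \<open>For \<open>c = 0\<close> the bound on \<open>c * u\<close> says nothing
          about \<open>u\<close>.\<close>
        proof (cases "c = 0")
          case False
          with mult have "u x \<le> C / c" for x using *[of x] by (simp add: field_simps)
          then have "?P u" using mult.IH by blast
          then show ?thesis by (simp add: mult.assoc)
        qed simp
      qed
    next
      case (add u v)
      show ?case
      proof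
        assume "\<exists>C. \<forall>x. v x + u x \<le> C"
        then obtain C where *: "\<forall>x. v x + u x \<le> C" by blast
        have "u x \<le> C" "v x \<le> C" for x using add(2)[of x] add(4)[of x] *[rule_format, of x] by linarith+
        moreover from this have Pu: "?P u" and Pv: "?P v" using add.IH by blast+
        ultimately have "?P (\<lambda>x. v x + 1 * u x)"
          using add.hyps by (intro lin[where C=C and C'=C]) auto
        then show "?P (\<lambda>x. v x + u x)" by simp
      qed
    next
      case (seq U)
      have le: "U i x \<le> h x" for i x
        using seq by (intro incseq_le[of "\<lambda>i. U i x"]) (auto simp: incseq_def le_fun_def)
      show ?case
      proof
        assume "\<exists>C. \<forall>x. h x \<le> C"
        then obtain C where *: "\<forall>x. h x \<le> C" by blast
        have C: "U i x \<le> C" for i x using le[of i x] * by (meson order_trans)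
        then have "?P (U i)" for i using seq.IH by blast
        then show "?P h"
          using seq.hyps C that(1) by (intro lim[of U h C]) auto
      qed
    qed
    then show ?thesis using that by auto
  qed
  have eq: "max 0 (g x) + (-1) * max 0 (- g x) = g x" for x
    by auto
  have B: "0 \<le> B" "\<And>x. g x \<le> B" "\<And>x. - g x \<le> B"
    using order_trans[OF abs_ge_zero g(2)[of 0]] g(2) by (auto simp: abs_le_iff)
  have "?P (\<lambda>x. max 0 (g x) + (-1) * max 0 (- g x))"
    by (rule lin[where C=B and C'=B]) (use g(1) B in \<open>auto intro!: nn[where C=B]\<close>)
  then show ?thesis unfolding eq .
qed

section \<open>Calculus for indefinite integrals\<close>

lemma AE_Leb_Icc: "AE x in Leb {a..b}. x \<in> {a..b}"
  by (rule AE_Leb_mem) simp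

lemma integrable_Leb_subset:
  fixes k :: "real \<Rightarrow> real"
  assumes k: "integrable (Leb B) k" and "A \<in> sets borel" "B \<in> sets borel" "A \<subseteq> B"
  shows "integrable (Leb A) k" "integrable lborel (\<lambda>r. indicator A r * k r)"
proof -
  have [measurable]: "k \<in> borel_measurable borel" using borel_measurable_integrable[OF k] by simp
  have L: "Leb A = density lborel (\<lambda>x. ennreal (indicator A x))" for A
    by (simp add: Leb_def ennreal_indicator)
  then have i: "integrable lborel (\<lambda>r. indicator B r * k r)"
    using k assms by (simp add: integrable_density)
  have eq: "indicator A r *\<^sub>R (indicator B r * k r) = indicator A r * k r" for r
    using assms(4) by (auto simp: indicator_def)
  show *: "integrable lborel (\<lambda>r. indicator A r * k r)"
    using integrable_mult_indicator[OF _ i, of A] assms unfolding eq by simp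
  show "integrable (Leb A) k"
    using assms * by (simp add: integrable_density L)
qed

lemma integral_Leb_Icc_self: "integral\<^sup>L (Leb {a..a}) f = (0::real)"
proof (rule integral_eq_zero_AE)
  have "AE x in lborel. x \<in> {a..a} \<longrightarrow> f x = 0"
    using AE_lborel_singleton[of a] by eventually_elim auto
  then show "AE x in Leb {a..a}. f x = 0" by (simp only: AE_Leb atLeastAtMost_borel)
qed

lemma integral_Leb_Icc_diff:
  fixes k :: "real \<Rightarrow> real"
  assumes k: "integrable (Leb {0..b}) k" and st: "0 \<le> s" "s \<le> t" "t \<le> b"
  shows "integral\<^sup>L (Leb {0..t}) k - integral\<^sup>L (Leb {0..s}) k = (LBINT r. indicator {s<..t} r * k r)"
    and "integrable lborel (\<lambda>r. indicator {s<..t} r * k r)"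
proof -
  have [measurable]: "k \<in> borel_measurable borel" using borel_measurable_integrable[OF k] by simp
  note i3 = integrable_Leb_subset(2)[OF k]
  show "integrable lborel (\<lambda>r. indicator {s<..t} r * k r)"
    by (rule i3) (use st in auto)
  have "integral\<^sup>L (Leb {0..t}) k - integral\<^sup>L (Leb {0..s}) k =
     (LBINT r. indicator {0..t} r * k r - indicator {0..s} r * k r)"
    using i3[of "{0..t}"] i3[of "{0..s}"] st by (simp add: integral_Leb)
  also have "\<dots> = (LBINT r. indicator {s<..t} r * k r)"
    by (rule Bochner_Integration.integral_cong) (use st in \<open>auto simp: indicator_def\<close>)
  finally show "integral\<^sup>L (Leb {0..t}) k - integral\<^sup>L (Leb {0..s}) k = (LBINT r. indicator {s<..t} r * k r)" .
qed

lemma integral_Leb_Icc_increment_le: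
  fixes k :: "real \<Rightarrow> real"
  assumes k: "integrable (Leb {0..b}) k" and st: "s \<in> {0..b}" "t \<in> {0..b}"
    and B: "\<And>r. min s t \<le> r \<Longrightarrow> r \<le> max s t \<Longrightarrow> \<bar>k r\<bar> \<le> B"
  shows "\<bar>integral\<^sup>L (Leb {0..t}) k - integral\<^sup>L (Leb {0..s}) k\<bar> \<le> B * \<bar>t - s\<bar>"
  using st B
proof (induction s t rule: linorder_wlog)
  case (le s t)
  note d = integral_Leb_Icc_diff[OF k, of s t]
  have "\<bar>LBINT r. indicator {s<..t} r * k r\<bar> \<le> (LBINT r. indicator {s<..t} r * \<bar>k r\<bar>)"
    using integral_norm_bound[of lborel "\<lambda>r. indicator {s<..t} r * k r"] by (simp add: abs_mult)
  also have "\<dots> \<le> (LBINT r. indicator {s<..t} r * B)"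
  proof (rule integral_mono)
    have "integrable lborel (\<lambda>r. \<bar>indicator {s<..t} r * k r\<bar>)"
      using d(2) le by auto
    then show "integrable lborel (\<lambda>r. indicator {s<..t} r * \<bar>k r\<bar>)" by (simp add: abs_mult)
    show "integrable lborel (\<lambda>r. indicator {s<..t} r * B)"
      using le by (intro integrable_mult_left) auto
  qed (use le in \<open>auto simp: indicator_def\<close>)
  also have "\<dots> = B * \<bar>t - s\<bar>"
    using le by (simp add: mult.commute)
  finally show ?case using d(1) le by simp
next
  case (sym s t)
  then show ?case by (simp add: abs_minus_commute min.commute max.commute)
qed

text \<open>The times may have any sign: for \<open>t < 0\<close> the interval is empty, so the
  primitive is constant there and \<open>t\<close> can be replaced by
  \<open>max 0 t\<close>.\<close>

lemma Leb_integral_Lipschitz: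
  fixes V :: "real \<Rightarrow> real"
  assumes [measurable]: "V \<in> borel_measurable borel" and V: "\<And>r. \<bar>V r\<bar> \<le> C"
  shows "\<bar>integral\<^sup>L (Leb {0..t}) V - integral\<^sup>L (Leb {0..s}) V\<bar> \<le> C * \<bar>t - s\<bar>"
proof -
  have C: "0 \<le> C" using V[of 0] by linarith
  have i: "integrable (Leb {0..b}) V" for b
    by (rule borel_measurable_bounded_integrable[OF finite_measure_Leb_Icc _ V]) simp
  have neg: "integral\<^sup>L (Leb {0..t}) V = integral\<^sup>L (Leb {0..max 0 t}) V" for t
  proof (cases "t < 0")
    case True
    then show ?thesis using integral_Leb_Icc_self[of 0 V] by (simp add: integral_Leb)
  qed (simp add: max_def)
  have "\<bar>integral\<^sup>L (Leb {0..max 0 t}) V - integral\<^sup>L (Leb {0..max 0 s}) V\<bar> \<le> C * \<bar>max 0 t - max 0 s\<bar>"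
    by (rule integral_Leb_Icc_increment_le[OF i, of _ "max 0 s + max 0 t"]) (use V in auto)
  also have "\<dots> \<le> C * \<bar>t - s\<bar>"
    using C by (intro mult_left_mono) auto
  finally show ?thesis by (simp add: neg[symmetric])
qed

lemma continuous_Leb_integral:
  fixes V :: "real \<Rightarrow> real"
  assumes "V \<in> borel_measurable borel" and "\<And>r. \<bar>V r\<bar> \<le> C"
  shows "continuous_on A (\<lambda>t. integral\<^sup>L (Leb {0..t}) V)"
proof -
  have C: "0 \<le> C" using assms(2)[of 0] by linarith
  have "C-lipschitz_on A (\<lambda>t. integral\<^sup>L (Leb {0..t}) V)"
    by (rule lipschitz_onI) (use Leb_integral_Lipschitz[OF assms] C in \<open>auto simp: dist_real_def\<close>)
  then show ?thesis by (rule lipschitz_on_continuous_on)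
qed

text \<open>\<open>Y\<close> is only Lipschitz, so \<open>\<zeta> (Y t) t\<close> may fail to be
  differentiable. The difference \<open>E\<close> of the two sides still has derivative 0 at every
  time \<open>s\<close>: to first order both increments are \<open>zx\<close> and \<open>zt\<close>
  at \<open>s\<close>, applied to \<open>Y t - Y s\<close> and \<open>t - s\<close>, and the rough
  part cancels.\<close>

lemma chain_rule_integral:
  fixes \<zeta> :: "real \<Rightarrow> real \<Rightarrow> real"
  assumes V [measurable]: "V \<in> borel_measurable borel" and VC: "\<And>r. \<bar>V r\<bar> \<le> C"
    and Y: "\<And>t. Y t = y0 + integral\<^sup>L (Leb {0..t}) V"
    and D: "\<And>x t. ((\<lambda>p. \<zeta> (fst p) (snd p)) has_derivative (\<lambda>h. zx x t * fst h + zt x t * snd h)) (at (x, t))"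
    and zx: "continuous_on UNIV (\<lambda>p. zx (fst p) (snd p))"
    and zt: "continuous_on UNIV (\<lambda>p. zt (fst p) (snd p))"
    and b: "0 \<le> b"
  shows "\<zeta> (Y b) b - \<zeta> (Y 0) 0 = (\<integral>s. zx (Y s) s * V s + zt (Y s) s \<partial>Leb {0..b})"
proof -
  have C0: "0 \<le> C" using VC[of 0] by linarith
  have YL: "\<bar>Y t - Y s\<bar> \<le> C * \<bar>t - s\<bar>" for s t
    using Leb_integral_Lipschitz[OF V VC, where t=t and s=s] by (simp add: Y)
  have Yc: "continuous_on A Y" for A
    unfolding Y by (intro continuous_intros continuous_Leb_integral[OF V VC])
  have zxY: "continuous_on A (\<lambda>s. zx (Y s) s)" for A
    using continuous_on_compose2[OF zx, of A "\<lambda>s. (Y s, s)"] by (simp add: continuous_on_Pair Yc)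
  have ztY: "continuous_on A (\<lambda>s. zt (Y s) s)" for A
    using continuous_on_compose2[OF zt, of A "\<lambda>s. (Y s, s)"] by (simp add: continuous_on_Pair Yc)
  note [measurable] = borel_measurable_continuous_onI[OF zxY] borel_measurable_continuous_onI[OF ztY]
  define k where "k s = zx (Y s) s * V s + zt (Y s) s" for s
  have [measurable]: "k \<in> borel_measurable borel" unfolding k_def[abs_def] by measurable
  have iV: "integrable (Leb {0..b}) V"
    by (rule borel_measurable_bounded_integrable[OF finite_measure_Leb_Icc _ VC]) simp
  have ik: "integrable (Leb {0..b}) k"
  proof -
    have "bounded ((\<lambda>s. zx (Y s) s) ` {0..b})" "bounded ((\<lambda>s. zt (Y s) s) ` {0..b})"
      by (intro compact_imp_bounded compact_continuous_image zxY ztY compact_Icc)+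
    then obtain B1 B2 where "\<forall>s\<in>{0..b}. \<bar>zx (Y s) s\<bar> \<le> B1" "\<forall>s\<in>{0..b}. \<bar>zt (Y s) s\<bar> \<le> B2"
      unfolding bounded_iff by auto
    then have B: "\<And>s. s \<in> {0..b} \<Longrightarrow> \<bar>zx (Y s) s\<bar> \<le> B1" "\<And>s. s \<in> {0..b} \<Longrightarrow> \<bar>zt (Y s) s\<bar> \<le> B2"
      by auto
    show ?thesis
    proof (rule LI.integrable_const_bound[where B="B1 * C + B2"])
      show "AE x in Leb {0..b}. norm (k x) \<le> B1 * C + B2"
        using AE_Leb_Icc[of 0 b]
      proof (eventually_elim)
        case (elim x)
        then have "\<bar>zx (Y x) x * V x\<bar> \<le> B1 * C"
          unfolding abs_mult by (intro mult_mono B VC) (use B(1)[of x] in auto)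
        then show ?case using B(2)[OF elim] unfolding k_def by simp
      qed
    qed simp
  qed
  define E where "E t = \<zeta> (Y t) t - integral\<^sup>L (Leb {0..t}) k" for t
  have dE: "(E has_real_derivative 0) (at s within {0..b})" if s: "s \<in> {0..b}" for s
    unfolding has_field_derivative_def has_derivative_within_alt
  proof (intro conjI allI impI)
    fix e' :: real assume "0 < e'"
    \<comment> \<open>Two errors of size \<open>e * (C + 1) * \<bar>t - s\<bar>\<close> will be
      added: the Taylor remainder of \<open>\<zeta>\<close> and the oscillation of its partial
      derivatives.\<close>
    define e where "e = e' / (2 * (C + 1))"
    have e: "0 < e" using \<open>0 < e'\<close> C0 by (simp add: e_def)
    obtain d1 where d1: "d1 > 0" "\<And>p. norm (p - (Y s, s)) < d1 \<Longrightarrow>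
       \<bar>\<zeta> (fst p) (snd p) - \<zeta> (Y s) s - (zx (Y s) s * (fst p - Y s) + zt (Y s) s * (snd p - s))\<bar> \<le> e * norm (p - (Y s, s))"
      using D[of "Y s" s] e unfolding has_derivative_at_alt by fastforce
    obtain d2 where d2: "d2 > 0" "\<And>p. norm (p - (Y s, s)) < d2 \<Longrightarrow> \<bar>zx (fst p) (snd p) - zx (Y s) s\<bar> < e"
      using zx e unfolding continuous_on_iff by (fastforce simp: dist_norm)
    obtain d3 where d3: "d3 > 0" "\<And>p. norm (p - (Y s, s)) < d3 \<Longrightarrow> \<bar>zt (fst p) (snd p) - zt (Y s) s\<bar> < e"
      using zt e unfolding continuous_on_iff by (fastforce simp: dist_norm)
    \<comment> \<open>The point \<open>(Y t, t)\<close> moves at speed at most \<open>C + 1\<close>,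
      so it stays in all three neighbourhoods for this long.\<close>
    define d where "d = min d1 (min d2 d3) / (C + 1)"
    have d: "d > 0" using d1(1) d2(1) d3(1) C0 by (simp add: d_def)
    have nr: "norm ((Y t, t) - (Y s, s)) \<le> (C + 1) * \<bar>t - s\<bar>" for t
      using norm_Pair_le[of "Y t - Y s" "t - s"] YL[of t s] by (simp add: algebra_simps)
    have nr': "norm ((Y t, t) - (Y s, s)) < d1 \<and> norm ((Y t, t) - (Y s, s)) < d2 \<and> norm ((Y t, t) - (Y s, s)) < d3" if "\<bar>t - s\<bar> < d" for t
    proof -
      have "norm ((Y t, t) - (Y s, s)) \<le> (C + 1) * \<bar>t - s\<bar>" by (rule nr)
      also have "\<dots> < min d1 (min d2 d3)"
        using that C0 unfolding d_def by (simp add: field_simps)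
      finally show ?thesis by simp
    qed
    show "\<exists>d>0. \<forall>t\<in>{0..b}. norm (t - s) < d \<longrightarrow> norm (E t - E s - 0 * (t - s)) \<le> e' * norm (t - s)"
    proof (intro exI[of _ d] conjI ballI impI d)
      fix t assume t: "t \<in> {0..b}" "norm (t - s) < d"
      define k' where "k' r = k r - (zx (Y s) s * V r + zt (Y s) s)" for r
      have ik': "integrable (Leb {0..b}) k'"
        unfolding k'_def by (intro Bochner_Integration.integrable_diff ik Bochner_Integration.integrable_add
            integrable_mult_right iV) (rule LI.integrable_const)
      have sub: "integral\<^sup>L (Leb {0..r}) k' = integral\<^sup>L (Leb {0..r}) k - (zx (Y s) s * (Y r - Y 0) + zt (Y s) s * r)"
        if r: "r \<in> {0..b}" for r
      proof -
        have iV: "integrable (Leb {0..r}) V"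
          by (rule borel_measurable_bounded_integrable[OF finite_measure_Leb_Icc _ VC]) simp
        have "measure (Leb {0..r}) UNIV = r"
          using r by (simp add: measure_def emeasure_Leb)
        moreover have "integrable (Leb {0..r}) k"
          by (rule integrable_Leb_subset[OF ik]) (use r in auto)
        ultimately show ?thesis
          unfolding k'_def Y using iV integral_Leb_Icc_self[of 0 V] by (simp add: algebra_simps)
      qed
      have "\<bar>integral\<^sup>L (Leb {0..t}) k' - integral\<^sup>L (Leb {0..s}) k'\<bar> \<le> (e * (C + 1)) * \<bar>t - s\<bar>"
      proof (rule integral_Leb_Icc_increment_le[OF ik' s t(1)])
        fix r assume r: "min s t \<le> r" "r \<le> max s t"
        then have "\<bar>r - s\<bar> < d" using t by auto
        note n = nr'[OF this]
        have "\<bar>(zx (Y r) r - zx (Y s) s) * V r\<bar> \<le> e * C"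
          unfolding abs_mult using d2(2)[of "(Y r, r)"] n VC[of r] e by (intro mult_mono) auto
        moreover have "\<bar>zt (Y r) r - zt (Y s) s\<bar> \<le> e"
          using d3(2)[of "(Y r, r)"] n by auto
        ultimately show "\<bar>k' r\<bar> \<le> e * (C + 1)"
          unfolding k'_def k_def by (simp add: algebra_simps)
      qed
      moreover have "\<bar>\<zeta> (Y t) t - \<zeta> (Y s) s - (zx (Y s) s * (Y t - Y s) + zt (Y s) s * (t - s))\<bar> \<le> e * ((C + 1) * \<bar>t - s\<bar>)"
      proof -
        have "\<bar>\<zeta> (Y t) t - \<zeta> (Y s) s - (zx (Y s) s * (Y t - Y s) + zt (Y s) s * (t - s))\<bar> \<le> e * norm ((Y t, t) - (Y s, s))"
          using d1(2)[of "(Y t, t)"] nr' t by simp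
        also have "\<dots> \<le> e * ((C + 1) * \<bar>t - s\<bar>)"
          using nr[of t] e by (intro mult_left_mono) auto
        finally show ?thesis .
      qed
      ultimately have "\<bar>E t - E s\<bar> \<le> 2 * (e * (C + 1) * \<bar>t - s\<bar>)"
        unfolding sub[OF s] sub[OF t(1)] E_def by (simp add: algebra_simps)
      also have "\<dots> = e' * \<bar>t - s\<bar>"
        using C0 unfolding e_def by (simp add: field_simps)
      finally show "norm (E t - E s - 0 * (t - s)) \<le> e' * norm (t - s)" by simp
    qed
  qed (simp add: bounded_linear_mult_right)
  obtain c where "\<And>s. s \<in> {0..b} \<Longrightarrow> E s = c"
    using has_field_derivative_zero_constant[of "{0..b}" E] dE by auto
  then have "E b = E 0" using b by simp
  then show ?thesis unfolding E_def using integral_Leb_Icc_self[of 0 k] by (simp flip: k_def)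
qed

lemma chain_rule_integral_1:
  fixes G :: "real \<Rightarrow> real"
  assumes V: "V \<in> borel_measurable borel" "\<And>r. \<bar>V r\<bar> \<le> C"
    and Y: "\<And>t. Y t = y0 + integral\<^sup>L (Leb {0..t}) V"
    and G: "\<And>x. (G has_real_derivative g x) (at x)" and g: "continuous_on UNIV g"
    and b: "0 \<le> b"
  shows "G (Y b) - G (Y 0) = (\<integral>s. g (Y s) * V s \<partial>Leb {0..b})"
proof -
  have "((\<lambda>p. G (fst p)) has_derivative (\<lambda>h. g x * fst h + 0 * snd h)) (at (x, t))" for x and t :: real
    using has_derivative_compose[of fst fst "(x, t)" UNIV G "\<lambda>h. g x * h"] G[of x]
    by (auto simp: has_field_derivative_def bounded_linear_fst bounded_linear_imp_has_derivative)
  moreover have "continuous_on UNIV (\<lambda>p. g (fst p))"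
    using continuous_on_compose2[OF g continuous_on_fst[OF continuous_on_id]] by simp
  ultimately show ?thesis
    using chain_rule_integral[OF V Y, of "\<lambda>x t. G x" "\<lambda>x t. g x" "\<lambda>x t. 0" b] b by simp
qed

lemma continuous_imp_antiderivative:
  fixes g :: "real \<Rightarrow> real"
  assumes "continuous_on UNIV g"
  obtains G where "\<And>x. (G has_real_derivative g x) (at x)"
  using einterval_antiderivative[of "-\<infinity>" \<infinity> g] assms
  by (auto simp: continuous_on_eq_continuous_at has_real_derivative_iff_has_vector_derivative)

lemma interval_integral_antiderivative:
  fixes g :: "real \<Rightarrow> real"
  assumes "\<And>x. (G has_real_derivative g x) (at x)" "continuous_on UNIV g"
  shows "(LBINT x=a..b. g x) = G b - G a"
  by (rule interval_integral_FTC_finite)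
     (use assms in \<open>auto intro: continuous_on_subset has_vector_derivative_at_within
        simp: has_real_derivative_iff_has_vector_derivative\<close>)

text \<open>Brings the oriented integral into the form of a weighted image measure, with the
  identity as map and \<open>sgn (b - a)\<close> as weight, so that it can be compared with an
  integral along a path.\<close>

lemma interval_integral_eq_Leb:
  fixes g :: "real \<Rightarrow> real"
  assumes [measurable]: "g \<in> borel_measurable borel"
  shows "(LBINT x=a..b. g x) = (\<integral>x. g x * sgn (b - a) \<partial>Leb {min a b..max a b})"
proof (cases "a \<le> b")
  case True
  then have "(LBINT x=a..b. g x) = integral\<^sup>L (Leb {a..b}) g"
    by (simp add: interval_integral_Icc set_lebesgue_integral_def integral_Leb)
  then show ?thesis using True integral_Leb_Icc_self[of a g]
    by (cases "a = b") (auto simp: min_def max_def sgn_if)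
next
  case False
  then have "(LBINT x=b..a. g x) = integral\<^sup>L (Leb {b..a}) g"
    by (simp add: interval_integral_Icc set_lebesgue_integral_def integral_Leb)
  then show ?thesis using False
    by (simp add: interval_integral_endpoints_reverse[of a b] min_def max_def)
qed

text \<open>The chain rule for a primitive of a merely bounded Borel function: on the set of times
  that the path spends in an exceptional null set, its velocity vanishes almost everywhere.\<close>

lemma bounded_chain_rule:
  fixes \<phi> \<omega> :: "real \<Rightarrow> real"
  assumes V: "V \<in> borel_measurable borel" "\<And>r. \<bar>V r\<bar> \<le> C"
    and Y: "\<And>t. Y t = y0 + integral\<^sup>L (Leb {0..t}) V"
    and \<phi>: "\<phi> \<in> borel_measurable borel" "\<And>x. \<bar>\<phi> x\<bar> \<le> B"
    and \<omega>: "\<And>a b. \<omega> b - \<omega> a = (LBINT x=a..b. \<phi> x)"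
    and b: "0 \<le> b"
  shows "\<omega> (Y b) - \<omega> (Y 0) = (\<integral>s. \<phi> (Y s) * V s \<partial>Leb {0..b})"
proof -
  have "continuous_on UNIV Y"
    unfolding Y by (intro continuous_intros continuous_Leb_integral[OF V])
  then have Ym: "Y \<in> borel_measurable borel" by (rule borel_measurable_continuous_onI)
  \<comment> \<open>Both sides integrate \<open>\<phi>\<close> against a signed measure: the image
    of \<open>V ds\<close> under \<open>Y\<close>, and oriented Lebesgue measure between the
    endpoints of the path. For continuous integrands they agree by the classical chain rule, hence
    also for \<open>\<phi>\<close>.\<close>
  have "(\<integral>s. \<phi> (Y s) * V s \<partial>Leb {0..b}) = (\<integral>s. \<phi> s * sgn (Y b - Y 0) \<partial>Leb {min (Y 0) (Y b)..max (Y 0) (Y b)})"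
  proof (rule weighted_pushforward_eq_borel[where z="\<lambda>x. x", OF _ _ _ _ _ \<phi>])
    show "integrable (Leb {0..b}) V"
      by (rule borel_measurable_bounded_integrable[OF finite_measure_Leb_Icc _ V(2)]) (use V in simp)
    fix g :: "real \<Rightarrow> real" assume g: "continuous_on UNIV g"
    then have gm: "g \<in> borel_measurable borel" by (rule borel_measurable_continuous_onI)
    obtain G where G: "\<And>x. (G has_real_derivative g x) (at x)"
      using continuous_imp_antiderivative[OF g] by blast
    show "(\<integral>s. g (Y s) * V s \<partial>Leb {0..b}) = (\<integral>s. g s * sgn (Y b - Y 0) \<partial>Leb {min (Y 0) (Y b)..max (Y 0) (Y b)})"
      unfolding chain_rule_integral_1[OF V Y G g b, symmetric]
        interval_integral_eq_Leb[OF gm, symmetric] interval_integral_antiderivative[OF G g] ..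
  qed (use Ym in auto)
  then show ?thesis unfolding \<omega> interval_integral_eq_Leb[OF \<phi>(1)] by simp
qed

text \<open>Polarization: the chain rule for the square is applied to \<open>H + K\<close> and
  \<open>H - K\<close>, which are again primitives of bounded functions.\<close>

lemma product_rule_integral:
  fixes h k :: "real \<Rightarrow> real"
  assumes h: "h \<in> borel_measurable borel" "\<And>r. \<bar>h r\<bar> \<le> B"
    and k: "k \<in> borel_measurable borel" "\<And>r. \<bar>k r\<bar> \<le> C"
    and H: "\<And>t. H t = H0 + integral\<^sup>L (Leb {0..t}) h"
    and K: "\<And>t. K t = K0 + integral\<^sup>L (Leb {0..t}) k"
    and b: "0 \<le> b"
  shows "H b * K b - H 0 * K 0 = (\<integral>s. h s * K s + H s * k s \<partial>Leb {0..b})"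
proof -
  note [measurable] = h(1) k(1)
  have ih: "integrable (Leb {0..b}) h" for b
    by (rule borel_measurable_bounded_integrable[OF finite_measure_Leb_Icc _ h(2)]) simp
  have ik: "integrable (Leb {0..b}) k" for b
    by (rule borel_measurable_bounded_integrable[OF finite_measure_Leb_Icc _ k(2)]) simp
  have sq: "(Y b)\<^sup>2 - (Y 0)\<^sup>2 = (\<integral>s. 2 * Y s * V s \<partial>Leb {0..b}) \<and> integrable (Leb {0..b}) (\<lambda>s. 2 * Y s * V s)"
    if V: "V \<in> borel_measurable borel" "\<And>r. \<bar>V r\<bar> \<le> C"
    and Y: "\<And>t. Y t = y0 + integral\<^sup>L (Leb {0..t}) V" for V :: "real \<Rightarrow> real" and Y y0 C
  proof
    show "(Y b)\<^sup>2 - (Y 0)\<^sup>2 = (\<integral>s. 2 * Y s * V s \<partial>Leb {0..b})"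
      by (rule chain_rule_integral_1[where G="\<lambda>x. x\<^sup>2", OF V Y]) (auto simp: b intro!: derivative_eq_intros continuous_intros)
    have Yc: "continuous_on A Y" for A
      unfolding Y by (intro continuous_intros continuous_Leb_integral[OF V])
    note [measurable] = borel_measurable_continuous_onI[OF Yc] V(1)
    have "bounded (Y ` {0..b})" by (intro compact_imp_bounded compact_continuous_image Yc) auto
    then obtain B where "\<forall>s\<in>{0..b}. \<bar>Y s\<bar> \<le> B"
      unfolding bounded_iff by auto
    then have B: "\<And>s. s \<in> {0..b} \<Longrightarrow> \<bar>Y s\<bar> \<le> B" by blast
    show "integrable (Leb {0..b}) (\<lambda>s. 2 * Y s * V s)"
    proof (rule LI.integrable_const_bound[where B="2 * B * C"])
      show "AE x in Leb {0..b}. norm (2 * Y x * V x) \<le> 2 * B * C"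
        using AE_Leb_Icc[of 0 b]
      proof (eventually_elim)
        case (elim x)
        have "\<bar>Y x\<bar> * \<bar>V x\<bar> \<le> B * C"
          by (intro mult_mono B V elim) (use B[OF elim] in auto)
        then show ?case by (simp add: abs_mult)
      qed
    qed simp
  qed
  have BC: "\<bar>h r + k r\<bar> \<le> B + C" "\<bar>h r - k r\<bar> \<le> B + C" for r using h(2)[of r] k(2)[of r] by auto
  have 1: "(H b + K b)\<^sup>2 - (H 0 + K 0)\<^sup>2 = (\<integral>s. 2 * (H s + K s) * (h s + k s) \<partial>Leb {0..b}) \<and>
    integrable (Leb {0..b}) (\<lambda>s. 2 * (H s + K s) * (h s + k s))"
    by (rule sq[where ?y0.0="H0 + K0", OF _ BC(1)]) (use ih ik in \<open>auto simp: H K\<close>)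
  have 2: "(H b - K b)\<^sup>2 - (H 0 - K 0)\<^sup>2 = (\<integral>s. 2 * (H s - K s) * (h s - k s) \<partial>Leb {0..b}) \<and>
    integrable (Leb {0..b}) (\<lambda>s. 2 * (H s - K s) * (h s - k s))"
    by (rule sq[where ?y0.0="H0 - K0", OF _ BC(2)]) (use ih ik in \<open>auto simp: H K\<close>)
  have "4 * (H b * K b - H 0 * K 0) = ((H b + K b)\<^sup>2 - (H 0 + K 0)\<^sup>2) - ((H b - K b)\<^sup>2 - (H 0 - K 0)\<^sup>2)"
    by (simp add: power2_eq_square algebra_simps)
  also have "\<dots> = (\<integral>s. 2 * (H s + K s) * (h s + k s) - 2 * (H s - K s) * (h s - k s) \<partial>Leb {0..b})"
    using 1 2 by (simp only: Bochner_Integration.integral_diff)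
  also have "\<dots> = (\<integral>s. 4 * (h s * K s + H s * k s) \<partial>Leb {0..b})"
    by (simp add: algebra_simps)
  also have "\<dots> = 4 * (\<integral>s. h s * K s + H s * k s \<partial>Leb {0..b})"
    by (rule integral_mult_right_zero)
  finally show ?thesis by simp
qed

section \<open>Quantiles of compactly supported distribution functions\<close>

text \<open>The one-sided limit has the form used in \<open>LS\<close>, so that \<open>LS F\<close>
  is the interval measure of \<open>rlim F\<close>.\<close>

definition rlim :: "(real \<Rightarrow> real) \<Rightarrow> real \<Rightarrow> real" where
  "rlim F x = Lim (at_right x) F"

definition llim :: "(real \<Rightarrow> real) \<Rightarrow> real \<Rightarrow> real" where
  "llim F x = Lim (at_left x) F"

text \<open>The value 0 outside (0,1) makes boundedness and Borel measurability hold for all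
  \<open>m\<close>, not just for almost all.\<close>

definition quantile :: "(real \<Rightarrow> real) \<Rightarrow> real \<Rightarrow> real" where
  "quantile F m = (if 0 < m \<and> m < 1 then Inf {x. m \<le> rlim F x} else 0)"

text \<open>Average of \<open>a\<close> over the range of values that \<open>F\<close> jumps over at \<open>y\<close>; this is \<open>a (F y)\<close>
  where \<open>F\<close> is continuous.\<close>

definition jump_avg :: "(real \<Rightarrow> real) \<Rightarrow> (real \<Rightarrow> real) \<Rightarrow> real \<Rightarrow> real" where
  "jump_avg a F y = (\<integral>\<theta>. a ((1 - \<theta>) * llim F y + \<theta> * rlim F y) \<partial>Leb {0<..<1})"

lemma tendsto_add_over_Suc: "(\<lambda>n. y + c / real (Suc n)) \<longlonglongrightarrow> (y :: real)"
proof -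
  have "(\<lambda>n. y + c / real (Suc n)) \<longlonglongrightarrow> y + 0"
    by (intro tendsto_add tendsto_const LIMSEQ_Suc[OF lim_const_over_n])
  then show ?thesis by simp
qed

lemma filterlim_at_right_seq: "c > 0 \<Longrightarrow> filterlim (\<lambda>n. y + c / real (Suc n)) (at_right y) sequentially"
  unfolding filterlim_at using tendsto_add_over_Suc by (simp add: add_pos_nonneg)

lemma filterlim_at_left_seq: "c < 0 \<Longrightarrow> filterlim (\<lambda>n. y + c / real (Suc n)) (at_left y) sequentially"
  unfolding filterlim_at using tendsto_add_over_Suc by (simp add: divide_neg_pos)

lemma Leb01_atMost: "integral\<^sup>L (Leb {0<..<1}) (indicator {..c}) = (min 1 (max 0 c) :: real)"
proof -
  have "integral\<^sup>L (Leb {0<..<1}) (indicator {..c}) = measure lborel ({0<..<1} \<inter> {..c})"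
  proof -
    have "integral\<^sup>L (Leb {0<..<1}) (indicator {..c}) = measure (Leb {0<..<1}) {..c}" by simp
    also have "\<dots> = measure lborel ({0<..<1} \<inter> {..c})"
      unfolding measure_def by (subst emeasure_Leb) simp_all
    finally show ?thesis .
  qed
  also have "\<dots> = min 1 (max 0 c)"
  proof (cases "c < 1")
    case True
    then have "{0<..<1} \<inter> {..c} = {0<..c}" by auto
    then show ?thesis using True by (cases "0 \<le> c") simp_all
  next
    case False
    then have "{0<..<1} \<inter> {..c} = {0<..<1}" by auto
    then show ?thesis using False by simp
  qed
  finally show ?thesis .
qed

lemma AE_Leb01: "AE m in Leb {0<..<1}. 0 < m \<and> m < 1"
  by (rule eventually_mono[OF AE_Leb_mem[of "{0<..<1}"]]) (simp_all del: eventually_conj_iff)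

text \<open>One-sided continuity is not assumed, since for positive times \<open>entropy_sol\<close>
  prescribes no normalisation of \<open>M\<close> at its jumps.\<close>

locale step_cdf =
  fixes F :: "real \<Rightarrow> real" and R :: real
  assumes mono_F: "mono F"
    and lo: "\<And>x. x < - R \<Longrightarrow> F x = 0"
    and hi: "\<And>x. R < x \<Longrightarrow> F x = 1"
begin

lemma F_mono: "x \<le> y \<Longrightarrow> F x \<le> F y"
  using mono_F by (rule monoD)

lemma F_bounds: "0 \<le> F x" "F x \<le> 1"
  using F_mono[of "min x (- R - 1)" x] lo[of "min x (- R - 1)"]
    F_mono[of x "max x (R + 1)"] hi[of "max x (R + 1)"] by auto

lemma R_nonneg: "0 \<le> R"
proof (rule ccontr)
  assume "\<not> 0 \<le> R"
  then show False using lo[of 0] hi[of 0] by auto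
qed

lemma F_meas [measurable]: "F \<in> borel_measurable borel"
  by (rule borel_measurable_mono[OF mono_F])

lemma rlim_tendsto: "(F \<longlongrightarrow> rlim F x) (at_right x)"
proof -
  have "(F \<longlongrightarrow> Inf (F ` ({x<..} \<inter> UNIV))) (at x within ({x<..} \<inter> UNIV))"
    by (rule Lim_right_bound[where K=0]) (auto intro: F_mono F_bounds)
  then have "(F \<longlongrightarrow> Inf (F ` {x<..})) (at_right x)" by simp
  then show ?thesis
    unfolding rlim_def using tendsto_Lim[of "at_right x" F] by simp
qed

lemma llim_tendsto: "(F \<longlongrightarrow> llim F x) (at_left x)"
proof -
  have "(F \<longlongrightarrow> Sup (F ` ({..<x} \<inter> UNIV))) (at x within ({..<x} \<inter> UNIV))"
    by (rule Lim_left_bound[where K=1]) (auto intro: F_mono F_bounds)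
  then have "(F \<longlongrightarrow> Sup (F ` {..<x})) (at_left x)" by simp
  then show ?thesis
    unfolding llim_def using tendsto_Lim[of "at_left x" F] by simp
qed

lemma rlim_ge: "F x \<le> rlim F x"
proof (rule tendsto_lowerbound[OF rlim_tendsto])
  show "eventually (\<lambda>y. F x \<le> F y) (at_right x)"
    using eventually_at_right_less[of x] by eventually_elim (simp add: F_mono)
qed simp

lemma rlim_le:
  assumes "x < y"
  shows "rlim F x \<le> F y"
proof (rule tendsto_upperbound[OF rlim_tendsto])
  show "eventually (\<lambda>z. F z \<le> F y) (at_right x)"
    using eventually_at_right_real[OF assms] by (rule eventually_mono) (simp add: F_mono)
qed simp

lemma llim_le: "llim F x \<le> F x"
proof (rule tendsto_upperbound[OF llim_tendsto])
  show "eventually (\<lambda>y. F y \<le> F x) (at_left x)"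
    using eventually_at_left_real[of "x - 1" x] by (rule eventually_mono) (auto simp: F_mono)
qed simp

lemma llim_ge:
  assumes "y < x"
  shows "F y \<le> llim F x"
proof (rule tendsto_lowerbound[OF llim_tendsto])
  show "eventually (\<lambda>z. F y \<le> F z) (at_left x)"
    using eventually_at_left_real[OF assms] by (rule eventually_mono) (simp add: F_mono)
qed simp

lemma rlim_le_llim: "x < y \<Longrightarrow> rlim F x \<le> llim F y"
  using rlim_le[of x "(x + y) / 2"] llim_ge[of "(x + y) / 2" y] by auto

lemma llim_le_rlim: "llim F x \<le> rlim F x"
  using llim_le rlim_ge order_trans by blast

lemma rlim_mono: "x \<le> y \<Longrightarrow> rlim F x \<le> rlim F y"
  using rlim_le_llim[of x y] llim_le_rlim[of y] by (cases "x = y") auto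

lemma rlim_bounds: "0 \<le> rlim F x" "rlim F x \<le> 1"
  using rlim_ge[of x] F_bounds[of x] rlim_le[of x "x+1"] F_bounds[of "x+1"] by auto

lemma llim_bounds: "0 \<le> llim F x" "llim F x \<le> 1"
  using llim_le[of x] F_bounds[of x] llim_ge[of "x-1" x] F_bounds[of "x-1"] by auto

lemma rlim_lo: "x < - R \<Longrightarrow> rlim F x = 0"
  using rlim_le[of x "(x - R) / 2"] lo[of "(x - R) / 2"] rlim_bounds[of x] by auto

lemma rlim_hi: "R \<le> x \<Longrightarrow> rlim F x = 1"
proof -
  have "1 \<le> rlim F R"
    by (rule tendsto_lowerbound[OF rlim_tendsto])
       (use eventually_at_right_less[of R] in \<open>auto simp: hi elim!: eventually_mono\<close>)
  then show "R \<le> x \<Longrightarrow> rlim F x = 1"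
    using rlim_mono[of R x] rlim_bounds[of x] by auto
qed

lemma rlim_right_cont: "continuous (at_right x) (rlim F)"
proof -
  have "(rlim F \<longlongrightarrow> rlim F x) (at_right x)"
  proof (rule tendstoI)
    fix e :: real assume "0 < e"
    then have "eventually (\<lambda>y. dist (F y) (rlim F x) < e) (at_right x)"
      using rlim_tendsto tendstoD by blast
    then obtain b where b: "b > x" "\<And>y. x < y \<Longrightarrow> y < b \<Longrightarrow> dist (F y) (rlim F x) < e"
      unfolding eventually_at_right_field by blast
    have "dist (rlim F y) (rlim F x) < e" if "x < y" "y < b" for y
      using rlim_le[of y "(y + b) / 2"] b(2)[of "(y + b) / 2"] rlim_mono[of x y] that
        rlim_ge[of "(y + b) / 2"] rlim_mono[of y "(y + b) / 2"]
      by (auto simp: dist_real_def)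
    then show "eventually (\<lambda>y. dist (rlim F y) (rlim F x) < e) (at_right x)"
      unfolding eventually_at_right_field using b(1) by blast
  qed
  then show ?thesis by (simp add: continuous_within)
qed

text \<open>Supplies the pseudoinverse relation between \<open>rlim F\<close> and its generalized
  inverse, through which levels and positions are compared from here on.\<close>

sublocale G: right_continuous_mono "rlim F" 0 1
proof
  show "(rlim F \<longlongrightarrow> 0) at_bot"
    by (rule tendsto_eventually) (auto simp: eventually_at_bot_dense rlim_lo intro!: exI[of _ "- R"])
  show "(rlim F \<longlongrightarrow> 1) at_top"
    by (rule tendsto_eventually) (auto simp: eventually_at_top_linorder rlim_hi intro!: exI[of _ R])
qed (auto intro: monoI rlim_mono rlim_right_cont)

section \<open>Quantiles, jumps and the law of the quantile\<close>

lemma quantile_le_iff: "0 < m \<Longrightarrow> m < 1 \<Longrightarrow> quantile F m \<le> x \<longleftrightarrow> m \<le> rlim F x"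
  using G.pseudoinverse[of m x] by (simp add: quantile_def)

lemma quantile_range: "\<bar>quantile F m\<bar> \<le> R"
proof (cases "0 < m \<and> m < 1")
  case True
  have "quantile F m \<le> R"
    using quantile_le_iff[of m R] True rlim_hi[of R] by auto
  moreover have "- R \<le> quantile F m"
  proof (rule ccontr)
    assume "\<not> - R \<le> quantile F m"
    then show False using quantile_le_iff[of m "quantile F m"] rlim_lo[of "quantile F m"] True by auto
  qed
  ultimately show ?thesis by auto
qed (use R_nonneg in \<open>auto simp: quantile_def\<close>)

lemma quantile_meas [measurable]: "quantile F \<in> borel_measurable borel"
proof (rule borel_measurableI_le)
  fix y
  have "{x \<in> space borel. quantile F x \<le> y} = ({0<..<1} \<inter> {..rlim F y}) \<union> (- {0<..<1} \<inter> {m. 0 \<le> y})"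
    using quantile_le_iff by (auto simp: quantile_def)
  also have "\<dots> \<in> sets borel" by measurable
  finally show "{x \<in> space borel. quantile F x \<le> y} \<in> sets borel" .
qed

lemma le_rlim_quantile: "0 < m \<Longrightarrow> m < 1 \<Longrightarrow> m \<le> rlim F (quantile F m)"
  using quantile_le_iff[of m "quantile F m"] by auto

lemma llim_quantile_le: "0 < m \<Longrightarrow> m < 1 \<Longrightarrow> llim F (quantile F m) \<le> m"
proof (rule tendsto_upperbound[OF llim_tendsto])
  assume m: "0 < m" "m < 1"
  have "F y \<le> m" if "y < quantile F m" for y
    using quantile_le_iff[OF m, of y] rlim_ge[of y] that by auto
  then show "\<forall>\<^sub>F x in at_left (quantile F m). F x \<le> m"
    using eventually_at_left_real[of "quantile F m - 1" "quantile F m"] by (auto elim!: eventually_mono)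
qed auto

lemma quantile_eqI:
  assumes "0 < m" "m < 1" "llim F y < m" "m \<le> rlim F y"
  shows "quantile F m = y"
proof (rule antisym)
  show "quantile F m \<le> y" using assms by (simp add: quantile_le_iff)
  show "y \<le> quantile F m"
  proof (rule ccontr)
    assume "\<not> y \<le> quantile F m"
    then have "rlim F (quantile F m) \<le> llim F y" by (intro rlim_le_llim) auto
    then show False using le_rlim_quantile[of m] assms by auto
  qed
qed

lemma quantile_less: "0 < m \<Longrightarrow> m < 1 \<Longrightarrow> m < llim F y \<Longrightarrow> quantile F m < y"
  using llim_quantile_le[of m] quantile_le_iff[of m y] llim_le_rlim[of y]
  by (cases "quantile F m = y") auto

lemma real_distribution_LS: "real_distribution (LS F)"
  unfolding LS_def rlim_def[symmetric]
  by (rule real_distribution_interval_measure) (auto intro: rlim_mono rlim_right_cont G.bot G.top)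

lemma cdf_LS: "cdf (LS F) = rlim F"
  unfolding LS_def rlim_def[symmetric]
  by (rule cdf_interval_measure) (auto intro: rlim_mono rlim_right_cont G.bot)

text \<open>Inverse transform sampling: both measures have the distribution function
  \<open>rlim F\<close>. Integrals against the moving measure thereby become integrals over the
  fixed interval (0,1).\<close>

lemma distr_quantile: "distr (Leb {0<..<1}) borel (quantile F) = LS F"
proof (rule cdf_unique)
  show "real_distribution (distr (Leb {0<..<1}) borel (quantile F))"
    by (auto simp: real_distribution_def real_distribution_axioms_def intro!: L01.prob_space_distr)
  show "real_distribution (LS F)" by (rule real_distribution_LS)
  have "cdf (distr (Leb {0<..<1}) borel (quantile F)) x = rlim F x" for x
  proof -
    have "cdf (distr (Leb {0<..<1}) borel (quantile F)) x = measure (Leb {0<..<1}) {m. quantile F m \<le> x}"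
      by (simp add: cdf_def measure_distr vimage_def)
    also have "\<dots> = integral\<^sup>L (Leb {0<..<1}) (indicator {m. quantile F m \<le> x})"
      by simp
    also have "\<dots> = integral\<^sup>L (Leb {0<..<1}) (indicator {..rlim F x})"
    proof (rule integral_cong_AE)
      show "AE m in Leb {0<..<1}. indicator {m. quantile F m \<le> x} m = (indicator {..rlim F x} m :: real)"
        using AE_Leb01 by eventually_elim (simp add: quantile_le_iff indicator_def)
    qed auto
    also have "\<dots> = rlim F x"
      unfolding Leb01_atMost using rlim_bounds[of x] by simp
    finally show ?thesis .
  qed
  then show "cdf (distr (Leb {0<..<1}) borel (quantile F)) = cdf (LS F)"
    by (auto simp: cdf_LS)
qed

lemma integral_LS:
  fixes f :: "real \<Rightarrow> real"
  assumes "f \<in> borel_measurable borel"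
  shows "integral\<^sup>L (LS F) f = (\<integral>m. f (quantile F m) \<partial>Leb {0<..<1})"
  unfolding distr_quantile[symmetric] using assms by (simp add: integral_distr)

lemma AE_rlim: "AE x in lborel. rlim F x = F x"
proof (rule AE_I'[where N="{x. \<not> isCont F x}"])
  show "{x. \<not> isCont F x} \<in> null_sets lborel"
    by (rule countable_imp_null_set_lborel[OF mono_ctble_discont[OF mono_F]])
  have "rlim F x = F x" if "isCont F x" for x
  proof (rule tendsto_unique[OF _ rlim_tendsto])
    show "(F \<longlongrightarrow> F x) (at_right x)"
      using that unfolding isCont_def by (rule filterlim_mono) (auto simp: at_le)
  qed simp
  then show "{x \<in> space lborel. rlim F x \<noteq> F x} \<subseteq> {x. \<not> isCont F x}" by auto
qed

lemma rlim_meas [measurable]: "rlim F \<in> borel_measurable borel"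
  by (rule borel_measurable_mono) (auto intro: monoI rlim_mono)

lemma llim_meas [measurable]: "llim F \<in> borel_measurable borel"
proof (rule borel_measurable_mono, rule monoI)
  fix x y :: real assume "x \<le> y"
  then show "llim F x \<le> llim F y"
    using llim_le_rlim[of x] rlim_le_llim[of x y] by (cases "x = y") auto
qed

section \<open>Redrawing a level inside its jump\<close>

abbreviation jump_fill :: "real \<Rightarrow> real \<Rightarrow> real" where
  "jump_fill m \<theta> \<equiv> (1 - \<theta>) * llim F (quantile F m) + \<theta> * rlim F (quantile F m)"

text \<open>For uniform \<open>m\<close> and \<open>\<theta>\<close>, \<open>jump_fill\<close>
  redraws the level uniformly within the jump of \<open>F\<close> at \<open>quantile F m\<close>.
  The result is almost surely at most \<open>\<mu>\<close> when \<open>m < l\<close>, almost surely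
  above \<open>\<mu>\<close> when \<open>m > r\<close>, and at most \<open>\<mu>\<close> with
  probability \<open>c\<close> in between, which gives \<open>l + c * (r - l)\<close> in
  total.\<close>

lemma jump_fill_cdf:
  assumes \<mu>: "0 < \<mu>" "\<mu> < 1"
  shows "(\<integral>m. (\<integral>\<theta>. indicator {..\<mu>} (jump_fill m \<theta>) \<partial>Leb {0<..<1}) \<partial>Leb {0<..<1}) = \<mu>"
proof -
  let ?U = "Leb {0<..<1::real}"
  define y where "y = quantile F \<mu>"
  define l where "l = llim F y"
  define r where "r = rlim F y"
  have l: "0 \<le> l" "l \<le> \<mu>" and r: "\<mu> \<le> r" "r \<le> 1"
    using llim_bounds llim_quantile_le[OF \<mu>] le_rlim_quantile[OF \<mu>] rlim_bounds
    by (auto simp: l_def r_def y_def)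
  \<comment> \<open>If \<open>F\<close> does not jump at \<open>y\<close>, then
    \<open>l = \<mu> = r\<close> and division by zero gives \<open>c = 0\<close>, so the formula
    stays correct.\<close>
  define c where "c = (\<mu> - l) / (r - l)"
  note AE01 = AE_Leb01
  have inner: "(\<integral>\<theta>. indicator {..\<mu>} (jump_fill m \<theta>) \<partial>?U) = indicator {..l} m + c * (indicator {..r} m - indicator {..l} m)"
    if m: "0 < m" "m < 1" "m \<noteq> l" for m
  proof -
    let ?q = "quantile F m"
    consider "m < l" | "r < m" | "l < m" "m \<le> r" using m by linarith
    then show ?thesis
    proof cases
      case 1
      then have "?q < y" using m by (intro quantile_less) (auto simp: l_def)
      then have rl: "rlim F ?q \<le> \<mu>" using rlim_le_llim[of ?q y] l by (auto simp: l_def)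
      have "(\<integral>\<theta>. indicator {..\<mu>} (jump_fill m \<theta>) \<partial>?U) = (\<integral>\<theta>. (1::real) \<partial>?U)"
      proof (rule integral_cong_AE)
        show "AE \<theta> in ?U. indicator {..\<mu>} (jump_fill m \<theta>) = (1::real)"
          using AE01
        proof eventually_elim
          case (elim \<theta>)
          have "jump_fill m \<theta> \<le> rlim F ?q"
            using elim llim_le_rlim[of ?q] by (intro convex_bound_le) auto
          then show ?case using rl by simp
        qed
      qed auto
      then show ?thesis using 1 l r m L01.prob_space by (simp add: indicator_def)
    next
      case 2
      then have "y < ?q" using m quantile_le_iff[of m y] by (auto simp: r_def)
      then have ll: "r \<le> llim F ?q" using rlim_le_llim[of y ?q] by (auto simp: r_def)
      \<comment> \<open>\<open>llim F ?q\<close> may equal \<open>\<mu>\<close>; the strict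
        inequality comes from \<open>rlim F ?q > r\<close> together with
        \<open>\<theta> > 0\<close>.\<close>
      have rr: "m \<le> rlim F ?q" using m le_rlim_quantile by auto
      have "(\<integral>\<theta>. indicator {..\<mu>} (jump_fill m \<theta>) \<partial>?U) = (\<integral>\<theta>. (0::real) \<partial>?U)"
      proof (rule integral_cong_AE)
        show "AE \<theta> in ?U. indicator {..\<mu>} (jump_fill m \<theta>) = (0::real)"
          using AE01
        proof eventually_elim
          case (elim \<theta>)
          have "(1 - \<theta>) * r \<le> (1 - \<theta>) * llim F ?q"
            using elim ll by (intro mult_left_mono) auto
          moreover have "\<theta> * r < \<theta> * rlim F ?q"
            using elim rr 2 by (intro mult_strict_left_mono) auto
          ultimately have "(1 - \<theta>) * r + \<theta> * r < jump_fill m \<theta>" by (rule add_le_less_mono)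
          then have "r < jump_fill m \<theta>" by (simp add: algebra_simps)
          then show ?case using r by simp
        qed
      qed auto
      then show ?thesis using 2 l r by simp
    next
      case 3
      then have q: "?q = y" using m by (intro quantile_eqI) (auto simp: l_def r_def)
      have "(\<integral>\<theta>. indicator {..\<mu>} (jump_fill m \<theta>) \<partial>?U) = (integral\<^sup>L ?U (indicator {..c}) :: real)"
      proof (rule Bochner_Integration.integral_cong)
        fix \<theta>
        have "jump_fill m \<theta> \<le> \<mu> \<longleftrightarrow> \<theta> \<le> c"
          unfolding q l_def[symmetric] r_def[symmetric] c_def using 3 by (simp add: field_simps)
        then show "indicator {..\<mu>} (jump_fill m \<theta>) = (indicator {..c} \<theta> :: real)"
          by (simp add: indicator_def)
      qed simp
      also have "\<dots> = c"
        unfolding Leb01_atMost using l r 3 by (auto simp: c_def)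
      finally show ?thesis using 3 l r by simp
    qed
  qed
  have "(\<integral>m. (\<integral>\<theta>. indicator {..\<mu>} (jump_fill m \<theta>) \<partial>?U) \<partial>?U) =
      (\<integral>m. indicator {..l} m + c * (indicator {..r} m - indicator {..l} m) \<partial>?U)"
  proof (rule integral_cong_AE)
    have "AE m in ?U. m \<noteq> l"
      unfolding AE_Leb[OF open_greaterThanLessThan[THEN borel_open]] using AE_lborel_singleton[of l] by auto
    then show "AE m in ?U. (\<integral>\<theta>. indicator {..\<mu>} (jump_fill m \<theta>) \<partial>?U) = indicator {..l} m + c * (indicator {..r} m - indicator {..l} m)"
      using AE01 by eventually_elim (rule inner, simp_all)
  qed measurable
  also have "\<dots> = integral\<^sup>L ?U (indicator {..l}) + c * (integral\<^sup>L ?U (indicator {..r}) - integral\<^sup>L ?U (indicator {..l}))"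
    by (simp add: L01.emeasure_finite less_top[symmetric])
  also have "\<dots> = \<mu>"
    unfolding Leb01_atMost using l r \<mu> by (auto simp: c_def)
  finally show ?thesis .
qed

end

abbreviation U01 :: "real measure" where "U01 \<equiv> Leb {0<..<1}"

lemma integrable_U01:
  fixes f :: "real \<Rightarrow> real"
  assumes "f \<in> borel_measurable borel" "\<And>x. \<bar>f x\<bar> \<le> B"
  shows "integrable U01 f"
  by (rule borel_measurable_bounded_integrable[OF L01.finite_measure _ assms(2)]) (simp add: assms)

lemma real_distribution_U01: "real_distribution U01"
  using prob_space_Leb01 by (simp add: real_distribution_def real_distribution_axioms_def)

lemma cdf_U01: "cdf U01 x = min 1 (max 0 x)"
  using Leb01_atMost[of x] by (simp add: cdf_def)

context step_cdf begin

text \<open>Redrawing a level within its jump preserves the uniform law. The distribution functions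
  agree on (0,1) by \<open>jump_fill_cdf\<close>; monotonicity and the bounds 0 and 1 settle the
  remaining arguments.\<close>

lemma distr_jump_fill: "distr (U01 \<Otimes>\<^sub>M U01) borel (\<lambda>(m, \<theta>). jump_fill m \<theta>) = U01"
proof (rule cdf_unique)
  interpret P: pair_prob_space U01 U01 ..
  let ?D = "distr (U01 \<Otimes>\<^sub>M U01) borel (\<lambda>(m, \<theta>). jump_fill m \<theta>)"
  have [measurable]: "(\<lambda>(m, \<theta>). jump_fill m \<theta>) \<in> borel_measurable (U01 \<Otimes>\<^sub>M U01)"
    by measurable
  have rd: "real_distribution ?D"
    by (auto simp: real_distribution_def real_distribution_axioms_def intro!: P.prob_space_distr)
  then show "real_distribution ?D" .
  interpret D: real_distribution ?D by (rule rd)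
  show "real_distribution U01" by (rule real_distribution_U01)
  have mid: "cdf ?D \<mu> = \<mu>" if \<mu>: "0 < \<mu>" "\<mu> < 1" for \<mu>
  proof -
    have "cdf ?D \<mu> = measure (U01 \<Otimes>\<^sub>M U01) {p. jump_fill (fst p) (snd p) \<le> \<mu>}"
      by (simp add: cdf_def measure_distr vimage_def space_pair_measure split_beta)
    also have "\<dots> = (\<integral>p. indicator {p. jump_fill (fst p) (snd p) \<le> \<mu>} p \<partial>(U01 \<Otimes>\<^sub>M U01))"
      by (simp add: space_pair_measure)
    also have "\<dots> = (\<integral>p. (\<lambda>(m, \<theta>). indicator {..\<mu>} (jump_fill m \<theta>)) p \<partial>(U01 \<Otimes>\<^sub>M U01))"
      by (rule Bochner_Integration.integral_cong) (auto simp: indicator_def)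
    also have "\<dots> = (\<integral>m. (\<integral>\<theta>. indicator {..\<mu>} (jump_fill m \<theta>) \<partial>U01) \<partial>U01)"
      by (subst P.integral_fst[symmetric])
         (auto intro!: P.P.integrable_const_bound[where B=1] simp: split_beta)
    also have "\<dots> = \<mu>" by (rule jump_fill_cdf[OF \<mu>])
    finally show ?thesis .
  qed
  have lo: "cdf ?D \<mu> = 0" if "\<mu> \<le> 0" for \<mu>
  proof (rule antisym)
    show "cdf ?D \<mu> \<le> 0"
    proof (rule field_le_epsilon)
      fix e :: real assume e: "0 < e"
      have "cdf ?D \<mu> \<le> cdf ?D (min e (1/2))"
        by (rule D.cdf_nondecreasing) (use that e in auto)
      then show "cdf ?D \<mu> \<le> 0 + e" using mid[of "min e (1/2)"] e by auto
    qed
  qed (rule D.cdf_nonneg)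
  have hi: "cdf ?D \<mu> = 1" if "1 \<le> \<mu>" for \<mu>
  proof (rule antisym)
    show "1 \<le> cdf ?D \<mu>"
    proof (rule field_le_epsilon)
      fix e :: real assume e: "0 < e"
      have "cdf ?D (max (1 - e) (1/2)) \<le> cdf ?D \<mu>"
        by (rule D.cdf_nondecreasing) (use that e in auto)
      then show "1 \<le> cdf ?D \<mu> + e" using mid[of "max (1 - e) (1/2)"] e by auto
    qed
  qed (rule D.cdf_bounded_prob)
  show "cdf ?D = cdf U01"
  proof
    fix \<mu>
    show "cdf ?D \<mu> = cdf U01 \<mu>"
      using mid[of \<mu>] lo[of \<mu>] hi[of \<mu>] unfolding cdf_U01 by linarith
  qed
qed

text \<open>A redrawn level lies strictly inside the same jump; if there is no jump it is
  \<open>m\<close> itself.\<close>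

lemma quantile_jump_fill:
  assumes m: "0 < m" "m < 1" and \<theta>: "0 < \<theta>" "\<theta> < 1"
  shows "quantile F (jump_fill m \<theta>) = quantile F m"
proof (cases "llim F (quantile F m) = rlim F (quantile F m)")
  case True
  then have "m = llim F (quantile F m)"
    using le_rlim_quantile[OF m] llim_quantile_le[OF m] by simp
  moreover have "jump_fill m \<theta> = llim F (quantile F m)"
    using True by (simp add: algebra_simps)
  ultimately show ?thesis by simp
next
  case False
  let ?l = "llim F (quantile F m)" and ?r = "rlim F (quantile F m)"
  have lr: "?l < ?r" using False llim_le_rlim[of "quantile F m"] by simp
  have "0 < \<theta> * (?r - ?l)" "0 < (1 - \<theta>) * (?r - ?l)" using lr \<theta> by simp_all
  then have "?l < jump_fill m \<theta>" "jump_fill m \<theta> < ?r"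
    by (simp_all add: algebra_simps)
  then show ?thesis
    using llim_bounds[of "quantile F m"] rlim_bounds[of "quantile F m"]
    by (intro quantile_eqI) auto
qed

text \<open>Averaging over jumps is the conditional expectation given the quantile.\<close>

lemma integral_jump_avg:
  fixes a g :: "real \<Rightarrow> real"
  assumes [measurable]: "a \<in> borel_measurable borel" "g \<in> borel_measurable borel"
    and a: "\<And>m. \<bar>a m\<bar> \<le> K" and g: "\<And>x. \<bar>g x\<bar> \<le> B"
  shows "(\<integral>m. g (quantile F m) * a m \<partial>U01) = (\<integral>m. g (quantile F m) * jump_avg a F (quantile F m) \<partial>U01)"
proof -
  interpret P: pair_prob_space U01 U01 ..
  have b: "\<bar>g x * a y\<bar> \<le> B * K" for x y
    unfolding abs_mult using a[of y] g[of x] by (intro mult_mono) auto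
  \<comment> \<open>Replace \<open>m\<close> by the redrawn level, which has the same law and almost
    surely the same quantile; integrating out \<open>\<theta>\<close> then averages \<open>a\<close>
    alone.\<close>
  have "(\<integral>m. g (quantile F m) * a m \<partial>U01) = (\<integral>m. g (quantile F m) * a m \<partial>(distr (U01 \<Otimes>\<^sub>M U01) borel (\<lambda>(m, \<theta>). jump_fill m \<theta>)))"
    unfolding distr_jump_fill ..
  also have "\<dots> = (\<integral>p. (\<lambda>(m, \<theta>). g (quantile F (jump_fill m \<theta>)) * a (jump_fill m \<theta>)) p \<partial>(U01 \<Otimes>\<^sub>M U01))"
    by (subst integral_distr) (measurable, simp add: case_prod_unfold)
  also have "\<dots> = (\<integral>m. (\<integral>\<theta>. g (quantile F (jump_fill m \<theta>)) * a (jump_fill m \<theta>) \<partial>U01) \<partial>U01)"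
    by (subst P.integral_fst[symmetric])
       (auto intro!: P.P.integrable_const_bound[where B="B * K"] b simp: split_beta)
  also have "\<dots> = (\<integral>m. g (quantile F m) * jump_avg a F (quantile F m) \<partial>U01)"
  proof (rule integral_cong_AE)
    show "AE m in U01. (\<integral>\<theta>. g (quantile F (jump_fill m \<theta>)) * a (jump_fill m \<theta>) \<partial>U01) =
        g (quantile F m) * jump_avg a F (quantile F m)"
      using AE_Leb01
    proof eventually_elim
      case (elim m)
      have "(\<integral>\<theta>. g (quantile F (jump_fill m \<theta>)) * a (jump_fill m \<theta>) \<partial>U01) = (\<integral>\<theta>. g (quantile F m) * a (jump_fill m \<theta>) \<partial>U01)"
      proof (rule integral_cong_AE)
        show "AE \<theta> in U01. g (quantile F (jump_fill m \<theta>)) * a (jump_fill m \<theta>) = g (quantile F m) * a (jump_fill m \<theta>)"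
          using AE_Leb01 by eventually_elim (use elim quantile_jump_fill[of m] in simp)
      qed measurable
      then show ?case by (simp add: jump_avg_def)
    qed
  next
    show "(\<lambda>m. g (quantile F m) * jump_avg a F (quantile F m)) \<in> borel_measurable U01"
      unfolding jump_avg_def by measurable
  qed measurable
  finally show ?thesis .
qed

section \<open>Limits of Steklov averages at a jump\<close>

lemma F_seq_tendsto:
  "c < 0 \<Longrightarrow> (\<lambda>n. F (y + c / real (Suc n))) \<longlonglongrightarrow> llim F y"
  "c > 0 \<Longrightarrow> (\<lambda>n. F (y + c / real (Suc n))) \<longlonglongrightarrow> rlim F y"
  by (rule filterlim_compose[OF llim_tendsto filterlim_at_left_seq] filterlim_compose[OF rlim_tendsto filterlim_at_right_seq]; simp)+

lemma steklov_tendsto_rlim: "(\<lambda>n. \<integral>r. F (x + r / real (Suc n)) \<partial>U01) \<longlonglongrightarrow> rlim F x"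
proof -
  have "(\<lambda>n. \<integral>r. F (x + r / real (Suc n)) \<partial>U01) \<longlonglongrightarrow> (\<integral>r. rlim F x \<partial>U01)"
  proof (rule integral_dominated_convergence[where w="\<lambda>_. 1"])
    show "AE r in U01. (\<lambda>n. F (x + r / real (Suc n))) \<longlonglongrightarrow> rlim F x"
      using AE_Leb01 by eventually_elim (simp add: F_seq_tendsto del: of_nat_Suc)
  qed (use F_bounds in \<open>auto simp: abs_le_iff intro!: AE_I2 order_trans[OF _ F_bounds(1)]\<close>)
  then show ?thesis using L01.prob_space by simp
qed

text \<open>The window of length \<open>1 / Suc n\<close> starts at
  \<open>y + (\<theta> - 1) / Suc n\<close>: a fraction \<open>1 - \<theta>\<close> of it lies to
  the left of \<open>y\<close> and a fraction \<open>\<theta>\<close> to the right, which explains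
  the weights.\<close>

lemma steklov_tendsto_jump:
  assumes \<theta>: "0 < \<theta>" "\<theta> < 1"
  shows "(\<lambda>n. \<integral>r. F (y + (\<theta> - 1 + r) / real (Suc n)) \<partial>U01) \<longlonglongrightarrow> (1 - \<theta>) * llim F y + \<theta> * rlim F y"
proof -
  let ?i = "indicator {..1 - \<theta>} :: real \<Rightarrow> real"
  have "(\<lambda>n. \<integral>r. F (y + (\<theta> - 1 + r) / real (Suc n)) \<partial>U01) \<longlonglongrightarrow> (\<integral>r. rlim F y + ?i r * (llim F y - rlim F y) \<partial>U01)"
  proof (rule integral_dominated_convergence[where w="\<lambda>_. 1"])
    have "AE r in U01. r \<noteq> 1 - \<theta>"
      unfolding AE_Leb[OF open_greaterThanLessThan[THEN borel_open]] using AE_lborel_singleton[of "1 - \<theta>"] by (rule eventually_mono) simp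
    then show "AE r in U01. (\<lambda>n. F (y + (\<theta> - 1 + r) / real (Suc n))) \<longlonglongrightarrow> rlim F y + ?i r * (llim F y - rlim F y)"
    proof eventually_elim
      case (elim r)
      then show ?case
        using F_seq_tendsto(1)[of "\<theta> - 1 + r" y] F_seq_tendsto(2)[of "\<theta> - 1 + r" y]
        by (cases "r \<le> 1 - \<theta>") (simp_all del: of_nat_Suc)
    qed
  qed (use F_bounds in \<open>auto simp: abs_le_iff intro!: AE_I2 order_trans[OF _ F_bounds(1)]\<close>)
  moreover have "(\<integral>r. rlim F y + ?i r * (llim F y - rlim F y) \<partial>U01) = rlim F y + (1 - \<theta>) * (llim F y - rlim F y)"
  proof -
    have "integral\<^sup>L U01 ?i = 1 - \<theta>" unfolding Leb01_atMost using \<theta> by simp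
    moreover have "integrable U01 ?i" by (rule integrable_U01[where B=1]) (auto simp: indicator_def)
    ultimately show ?thesis using L01.prob_space by simp
  qed
  moreover have "rlim F y + (1 - \<theta>) * (llim F y - rlim F y) = (1 - \<theta>) * llim F y + \<theta> * rlim F y"
    by (simp add: algebra_simps)
  ultimately show ?thesis by (simp only:)
qed

text \<open>\<open>g\<close> acts after the averaging in space. As the window slides across
  \<open>y\<close>, the limits of the averages run through the jump at constant speed, so the mean
  of \<open>g\<close> over window positions becomes its mean over the jump.\<close>

lemma steklov_tendsto_jump_avg:
  assumes g: "continuous_on UNIV g" and B: "\<And>x. \<bar>g x\<bar> \<le> B"
  shows "(\<lambda>n. \<integral>\<theta>. g (\<integral>r. F (y + (\<theta> - 1 + r) / real (Suc n)) \<partial>U01) \<partial>U01) \<longlonglongrightarrow> jump_avg g F y"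
  unfolding jump_avg_def
proof (rule integral_dominated_convergence[where w="\<lambda>_. B"])
  have [measurable]: "g \<in> borel_measurable borel" by (rule borel_measurable_continuous_onI[OF g])
  show "(\<lambda>\<theta>. g ((1 - \<theta>) * llim F y + \<theta> * rlim F y)) \<in> borel_measurable U01" by measurable
  show "(\<lambda>\<theta>. g (\<integral>r. F (y + (\<theta> - 1 + r) / real (Suc n)) \<partial>U01)) \<in> borel_measurable U01" for n by measurable
  show "AE \<theta> in U01. (\<lambda>n. g (\<integral>r. F (y + (\<theta> - 1 + r) / real (Suc n)) \<partial>U01)) \<longlonglongrightarrow> g ((1 - \<theta>) * llim F y + \<theta> * rlim F y)"
    using AE_Leb01 by eventually_elim (rule continuous_on_tendsto_compose[OF g steklov_tendsto_jump], auto)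
qed (use B in auto)

text \<open>For almost every \<open>x\<close>, \<open>m \<le> F x\<close> holds exactly when
  \<open>quantile F m \<le> x\<close>; the rest is Fubini. The inner integral on the left is a
  primitive of \<open>a\<close> evaluated at \<open>F x\<close>. The formula serves for
  \<open>M\<close> itself, for the flux \<open>A(M)\<close> and for \<open>G(M)\<close>.\<close>

lemma layer_cake:
  fixes a k :: "real \<Rightarrow> real"
  assumes k: "integrable lborel k" and [measurable]: "a \<in> borel_measurable borel" and a: "\<And>m. \<bar>a m\<bar> \<le> K"
  shows "(\<integral>x. (\<integral>m. a m * indicator {..F x} m \<partial>U01) * k x \<partial>lborel) = (\<integral>m. a m * (\<integral>x. indicator {quantile F m..} x * k x \<partial>lborel) \<partial>U01)"
proof -
  interpret P: pair_sigma_finite lborel U01 ..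
  have [measurable]: "k \<in> borel_measurable borel" using borel_measurable_integrable[OF k] by simp
  have "(\<integral>x. (\<integral>m. a m * indicator {..F x} m \<partial>U01) * k x \<partial>lborel) = (\<integral>x. (\<integral>m. a m * indicator {quantile F m..} x * k x \<partial>U01) \<partial>lborel)"
  proof (rule integral_cong_AE)
    show "AE x in lborel. (\<integral>m. a m * indicator {..F x} m \<partial>U01) * k x = (\<integral>m. a m * indicator {quantile F m..} x * k x \<partial>U01)"
      using AE_rlim
    proof eventually_elim
      case (elim x)
      have "(\<integral>m. a m * indicator {..F x} m \<partial>U01) = (\<integral>m. a m * indicator {quantile F m..} x \<partial>U01)"
      proof (rule integral_cong_AE)
        show "AE m in U01. a m * indicator {..F x} m = a m * indicator {quantile F m..} x"
          using AE_Leb01 by eventually_elim (simp add: indicator_def quantile_le_iff elim)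
      qed (unfold indicator_def atLeast_iff atMost_iff, measurable)
      then show ?case by simp
    qed
  qed (unfold indicator_def atLeast_iff atMost_iff, measurable)
  also have "\<dots> = (\<integral>m. (\<integral>x. a m * indicator {quantile F m..} x * k x \<partial>lborel) \<partial>U01)"
  proof (rule P.Fubini_integral[symmetric])
    have "integrable (lborel \<Otimes>\<^sub>M U01) (\<lambda>(x, m). K * \<bar>k x\<bar>)"
      by (rule P.Fubini_integrable) (use k L01.prob_space in \<open>auto simp: abs_mult\<close>)
    then show "integrable (lborel \<Otimes>\<^sub>M U01) (\<lambda>(x, m). a m * indicator {quantile F m..} x * k x)"
    proof (rule Bochner_Integration.integrable_bound)
      show "AE p in lborel \<Otimes>\<^sub>M U01. norm (case p of (x, m) \<Rightarrow> a m * indicator {quantile F m..} x * k x) \<le> norm (case p of (x, m) \<Rightarrow> K * \<bar>k x\<bar>)"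
        using a order_trans[OF abs_ge_zero a] by (auto intro!: AE_I2 mult_right_mono simp: abs_mult indicator_def split_beta)
    qed (unfold indicator_def atLeast_iff atMost_iff, measurable)
  qed
  finally show ?thesis by (simp add: mult.assoc)
qed

end

lemma integral_tail_derivative:
  fixes f f' :: "real \<Rightarrow> real"
  assumes f: "\<And>x. (f has_real_derivative f' x) (at x)" "continuous_on UNIV f'"
    and b: "\<And>x. b \<le> x \<Longrightarrow> f x = 0 \<and> f' x = 0"
  shows "(\<integral>x. indicator {q..} x * f' x \<partial>lborel) = - f q"
proof -
  define c where "c = max b q"
  have "(\<integral>x. indicator {q..} x * f' x \<partial>lborel) = (\<integral>x. indicator {q..c} x * f' x \<partial>lborel)"
    by (rule Bochner_Integration.integral_cong) (use b in \<open>auto simp: indicator_def c_def\<close>)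
  also have "\<dots> = (LBINT x=q..c. f' x)"
  proof -
    have "q \<le> c" by (simp add: c_def)
    then show ?thesis by (simp add: interval_integral_Icc set_lebesgue_integral_def)
  qed
  also have "\<dots> = f c - f q" by (rule interval_integral_antiderivative[OF f])
  finally show ?thesis using b[of c] by (simp add: c_def)
qed

section \<open>Smooth pulses and test functions\<close>

definition smooth1 :: "(real \<Rightarrow> real) \<Rightarrow> bool" where
  "smooth1 f \<longleftrightarrow> (\<forall>n x. (deriv ^^ n) f differentiable (at x))"

text \<open>A coinduction principle: a family that contains a derivative of each of its members
  contains all iterated derivatives, so these never have to be computed.\<close>

lemma smooth1_family:
  fixes \<F> :: "(real \<Rightarrow> real) set"
  assumes "f \<in> \<F>" and *: "\<And>g. g \<in> \<F> \<Longrightarrow> \<exists>g'\<in>\<F>. \<forall>x. (g has_real_derivative g' x) (at x)"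
  shows "smooth1 f"
proof -
  have d: "deriv g \<in> \<F>" if g: "g \<in> \<F>" for g
  proof -
    obtain g' where "g' \<in> \<F>" "\<And>x. (g has_real_derivative g' x) (at x)" using *[OF g] by blast
    moreover from this have "deriv g = g'" by (auto intro: DERIV_imp_deriv)
    ultimately show ?thesis by simp
  qed
  have "(deriv ^^ n) f \<in> \<F>" for n
    by (induction n) (auto simp: assms d)
  then show ?thesis
    unfolding smooth1_def using * real_differentiable_def by blast
qed

lemma smooth1_D:
  assumes "smooth1 f"
  shows "((deriv ^^ n) f has_real_derivative (deriv ^^ Suc n) f x) (at x)"
  using assms unfolding smooth1_def by (simp add: DERIV_deriv_iff_real_differentiable)

lemma smooth1_continuous:
  assumes "smooth1 f"
  shows "continuous_on A ((deriv ^^ n) f)"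
  using smooth1_D[OF assms, of n] by (meson DERIV_isCont continuous_at_imp_continuous_on)

lemma smooth1_affine_diff:
  assumes f: "smooth1 f"
  shows "smooth1 (\<lambda>x. f (c * (x - a)) - f (c * (x - b)))"
proof -
  \<comment> \<open>\<open>n\<close> counts derivatives and \<open>d\<close> collects the factors
    \<open>c\<close> that the chain rule produces.\<close>
  let ?\<F> = "range (\<lambda>(n, d). \<lambda>x. d * ((deriv ^^ n) f (c * (x - a)) - (deriv ^^ n) f (c * (x - b))))"
  show ?thesis
  proof (rule smooth1_family[where \<F>="?\<F>"])
    show "(\<lambda>x. f (c * (x - a)) - f (c * (x - b))) \<in> ?\<F>"
      by (rule image_eqI[of _ _ "(0, 1)"]) auto
    fix g assume "g \<in> ?\<F>"
    then obtain n d where g: "g = (\<lambda>x. d * ((deriv ^^ n) f (c * (x - a)) - (deriv ^^ n) f (c * (x - b))))" by auto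
    have 1: "((\<lambda>x. (deriv ^^ n) f (c * (x - a))) has_real_derivative (deriv ^^ Suc n) f (c * (x - a)) * c) (at x)" for x a
      by (rule DERIV_chain2[OF smooth1_D[OF f]]) (auto intro!: derivative_eq_intros)
    show "\<exists>g'\<in>?\<F>. \<forall>x. (g has_real_derivative g' x) (at x)"
    proof (intro bexI allI)
      fix x
      show "(g has_real_derivative (d * c) * ((deriv ^^ Suc n) f (c * (x - a)) - (deriv ^^ Suc n) f (c * (x - b)))) (at x)"
        unfolding g using DERIV_cmult[OF DERIV_diff[OF 1[of a x] 1[of b x]], of d] by (simp add: algebra_simps)
    qed (auto intro!: image_eqI[of _ _ "(Suc n, d * c)"])
  qed
qed

text \<open>The polynomial factor in \<open>1 / x\<close> makes the class of these functions closed
  under differentiation.\<close>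

definition flat_exp :: "real poly \<Rightarrow> real \<Rightarrow> real" where
  "flat_exp p x = (if 0 < x then poly p (1 / x) * exp (- (1 / x)) else 0)"

lemma poly_exp_tendsto_0: "((\<lambda>y. y ^ k * poly p y * exp (- y)) \<longlongrightarrow> (0::real)) at_top"
proof (induction p arbitrary: k)
  case 0
  then show ?case by simp
next
  case (pCons a p)
  have "((\<lambda>y. a * (y ^ k / exp y) + y ^ Suc k * poly p y * exp (- y)) \<longlongrightarrow> a * 0 + 0) at_top"
    by (intro tendsto_intros pCons.IH tendsto_power_div_exp_0)
  then show ?case by (simp add: algebra_simps exp_minus divide_inverse)
qed

text \<open>With \<open>y = 1 / x\<close> the derivative in \<open>x\<close> is
  \<open>- y * y\<close> times the derivative in \<open>y\<close>, which turns \<open>p\<close> into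
  \<open>y * y * (p - p')\<close>; the factor \<open>[:0, 0, 1:]\<close> is \<open>y * y\<close>. At
  0 the exponential beats every polynomial.\<close>

lemma flat_exp_deriv:
  "(flat_exp p has_real_derivative flat_exp ([:0, 0, 1:] * (p - pderiv p)) x) (at x)"
proof -
  consider "x < 0" | "x = 0" | "0 < x" by linarith
  then show ?thesis
  proof cases
    case 1
    have "((\<lambda>_. 0) has_real_derivative 0) (at x)" by simp
    then have "(flat_exp p has_real_derivative 0) (at x)"
    proof (rule has_field_derivative_transform_within_open[where S="{..<0}"])
    qed (use 1 in \<open>auto simp: flat_exp_def\<close>)
    then show ?thesis using 1 by (simp add: flat_exp_def)
  next
    case 2
    have "((\<lambda>h. flat_exp p h / h) \<longlongrightarrow> 0) (at 0)"
    proof (rule filterlim_split_at)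
      show "((\<lambda>h. flat_exp p h / h) \<longlongrightarrow> 0) (at_left 0)"
      proof (rule tendsto_eventually)
        show "\<forall>\<^sub>F h in at_left 0. flat_exp p h / h = 0"
          using eventually_at_left_real[of "-1" 0] by (rule eventually_mono) (auto simp: flat_exp_def)
      qed
      have "((\<lambda>h. (\<lambda>y. y ^ 1 * poly p y * exp (- y)) (inverse h)) \<longlongrightarrow> 0) (at_right 0)"
        by (rule filterlim_compose[OF poly_exp_tendsto_0 filterlim_inverse_at_top_right])
      then show "((\<lambda>h. flat_exp p h / h) \<longlongrightarrow> 0) (at_right 0)"
      proof (rule Lim_transform_eventually)
        show "\<forall>\<^sub>F h in at_right 0. (\<lambda>y. y ^ 1 * poly p y * exp (- y)) (inverse h) = flat_exp p h / h"
          using eventually_at_right_less[of 0] by (rule eventually_mono) (simp add: flat_exp_def field_simps)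
      qed
    qed
    then show ?thesis using 2 by (simp add: DERIV_def flat_exp_def)
  next
    case 3
    have "((\<lambda>x. poly p (1 / x) * exp (- (1 / x))) has_real_derivative flat_exp ([:0, 0, 1:] * (p - pderiv p)) x) (at x)"
    proof -
      have i: "((\<lambda>x. 1 / x) has_real_derivative - (1 / x\<^sup>2)) (at x)"
        using 3 by (auto intro!: derivative_eq_intros simp: power2_eq_square)
      show ?thesis
        by (rule derivative_eq_intros DERIV_chain2[OF poly_DERIV i] DERIV_chain2[OF DERIV_exp DERIV_minus[OF i]] refl)+
           (use 3 in \<open>simp add: flat_exp_def field_simps power2_eq_square\<close>)
    qed
    then show ?thesis
      by (rule has_field_derivative_transform_within_open[where S="{0<..}"]) (use 3 in \<open>auto simp: flat_exp_def\<close>)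
  qed
qed

text \<open>Functions that vanish outside (0,1) and are flat at both ends; closing products under
  sums makes the product rule stay in the class.\<close>

inductive_set bumps :: "(real \<Rightarrow> real) set" where
  prod: "(\<lambda>x. flat_exp p x * flat_exp q (1 - x)) \<in> bumps"
| add: "f \<in> bumps \<Longrightarrow> g \<in> bumps \<Longrightarrow> (\<lambda>x. f x + g x) \<in> bumps"

lemma bumps_deriv: "g \<in> bumps \<Longrightarrow> \<exists>g'\<in>bumps. \<forall>x. (g has_real_derivative g' x) (at x)"
proof (induction rule: bumps.induct)
  case (prod p q)
  let ?D = "\<lambda>p. [:0, 0, 1:] * (p - pderiv p)"
  have 1: "((\<lambda>x. flat_exp q (1 - x)) has_real_derivative flat_exp (?D q) (1 - x) * (-1)) (at x)" for x
    by (rule DERIV_chain2[OF flat_exp_deriv]) (auto intro!: derivative_eq_intros)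
  \<comment> \<open>The sign from the inner derivative of \<open>1 - x\<close> is absorbed into the
    polynomial.\<close>
  have m: "flat_exp (?D q) y * (-1) = flat_exp (- ?D q) y" for y by (simp only: flat_exp_def poly_minus) simp
  have "((\<lambda>x. flat_exp p x * flat_exp q (1 - x)) has_real_derivative
      flat_exp (?D p) x * flat_exp q (1 - x) + flat_exp p x * flat_exp (- ?D q) (1 - x)) (at x)" for x
    using DERIV_mult[OF flat_exp_deriv[of p] 1[unfolded m], of x] by (simp only: mult.commute add.commute)
  moreover have "(\<lambda>x. flat_exp (?D p) x * flat_exp q (1 - x) + flat_exp p x * flat_exp (- ?D q) (1 - x)) \<in> bumps"
    by (intro bumps.intros)
  ultimately show ?case by (intro bexI[rotated]) auto
next
  case (add f g)
  then obtain f' g' where *: "f' \<in> bumps" "g' \<in> bumps"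
    and d: "\<And>x. (f has_real_derivative f' x) (at x)" "\<And>x. (g has_real_derivative g' x) (at x)" by blast
  show ?case
    by (rule bexI[OF _ bumps.add[OF *]]) (auto intro!: derivative_intros d)
qed

lemma smooth_step_exists:
  obtains S S' :: "real \<Rightarrow> real" where "smooth1 S" "\<And>x. (S has_real_derivative S' x) (at x)" "continuous_on UNIV S'"
    "\<And>x. x \<le> 0 \<Longrightarrow> S x = 0" "\<And>x. 1 \<le> x \<Longrightarrow> S x = 1" "mono S" "\<And>x. 0 \<le> S' x" "\<And>x. x \<notin> {0..1} \<Longrightarrow> S' x = 0"
proof -
  define \<beta> where "\<beta> x = flat_exp 1 x * flat_exp 1 (1 - x)" for x
  have \<beta>: "\<beta> \<in> bumps" unfolding \<beta>_def[abs_def] by (rule bumps.prod)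
  have \<beta>pos: "0 < \<beta> x" if "0 < x" "x < 1" for x using that by (simp add: \<beta>_def flat_exp_def)
  have \<beta>0: "\<beta> x = 0" if "x \<le> 0 \<or> 1 \<le> x" for x using that by (auto simp: \<beta>_def flat_exp_def)
  have \<beta>nn: "0 \<le> \<beta> x" for x by (simp add: \<beta>_def flat_exp_def)
  have \<beta>c: "continuous_on UNIV \<beta>"
    using bumps_deriv[OF \<beta>] by (meson DERIV_isCont continuous_at_imp_continuous_on)
  obtain G where G: "\<And>x. (G has_real_derivative \<beta> x) (at x)"
    using continuous_imp_antiderivative[OF \<beta>c] by blast
  have Gc: "continuous_on A G" for A using G by (meson DERIV_isCont continuous_at_imp_continuous_on)
  define Z where "Z = G 1 - G 0"
  have Z: "0 < Z"
    using DERIV_pos_imp_increasing_open[of 0 1 G] G \<beta>pos Gc by (fastforce simp: Z_def)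
  define S where "S x = (G x - G 0) / Z" for x
  define S' where "S' x = \<beta> x / Z" for x
  have S: "(S has_real_derivative S' x) (at x)" for x
    unfolding S_def[abs_def] S'_def using Z by (auto intro!: derivative_eq_intros G)
  have S'B: "S' \<in> bumps"
  proof -
    \<comment> \<open>The normalising factor is absorbed into a constant polynomial, so
      \<open>S'\<close> is again a bump.\<close>
    have "S' = (\<lambda>x. flat_exp [:1 / Z:] x * flat_exp 1 (1 - x))"
      by (auto simp: S'_def \<beta>_def flat_exp_def fun_eq_iff)
    then show ?thesis by (simp add: bumps.prod)
  qed
  have "smooth1 S"
    by (rule smooth1_family[where \<F>="insert S bumps"]) (use S S'B bumps_deriv in auto)
  moreover have "S x = 0" if "x \<le> 0" for x
  proof -
    have "(G has_real_derivative 0) (at z)" if "z < 0" for z using G[of z] \<beta>0[of z] that by simp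
    then show ?thesis
      using DERIV_isconst_end[of x 0 G] that Gc by (cases "x = 0") (auto simp: S_def)
  qed
  moreover have "S x = 1" if "1 \<le> x" for x
  proof -
    have "(G has_real_derivative 0) (at z)" if "1 < z" for z using G[of z] \<beta>0[of z] that by simp
    then show ?thesis
      using DERIV_isconst_end[of 1 x G] that Gc Z by (cases "x = 1") (auto simp: S_def Z_def)
  qed
  moreover have S'nn: "0 \<le> S' x" for x using \<beta>nn Z by (simp add: S'_def)
  moreover have "mono S"
    by (rule monoI, rule DERIV_nonneg_imp_nondecreasing) (use S S'nn in auto)
  moreover have "continuous_on UNIV S'"
    unfolding S'_def[abs_def] using Z by (intro continuous_intros \<beta>c) auto
  moreover have "S' x = 0" if "x \<notin> {0..1}" for x
    using \<beta>0[of x] that by (auto simp: S'_def)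
  ultimately show ?thesis using that S by blast
qed

text \<open>Both edges lie to the right of their endpoints, within distance
  \<open>1 / Suc n\<close>. Therefore the limit is the indicator of a half-open interval, and
  \<open>f' n\<close> tends to a unit mass at \<open>a\<close> minus one at \<open>b\<close>, tested
  on functions that are continuous from the right there.\<close>

lemma smooth_pulses:
  fixes a b :: real
  assumes ab: "a < b"
  obtains f f' :: "nat \<Rightarrow> real \<Rightarrow> real" where "\<And>n. smooth1 (f n)"
    "\<And>n x. (f n has_real_derivative f' n x) (at x)" "\<And>n. continuous_on UNIV (f' n)"
    "\<And>n x. 0 \<le> f n x" "\<And>n x. f n x \<le> 1"
    "\<And>n x. x < a \<or> b + 1 / real (Suc n) < x \<Longrightarrow> f n x = 0 \<and> f' n x = 0"
    "\<And>x. (\<lambda>n. f n x) \<longlonglongrightarrow> indicator {a<..b} x"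
    "\<And>\<Phi> B. \<Phi> \<in> borel_measurable borel \<Longrightarrow> (\<And>t. \<bar>\<Phi> t\<bar> \<le> B) \<Longrightarrow> continuous (at_right a) \<Phi> \<Longrightarrow> continuous (at_right b) \<Phi> \<Longrightarrow>
      (\<lambda>n. LBINT t. f' n t * \<Phi> t) \<longlonglongrightarrow> \<Phi> a - \<Phi> b"
proof -
  obtain S S' :: "real \<Rightarrow> real" where S: "smooth1 S" "\<And>x. (S has_real_derivative S' x) (at x)" "continuous_on UNIV S'"
    "\<And>x. x \<le> 0 \<Longrightarrow> S x = 0" "\<And>x. 1 \<le> x \<Longrightarrow> S x = 1" "mono S" "\<And>x. 0 \<le> S' x" "\<And>x. x \<notin> {0..1} \<Longrightarrow> S' x = 0"
    using smooth_step_exists by blast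
  have [measurable]: "S' \<in> borel_measurable borel" by (rule borel_measurable_continuous_onI[OF S(3)])
  have S01: "0 \<le> S x" "S x \<le> 1" for x
    using monoD[OF S(6), of "min x 0" x] S(4)[of "min x 0"] monoD[OF S(6), of x "max x 1"] S(5)[of "max x 1"] by auto
  define f where "f n x = S (real (Suc n) * (x - a)) - S (real (Suc n) * (x - b))" for n x
  define f' where "f' n x = S' (real (Suc n) * (x - a)) * real (Suc n) - S' (real (Suc n) * (x - b)) * real (Suc n)" for n x
  have lim: "(\<lambda>n. S (real (Suc n) * (x - c))) \<longlonglongrightarrow> indicator {c<..} x" for x c
  proof (cases "x \<le> c")
    case True
    then have "S (real (Suc n) * (x - c)) = 0" for n
      by (intro S(4) mult_nonneg_nonpos) auto
    then show ?thesis using True by simp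
  next
    case False
    obtain N :: nat where N: "1 / (x - c) < real N" using reals_Archimedean2 by blast
    have "S (real (Suc n) * (x - c)) = 1" if "N \<le> n" for n
    proof (rule S(5))
      have "1 / (x - c) \<le> real (Suc n)" using N that by linarith
      then show "1 \<le> real (Suc n) * (x - c)" using False by (simp add: field_simps)
    qed
    then show ?thesis using False
      by (intro tendsto_eventually eventually_sequentiallyI[of N]) simp
  qed
  have iS: "integrable lborel S'" "(LBINT r. S' r) = 1"
  proof -
    have eq: "S' = (\<lambda>r. indicator {0..1} r * S' r)" using S(8) by (fastforce simp: indicator_def)
    have "set_integrable lborel {0..1} S'"
      by (rule borel_integrable_atLeastAtMost') (rule continuous_on_subset[OF S(3)], simp)
    then show "integrable lborel S'" by (subst eq) (simp add: set_integrable_def)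
    have "(LBINT r. S' r) = (LBINT r=ereal 0..ereal 1. S' r)"
      unfolding interval_integral_Icc[OF zero_le_one] set_lebesgue_integral_def by (subst eq) simp
    also have "\<dots> = S 1 - S 0" using interval_integral_antiderivative[OF S(2,3), of 0 1] by simp
    finally show "(LBINT r. S' r) = 1" using S(4,5) by simp
  qed
  \<comment> \<open>Each edge is a unit mass spread over an interval of length
    \<open>1 / Suc n\<close> to the right of \<open>c\<close>; the substitution
    \<open>t = c + r / Suc n\<close> turns it into the fixed density \<open>S'\<close>.\<close>
  have conc: "(\<lambda>n. LBINT t. S' (real (Suc n) * (t - c)) * real (Suc n) * \<Phi> t) \<longlonglongrightarrow> \<Phi> c \<and>
      integrable lborel (\<lambda>t. S' (real (Suc n) * (t - c)) * real (Suc n) * \<Phi> t)"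
    if [measurable]: "\<Phi> \<in> borel_measurable borel" and B: "\<And>t. \<bar>\<Phi> t\<bar> \<le> B" and c: "continuous (at_right c) \<Phi>" for \<Phi> B c n
  proof
    have eq: "(LBINT t. S' (real (Suc n) * (t - c)) * real (Suc n) * \<Phi> t) = (LBINT r. S' r * \<Phi> (c + r / real (Suc n)))" for n
    proof -
      have "(LBINT x. S' x * real (Suc n) * \<Phi> (c + x / real (Suc n))) = real (Suc n) * (LBINT x. S' x * \<Phi> (c + x / real (Suc n)))"
        unfolding integral_mult_right_zero[symmetric] by (simp only: mult_ac)
      then show ?thesis
        by (subst lborel_integral_real_affine[where c="1 / real (Suc n)" and t=c]) (simp_all del: of_nat_Suc)
    qed
    have "(\<lambda>n. LBINT r. S' r * \<Phi> (c + r / real (Suc n))) \<longlonglongrightarrow> (LBINT r. S' r * \<Phi> c)"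
    proof (rule integral_dominated_convergence[where w="\<lambda>r. S' r * B"])
      show "AE r in lborel. (\<lambda>n. S' r * \<Phi> (c + r / real (Suc n))) \<longlonglongrightarrow> S' r * \<Phi> c"
      proof (rule AE_I2)
        fix r :: real
        show "(\<lambda>n. S' r * \<Phi> (c + r / real (Suc n))) \<longlonglongrightarrow> S' r * \<Phi> c"
        proof (cases "0 < r")
          case True
          have "(\<Phi> \<longlongrightarrow> \<Phi> c) (at_right c)" using c by (simp add: continuous_within)
          then have "(\<lambda>n. \<Phi> (c + r / real (Suc n))) \<longlonglongrightarrow> \<Phi> c"
            by (rule filterlim_compose[OF _ filterlim_at_right_seq[OF True]])
          then show ?thesis by (intro tendsto_intros)
        next
          case False
          then have "r = 0 \<or> S' r = 0" using S(8)[of r] by force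
          then show ?thesis by auto
        qed
      qed
    qed (use iS S(7) B in \<open>auto simp: abs_mult intro!: mult_left_mono\<close>)
    then show "(\<lambda>n. LBINT t. S' (real (Suc n) * (t - c)) * real (Suc n) * \<Phi> t) \<longlonglongrightarrow> \<Phi> c"
      unfolding eq using iS by simp
    have "integrable lborel (\<lambda>t. S' (- real (Suc n) * c + real (Suc n) * t))"
      using lborel_integrable_real_affine[OF iS(1), of "real (Suc n)" "- real (Suc n) * c"] by simp
    moreover have "- real (Suc n) * c + real (Suc n) * t = real (Suc n) * (t - c)" for t
      by (simp add: algebra_simps)
    ultimately have "integrable lborel (\<lambda>t. S' (real (Suc n) * (t - c)))" by (simp only:)
    then have "integrable lborel (\<lambda>t. S' (real (Suc n) * (t - c)) * real (Suc n) * B)" by simp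
    then show "integrable lborel (\<lambda>t. S' (real (Suc n) * (t - c)) * real (Suc n) * \<Phi> t)"
      by (rule Bochner_Integration.integrable_bound)
         (use S(7) B order_trans[OF abs_ge_zero B] in \<open>auto simp: abs_mult intro!: AE_I2 mult_left_mono\<close>)
  qed
  show ?thesis
  proof
    show "smooth1 (f n)" for n
      unfolding f_def[abs_def] by (rule smooth1_affine_diff[OF S(1)])
    show "(f n has_real_derivative f' n x) (at x)" for n x
      unfolding f_def[abs_def] f'_def
      by (intro DERIV_diff DERIV_chain2[OF S(2)]) (auto intro!: derivative_eq_intros)
    show "continuous_on UNIV (f' n)" for n
      unfolding f'_def[abs_def] by (intro continuous_intros continuous_on_compose2[OF S(3)]) auto
    have "S (real (Suc n) * (x - b)) \<le> S (real (Suc n) * (x - a))" for n x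
      using ab by (intro monoD[OF S(6)] mult_left_mono) auto
    then show "0 \<le> f n x" "f n x \<le> 1" for n x
      using S01(1)[of "real (Suc n) * (x - b)"] S01(2)[of "real (Suc n) * (x - a)"] unfolding f_def by (smt (verit))+
    show "f n x = 0 \<and> f' n x = 0" if "x < a \<or> b + 1 / real (Suc n) < x" for n x
      using that
    proof
      assume "x < a"
      then have "real (Suc n) * (x - a) < 0" "real (Suc n) * (x - b) < 0"
        using ab by (auto intro!: mult_pos_neg simp del: of_nat_Suc)
      then show ?thesis unfolding f_def f'_def using S(4,8) by (simp del: of_nat_Suc)
    next
      assume *: "b + 1 / real (Suc n) < x"
      have "1 < real (Suc n) * (x - b)" using * by (simp add: field_simps)
      moreover have "real (Suc n) * (x - b) < real (Suc n) * (x - a)"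
        using ab by (intro mult_strict_left_mono) auto
      ultimately have "1 < real (Suc n) * (x - a)" by (rule less_trans)
      then show ?thesis unfolding f_def f'_def using S(5,8) \<open>1 < real (Suc n) * (x - b)\<close> by (simp del: of_nat_Suc)
    qed
    show "(\<lambda>n. f n x) \<longlonglongrightarrow> indicator {a<..b} x" for x
    proof -
      have "(\<lambda>n. f n x) \<longlonglongrightarrow> indicator {a<..} x - indicator {b<..} x"
        unfolding f_def by (intro tendsto_diff lim)
      moreover have "indicator {a<..} x - indicator {b<..} x = (indicator {a<..b} x :: real)"
        using ab by (auto simp: indicator_def)
      ultimately show ?thesis by simp
    qed
    fix \<Phi> :: "real \<Rightarrow> real" and B
    assume \<Phi>: "\<Phi> \<in> borel_measurable borel" "\<And>t. \<bar>\<Phi> t\<bar> \<le> B" "continuous (at_right a) \<Phi>" "continuous (at_right b) \<Phi>"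
    have "(\<lambda>n. (LBINT t. S' (real (Suc n) * (t - a)) * real (Suc n) * \<Phi> t) - (LBINT t. S' (real (Suc n) * (t - b)) * real (Suc n) * \<Phi> t)) \<longlonglongrightarrow> \<Phi> a - \<Phi> b"
      using conc[OF \<Phi>(1,2,3)] conc[OF \<Phi>(1,2,4)] by (intro tendsto_diff) blast+
    then show "(\<lambda>n. LBINT t. f' n t * \<Phi> t) \<longlonglongrightarrow> \<Phi> a - \<Phi> b"
      unfolding f'_def left_diff_distrib
      using conc[OF \<Phi>(1,2,3)] conc[OF \<Phi>(1,2,4)] by (subst Bochner_Integration.integral_diff) blast+
  qed
qed

section \<open>Test functions of space and time\<close>

lemma iter_pd_tensor:
  assumes f: "smooth1 f" and g: "smooth1 g"
  shows "\<exists>i j. iter_pd bs (\<lambda>x t. f x * g t) = (\<lambda>x t. (deriv ^^ i) f x * (deriv ^^ j) g t)"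
proof (induction bs)
  case Nil
  show ?case by (rule exI[of _ 0], rule exI[of _ 0]) simp
next
  case (Cons b bs)
  then obtain i j where *: "iter_pd bs (\<lambda>x t. f x * g t) = (\<lambda>x t. (deriv ^^ i) f x * (deriv ^^ j) g t)" by blast
  have "pdx (\<lambda>x t. (deriv ^^ i) f x * (deriv ^^ j) g t) = (\<lambda>x t. (deriv ^^ Suc i) f x * (deriv ^^ j) g t)"
    unfolding pdx_def by (intro ext DERIV_imp_deriv DERIV_cmult_right smooth1_D[OF f])
  moreover have "pdt (\<lambda>x t. (deriv ^^ i) f x * (deriv ^^ j) g t) = (\<lambda>x t. (deriv ^^ i) f x * (deriv ^^ Suc j) g t)"
    unfolding pdt_def by (intro ext DERIV_imp_deriv DERIV_cmult smooth1_D[OF g])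
  ultimately have "iter_pd (b # bs) (\<lambda>x t. f x * g t) =
      (if b then (\<lambda>x t. (deriv ^^ Suc i) f x * (deriv ^^ j) g t) else (\<lambda>x t. (deriv ^^ i) f x * (deriv ^^ Suc j) g t))"
    using * by simp
  then show ?case by (cases b) (simp_all only: if_True if_False, blast+)
qed

lemma smooth2_tensor:
  assumes f: "smooth1 f" and g: "smooth1 g"
  shows "smooth2 (\<lambda>x t. f x * g t)"
  unfolding smooth2_def
proof (intro allI conjI)
  fix bs :: "bool list" and x t :: real
  obtain i j where *: "iter_pd bs (\<lambda>x t. f x * g t) = (\<lambda>x t. (deriv ^^ i) f x * (deriv ^^ j) g t)"
    using iter_pd_tensor[OF f g] by blast
  show "continuous_on UNIV (\<lambda>p. iter_pd bs (\<lambda>x t. f x * g t) (fst p) (snd p))"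
    unfolding * by (intro continuous_intros continuous_on_compose2[OF smooth1_continuous[OF f, of UNIV]]
        continuous_on_compose2[OF smooth1_continuous[OF g, of UNIV]]) auto
  show "(\<lambda>y. iter_pd bs (\<lambda>x t. f x * g t) y t) differentiable at x"
    unfolding * real_differentiable_def using DERIV_cmult_right[OF smooth1_D[OF f]] by blast
  show "(\<lambda>s. iter_pd bs (\<lambda>x t. f x * g t) x s) differentiable at t"
    unfolding * real_differentiable_def using DERIV_cmult[OF smooth1_D[OF g]] by blast
qed

lemma test_st_tensor:
  assumes f: "smooth1 f" "\<And>x. x \<notin> {a..b} \<Longrightarrow> f x = 0"
    and g: "smooth1 g" "\<And>t. t \<notin> {c..d} \<Longrightarrow> g t = 0" and cd: "0 < c" "d < T"
  shows "test_st T (\<lambda>x t. f x * g t)"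
proof -
  have "{p. f (fst p) * g (snd p) \<noteq> 0} \<subseteq> {a..b} \<times> {c..d}"
    using f(2) g(2) by (auto simp: mem_Times_iff) (metis atLeastAtMost_iff)+
  then have sub: "supp2 (\<lambda>x t. f x * g t) \<subseteq> {a..b} \<times> {c..d}"
    unfolding supp2_def by (rule closure_minimal) (simp add: closed_Times)
  have "compact (supp2 (\<lambda>x t. f x * g t))"
    unfolding supp2_def
    by (rule compact_Int_closed[THEN back_subst[of compact], of "{a..b} \<times> {c..d}" "supp2 (\<lambda>x t. f x * g t)"])
       (use sub in \<open>auto simp: supp2_def compact_Times\<close>)
  then show ?thesis
    unfolding test_st_def using smooth2_tensor[OF f(1) g(1)] sub cd by fastforce
qed

lemma smooth2_continuous:
  assumes "smooth2 \<zeta>"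
  shows "continuous_on UNIV (\<lambda>p. \<zeta> (fst p) (snd p))"
    "continuous_on UNIV (\<lambda>p. pdx \<zeta> (fst p) (snd p))"
    "continuous_on UNIV (\<lambda>p. pdt \<zeta> (fst p) (snd p))"
  using assms[unfolded smooth2_def, rule_format, of "[]"] assms[unfolded smooth2_def, rule_format, of "[True]"]
    assms[unfolded smooth2_def, rule_format, of "[False]"] by auto

text \<open>\<open>smooth2\<close> speaks of partial derivatives, whereas the chain rule along a
  path requires a total derivative; the continuity of \<open>pdt \<zeta>\<close> provides
  it.\<close>

lemma smooth2_has_derivative:
  assumes \<zeta>: "smooth2 \<zeta>"
  shows "((\<lambda>p. \<zeta> (fst p) (snd p)) has_derivative (\<lambda>h. pdx \<zeta> x t * fst h + pdt \<zeta> x t * snd h)) (at (x, t))"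
proof -
  have d: "((\<lambda>y. \<zeta> y t) has_real_derivative pdx \<zeta> x t) (at x)" "((\<lambda>s. \<zeta> x s) has_real_derivative pdt \<zeta> x t) (at t)" for x t
    using \<zeta>[unfolded smooth2_def, rule_format, of "[]"]
    by (simp_all add: pdx_def pdt_def DERIV_deriv_iff_real_differentiable)
  have "((\<lambda>(x, t). \<zeta> x t) has_derivative (\<lambda>(tx, ty). pdx \<zeta> x t * tx + blinfun_scaleR_left (pdt \<zeta> x t) ty)) (at (x, t) within UNIV \<times> UNIV)"
  proof (rule has_derivative_partialsI)
    show "((\<lambda>x. \<zeta> x t) has_derivative (*) (pdx \<zeta> x t)) (at x within UNIV)"
      using d(1)[of t x] by (simp add: has_field_derivative_def)
    show "((\<lambda>t. \<zeta> x t) has_derivative blinfun_apply (blinfun_scaleR_left (pdt \<zeta> x t))) (at t within UNIV)" for x t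
    proof -
      have e: "(\<lambda>y. y * pdt \<zeta> x t) = (*) (pdt \<zeta> x t)" by (rule ext) (rule mult.commute)
      show ?thesis
        unfolding blinfun_scaleR_left.rep_eq real_scaleR_def e using d(2)[of x t] by (simp only: has_field_derivative_def)
    qed
    have "continuous (at (x, t)) (\<lambda>p. pdt \<zeta> (fst p) (snd p))"
      using smooth2_continuous(3)[OF \<zeta>] by (simp add: continuous_on_eq_continuous_at)
    then show "continuous (at (x, t) within UNIV \<times> UNIV) (\<lambda>(x, y). blinfun_scaleR_left (pdt \<zeta> x y))"
      using bounded_linear.continuous[OF bounded_linear_blinfun_scaleR_left] by (simp add: case_prod_unfold)
  qed auto
  then show ?thesis
    by (simp add: case_prod_unfold blinfun_scaleR_left.rep_eq mult.commute)
qed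

lemma test_st_outside:
  assumes \<zeta>: "test_st T \<zeta>" and p: "(x, t) \<notin> supp2 \<zeta>"
  shows "\<zeta> x t = 0" "pdx \<zeta> x t = 0" "pdt \<zeta> x t = 0"
proof -
  have op: "open (- supp2 \<zeta>)" by (simp add: supp2_def open_Compl)
  have z: "\<zeta> y s = 0" if "(y, s) \<notin> supp2 \<zeta>" for y s
    using that subsetD[OF closure_subset[of "{p. \<zeta> (fst p) (snd p) \<noteq> 0}"], of "(y, s)"] by (auto simp: supp2_def)
  then show "\<zeta> x t = 0" using p by simp
  obtain A B where AB: "open A" "open B" "(x, t) \<in> A \<times> B" "A \<times> B \<subseteq> - supp2 \<zeta>"
    using open_prod_elim[OF op, of "(x, t)"] p by (metis ComplI)
  have "((\<lambda>y. \<zeta> y t) has_real_derivative 0) (at x)"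
    by (rule has_field_derivative_transform_within_open[where S=A and f="\<lambda>_. 0"]) (use AB z in \<open>auto intro!: z[symmetric]\<close>)
  then show "pdx \<zeta> x t = 0" unfolding pdx_def by (rule DERIV_imp_deriv)
  have "((\<lambda>s. \<zeta> x s) has_real_derivative 0) (at t)"
    by (rule has_field_derivative_transform_within_open[where S=B and f="\<lambda>_. 0"]) (use AB z in \<open>auto intro!: z[symmetric]\<close>)
  then show "pdt \<zeta> x t = 0" unfolding pdt_def by (rule DERIV_imp_deriv)
qed

lemma test_st_outside_time:
  assumes "test_st T \<zeta>" "t \<le> 0 \<or> T \<le> t"
  shows "\<zeta> x t = 0" "pdx \<zeta> x t = 0" "pdt \<zeta> x t = 0"
proof -
  have "(x, t) \<notin> supp2 \<zeta>" using assms by (auto simp: test_st_def)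
  then show "\<zeta> x t = 0" "pdx \<zeta> x t = 0" "pdt \<zeta> x t = 0"
    using test_st_outside[OF assms(1)] by auto
qed

lemma test_st_bounded:
  assumes \<zeta>: "test_st T \<zeta>"
  obtains B where "\<And>x t. \<bar>\<zeta> x t\<bar> \<le> B" "\<And>x t. \<bar>pdx \<zeta> x t\<bar> \<le> B" "\<And>x t. \<bar>pdt \<zeta> x t\<bar> \<le> B"
proof -
  have "smooth2 \<zeta>" "compact (supp2 \<zeta>)" using \<zeta> by (auto simp: test_st_def)
  note c = smooth2_continuous[OF this(1)]
  have b: "\<exists>B. \<forall>x t. \<bar>h x t\<bar> \<le> B" if h: "continuous_on UNIV (\<lambda>p. h (fst p) (snd p))"
    and z: "\<And>x t. (x, t) \<notin> supp2 \<zeta> \<Longrightarrow> h x t = 0" for h :: "real \<Rightarrow> real \<Rightarrow> real"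
  proof -
    have "bounded ((\<lambda>p. h (fst p) (snd p)) ` supp2 \<zeta>)"
      by (intro compact_imp_bounded compact_continuous_image continuous_on_subset[OF h] \<open>compact (supp2 \<zeta>)\<close>) simp
    then obtain B where B: "\<forall>p\<in>supp2 \<zeta>. \<bar>h (fst p) (snd p)\<bar> \<le> B"
      unfolding bounded_iff by auto
    have "\<bar>h x t\<bar> \<le> max B 0" for x t
      using bspec[OF B, of "(x, t)"] z[of x t] by (cases "(x, t) \<in> supp2 \<zeta>") auto
    then show ?thesis by blast
  qed
  obtain B1 B2 B3 where "\<forall>x t. \<bar>\<zeta> x t\<bar> \<le> B1" "\<forall>x t. \<bar>pdx \<zeta> x t\<bar> \<le> B2" "\<forall>x t. \<bar>pdt \<zeta> x t\<bar> \<le> B3"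
    using b[OF c(1) test_st_outside(1)[OF \<zeta>]] b[OF c(2) test_st_outside(2)[OF \<zeta>]] b[OF c(3) test_st_outside(3)[OF \<zeta>]] by blast
  then show ?thesis
    by (intro that[of "max B1 (max B2 B3)"]) (auto simp: le_max_iff_disj)
qed

section \<open>The Lagrangian description of a solution\<close>

lemma integral_lborel_shift_reflect:
  fixes f :: "real \<Rightarrow> real"
  shows "(LBINT y. f (x - y)) = (LBINT z. f z)"
  using lborel_integral_real_affine[of "-1" f x] by simp

lemma abs_integral_le:
  fixes f g :: "'a \<Rightarrow> real"
  assumes "integrable M f" "integrable M g" "\<And>x. \<bar>f x\<bar> \<le> g x"
  shows "\<bar>integral\<^sup>L M f\<bar> \<le> integral\<^sup>L M g"
proof -
  have "\<bar>integral\<^sup>L M f\<bar> \<le> (\<integral>x. \<bar>f x\<bar> \<partial>M)" by (rule integral_abs_bound)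
  also have "\<dots> \<le> integral\<^sup>L M g" by (rule integral_mono) (use assms in auto)
  finally show ?thesis .
qed

section \<open>The kernel as a primitive of \<phi>\<close>

locale kernel =
  fixes \<omega> \<phi> :: "real \<Rightarrow> real"
  assumes H: "hypH \<omega> \<phi>"
begin

lemma \<phi>_integrable: "integrable lborel \<phi>" and \<omega>_integrable: "integrable lborel \<omega>" and \<omega>_nonneg: "0 \<le> \<omega> x"
  and \<omega>_diff: "\<omega> b - \<omega> a = (LBINT x=a..b. \<phi> x)"
  using H unfolding hypH_def by auto

lemma \<phi>_meas [measurable]: "\<phi> \<in> borel_measurable borel"
  using borel_measurable_integrable[OF \<phi>_integrable] by simp

lemma \<phi>_shift_integrable: "integrable lborel (\<lambda>y. \<phi> (x - y))"
  using lborel_integrable_real_affine[OF \<phi>_integrable, of "-1" x] by simp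

definition \<phi>_bound :: real where "\<phi>_bound = (SOME C. \<forall>x. \<bar>\<phi> x\<bar> \<le> C)"

lemma \<phi>_bounded: "\<bar>\<phi> x\<bar> \<le> \<phi>_bound"
proof -
  have "\<exists>C. \<forall>x. \<bar>\<phi> x\<bar> \<le> C" using H by (simp add: hypH_def)
  then have "\<forall>x. \<bar>\<phi> x\<bar> \<le> \<phi>_bound" unfolding \<phi>_bound_def by (rule someI_ex)
  then show ?thesis by blast
qed

lemma \<omega>_diff_Icc: "a \<le> b \<Longrightarrow> \<omega> b - \<omega> a = (LBINT x. indicator {a..b} x * \<phi> x)"
  by (simp add: \<omega>_diff interval_integral_Icc set_lebesgue_integral_def)

text \<open>Since \<open>\<phi>\<close> is integrable, \<open>\<omega>\<close> has a limit
  \<open>L\<close> at minus infinity, and since \<open>\<omega>\<close> is nonnegative and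
  integrable, \<open>L\<close> must be 0.\<close>

lemma \<omega>_eq_tail: "(LBINT z. indicator {..p} z * \<phi> z) = \<omega> p"
proof -
  let ?I = "LBINT z. indicator {..p} z * \<phi> z"
  define L where "L = \<omega> p - ?I"
  have "((\<lambda>t. LBINT z. indicator {p - t..p} z * \<phi> z) \<longlongrightarrow> ?I) at_top"
  proof (rule integral_dominated_convergence_at_top[where w="\<lambda>z. \<bar>\<phi> z\<bar>"])
    show "AE z in lborel. ((\<lambda>t. indicator {p - t..p} z * \<phi> z) \<longlongrightarrow> indicator {..p} z * \<phi> z) at_top"
    proof (rule AE_I2, rule tendsto_eventually)
      fix z
      show "\<forall>\<^sub>F t in at_top. indicator {p - t..p} z * \<phi> z = indicator {..p} z * \<phi> z"
        using eventually_ge_at_top[of "p - z"] by (rule eventually_mono) (auto simp: indicator_def)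
    qed
  qed (use \<phi>_integrable in \<open>auto simp: indicator_def\<close>)
  then have "((\<lambda>t. \<omega> p - (LBINT z. indicator {p - t..p} z * \<phi> z)) \<longlongrightarrow> L) at_top"
    unfolding L_def by (intro tendsto_intros)
  then have lim: "((\<lambda>t. \<omega> (p - t)) \<longlongrightarrow> L) at_top"
  proof (rule Lim_transform_eventually)
    show "\<forall>\<^sub>F t in at_top. \<omega> p - (LBINT z. indicator {p - t..p} z * \<phi> z) = \<omega> (p - t)"
      using eventually_ge_at_top[of 0]
    proof (rule eventually_mono)
      fix t :: real assume "0 \<le> t"
      then show "\<omega> p - (LBINT z. indicator {p - t..p} z * \<phi> z) = \<omega> (p - t)"
        using \<omega>_diff_Icc[of "p - t" p] by simp
    qed
  qed
  have "0 \<le> L" by (rule tendsto_lowerbound[OF lim]) (auto simp: \<omega>_nonneg)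
  moreover have "\<not> 0 < L"
  proof
    assume L: "0 < L"
    then have "\<forall>\<^sub>F t in at_top. L / 2 < \<omega> (p - t)" using order_tendstoD(1)[OF lim, of "L / 2"] by simp
    then obtain t0 where t0: "\<And>t. t0 \<le> t \<Longrightarrow> L / 2 < \<omega> (p - t)"
      unfolding eventually_at_top_linorder by blast
    \<comment> \<open>On an interval of length \<open>k\<close> the lower bound \<open>L / 2\<close>
      alone would already exceed the total integral of \<open>\<omega>\<close>.\<close>
    obtain k :: nat where k: "2 * integral\<^sup>L lborel \<omega> / L < real k" using reals_Archimedean2 by blast
    have "(LBINT x. indicator {p - t0 - real k..p - t0} x * (L / 2)) \<le> integral\<^sup>L lborel \<omega>"
    proof (rule integral_mono[OF _ \<omega>_integrable])
      show "integrable lborel (\<lambda>x. indicator {p - t0 - real k..p - t0} x * (L / 2))"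
        by (intro integrable_mult_left integrable_real_indicator) (auto simp: emeasure_lborel_Icc_eq)
      fix x show "indicator {p - t0 - real k..p - t0} x * (L / 2) \<le> \<omega> x"
        using t0[of "p - x"] \<omega>_nonneg[of x] by (auto simp: indicator_def)
    qed
    then show False using k L by (simp add: field_simps)
  qed
  ultimately show ?thesis by (simp add: L_def)
qed

lemma \<phi>_tail: "(LBINT y. indicator {q..} y * \<phi> (x - y)) = \<omega> (x - q)"
proof -
  have "(LBINT y. indicator {q..} y * \<phi> (x - y)) = (LBINT y. indicator {..x - q} (x - y) * \<phi> (x - y))"
    by (rule Bochner_Integration.integral_cong) (auto simp: indicator_def)
  also have "\<dots> = \<omega> (x - q)"
    unfolding integral_lborel_shift_reflect[of "\<lambda>z. indicator {..x - q} z * \<phi> z"] \<omega>_eq_tail ..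
  finally show ?thesis .
qed

text \<open>The \<open>L^1\<close> norm of \<open>\<phi>\<close>; it dominates
  \<open>\<omega>\<close> because \<open>\<omega>\<close> vanishes at minus infinity.\<close>

definition \<omega>_bound :: real where "\<omega>_bound = (LBINT x. \<bar>\<phi> x\<bar>)"

lemma \<omega>_bounded: "\<bar>\<omega> p\<bar> \<le> \<omega>_bound"
proof -
  have "\<bar>LBINT z. indicator {..p} z * \<phi> z\<bar> \<le> (LBINT z. \<bar>indicator {..p} z * \<phi> z\<bar>)"
    using integral_norm_bound[of lborel "\<lambda>z. indicator {..p} z * \<phi> z"] by simp
  also have "\<dots> \<le> \<omega>_bound"
    unfolding \<omega>_bound_def
  proof (rule integral_mono)
    show "integrable lborel (\<lambda>z. \<bar>indicator {..p} z * \<phi> z\<bar>)"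
      using integrable_mult_indicator[OF _ \<phi>_integrable, of "{..p}"] by auto
  qed (use \<phi>_integrable in \<open>auto simp: indicator_def\<close>)
  finally show ?thesis unfolding \<omega>_eq_tail .
qed

lemma \<omega>_Lipschitz: "\<bar>\<omega> b - \<omega> a\<bar> \<le> \<phi>_bound * \<bar>b - a\<bar>"
proof (induction a b rule: linorder_wlog)
  case (le a b)
  have "\<bar>LBINT x. indicator {a..b} x * \<phi> x\<bar> \<le> (LBINT x. indicator {a..b} x * \<phi>_bound)"
  proof (rule abs_integral_le)
    show "integrable lborel (\<lambda>x. indicator {a..b} x * \<phi> x)"
      using integrable_mult_indicator[OF _ \<phi>_integrable, of "{a..b}"] by simp
    show "integrable lborel (\<lambda>x. indicator {a..b} x * \<phi>_bound)"
      by (intro integrable_mult_left integrable_real_indicator) (auto simp: emeasure_lborel_Icc_eq)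
    show "\<bar>indicator {a..b} x * \<phi> x\<bar> \<le> indicator {a..b} x * \<phi>_bound" for x
      using \<phi>_bounded by (simp add: indicator_def)
  qed
  then show ?case using le by (simp add: \<omega>_diff_Icc mult.commute)
qed (simp add: abs_minus_commute)

lemma \<omega>_continuous: "continuous_on A \<omega>"
proof -
  have "\<phi>_bound-lipschitz_on A \<omega>"
    by (rule lipschitz_onI) (use \<omega>_Lipschitz \<phi>_bounded[of 0] in \<open>auto simp: dist_real_def intro: order_trans[OF abs_ge_zero]\<close>)
  then show ?thesis by (rule lipschitz_on_continuous_on)
qed

lemma \<omega>_meas [measurable]: "\<omega> \<in> borel_measurable borel"
  by (rule borel_measurable_continuous_onI[OF \<omega>_continuous])

end

text \<open>Kept independent of the initial data: the flux enters only through a bounded Borel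
  density \<open>a\<close>, and the conditions on \<open>M\<close> are the regularity clauses of
  \<open>entropy_sol\<close>.\<close>

locale lagrangian = kernel +
  fixes M :: "real \<Rightarrow> real \<Rightarrow> real" and a A :: "real \<Rightarrow> real" and K :: real
  assumes M_meas: "(\<lambda>p. M (fst p) (snd p)) \<in> borel_measurable borel"
    and M_mono: "\<And>t. 0 \<le> t \<Longrightarrow> mono (\<lambda>x. M x t)"
    and M_far: "\<And>T. 0 < T \<Longrightarrow> \<exists>R>0. \<forall>t\<in>{0..T}. \<forall>x. (x < -R \<longrightarrow> M x t = 0) \<and> (R < x \<longrightarrow> M x t = 1)"
    and M_cont: "\<And>T t. 0 < T \<Longrightarrow> t \<in> {0..T} \<Longrightarrow> ((\<lambda>s. LBINT x. \<bar>M x s - M x t\<bar>) \<longlongrightarrow> 0) (at t within {0..T})"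
    and a_meas [measurable]: "a \<in> borel_measurable borel" and a_bound: "\<And>m. \<bar>a m\<bar> \<le> K"
    and A_eq: "\<And>p. p \<in> {0..1} \<Longrightarrow> A p = (\<integral>m. a m * indicator {..p} m \<partial>U01)"
begin

text \<open>Extending \<open>M\<close> constantly to negative times avoids case distinctions.\<close>

definition N :: "real \<Rightarrow> real \<Rightarrow> real" where "N t x = M x (max 0 t)"

definition X :: "real \<Rightarrow> real \<Rightarrow> real" where "X m t = quantile (N t) m"

text \<open>The convolution of \<open>\<omega>\<close> with the measure at time \<open>t\<close>;
  \<open>conv_fun_eq\<close> identifies it with the convolution of \<open>\<phi>\<close> and
  \<open>M\<close>.\<close>

definition c :: "real \<Rightarrow> real \<Rightarrow> real" where "c x t = (\<integral>m. \<omega> (x - X m t) \<partial>U01)"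

definition u :: "real \<Rightarrow> real \<Rightarrow> real" where "u x t = jump_avg a (N t) x - c x t"

definition U :: "real \<Rightarrow> real \<Rightarrow> real" where "U m t = u (X m t) t"

lemma step_cdf_N: "0 < T \<Longrightarrow> \<exists>R>0. \<forall>t\<le>T. step_cdf (N t) R"
proof -
  assume T: "0 < T"
  obtain R where R: "R > 0" "\<forall>t\<in>{0..T}. \<forall>x. (x < -R \<longrightarrow> M x t = 0) \<and> (R < x \<longrightarrow> M x t = 1)"
    using M_far[OF T] by blast
  have "step_cdf (N t) R" if "t \<le> T" for t
    using R(2)[rule_format, of "max 0 t"] M_mono[of "max 0 t"] that T unfolding N_def step_cdf_def by auto
  then show ?thesis using R(1) by blast
qed

lemma step_cdf_N': obtains R where "step_cdf (N t) R"
  using step_cdf_N[of "max 1 t"] that by (meson less_max_iff_disj max.cobounded2 zero_less_one)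

lemma N_eq: "0 \<le> t \<Longrightarrow> N t = (\<lambda>x. M x t)"
  by (simp add: N_def max_def fun_eq_iff)

section \<open>Joint measurability in label, position and time\<close>

lemma N_meas [measurable (raw)]:
  assumes "f \<in> borel_measurable W" "g \<in> borel_measurable W"
  shows "(\<lambda>w. N (g w) (f w)) \<in> borel_measurable W"
proof -
  have [measurable]: "(\<lambda>p. M (fst p) (snd p)) \<in> borel_measurable (borel \<Otimes>\<^sub>M borel)"
    using M_meas by (simp add: borel_prod)
  have "(\<lambda>p. M (fst p) (snd p)) \<circ> (\<lambda>w. (f w, max 0 (g w))) \<in> borel_measurable W"
    by (rule measurable_comp[of _ _ "borel \<Otimes>\<^sub>M borel"]) (use assms in measurable)
  then show ?thesis by (simp add: comp_def N_def)
qed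

text \<open>Along a fixed sequence the one-sided limit is a pointwise limit of jointly measurable
  functions, so measurability in position and time together survives.\<close>

lemma rlim_N_meas [measurable (raw)]:
  assumes [measurable]: "f \<in> borel_measurable W" "g \<in> borel_measurable W"
  shows "(\<lambda>w. rlim (N (g w)) (f w)) \<in> borel_measurable W"
proof (rule borel_measurable_LIMSEQ_real[where u="\<lambda>n w. N (g w) (f w + 1 / real (Suc n))"])
  fix w
  obtain R where "step_cdf (N (g w)) R" by (rule step_cdf_N')
  then show "(\<lambda>n. N (g w) (f w + 1 / real (Suc n))) \<longlonglongrightarrow> rlim (N (g w)) (f w)"
    by (intro step_cdf.F_seq_tendsto(2)) auto
qed measurable

lemma llim_N_meas [measurable (raw)]:
  assumes [measurable]: "f \<in> borel_measurable W" "g \<in> borel_measurable W"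
  shows "(\<lambda>w. llim (N (g w)) (f w)) \<in> borel_measurable W"
proof (rule borel_measurable_LIMSEQ_real[where u="\<lambda>n w. N (g w) (f w + (-1) / real (Suc n))"])
  fix w
  obtain R where "step_cdf (N (g w)) R" by (rule step_cdf_N')
  then show "(\<lambda>n. N (g w) (f w + (-1) / real (Suc n))) \<longlonglongrightarrow> llim (N (g w)) (f w)"
    by (intro step_cdf.F_seq_tendsto(1)) auto
qed measurable

text \<open>The pseudoinverse relation describes sublevel sets of \<open>X\<close> by
  \<open>rlim\<close> at a fixed position, whose joint measurability is known.\<close>

lemma X_meas [measurable (raw)]:
  assumes [measurable]: "f \<in> borel_measurable W" "g \<in> borel_measurable W"
  shows "(\<lambda>w. X (f w) (g w)) \<in> borel_measurable W"
proof (rule borel_measurableI_le)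
  fix y
  have "X (f w) (g w) \<le> y \<longleftrightarrow> (if 0 < f w \<and> f w < 1 then f w \<le> rlim (N (g w)) y else 0 \<le> y)" for w
  proof -
    obtain R where "step_cdf (N (g w)) R" by (rule step_cdf_N')
    then show ?thesis using step_cdf.quantile_le_iff[of "N (g w)" R "f w" y] by (auto simp: X_def quantile_def)
  qed
  then have "{w \<in> space W. X (f w) (g w) \<le> y} = {w \<in> space W. if 0 < f w \<and> f w < 1 then f w \<le> rlim (N (g w)) y else 0 \<le> y}"
    by simp
  also have "\<dots> \<in> sets W" by measurable
  finally show "{w \<in> space W. X (f w) (g w) \<le> y} \<in> sets W" .
qed

lemma c_meas [measurable (raw)]:
  assumes [measurable]: "f \<in> borel_measurable W" "g \<in> borel_measurable W"
  shows "(\<lambda>w. c (f w) (g w)) \<in> borel_measurable W"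
  unfolding c_def by measurable

lemma u_meas [measurable (raw)]:
  assumes [measurable]: "f \<in> borel_measurable W" "g \<in> borel_measurable W"
  shows "(\<lambda>w. u (f w) (g w)) \<in> borel_measurable W"
  unfolding u_def jump_avg_def by measurable

lemma U_meas [measurable (raw)]:
  assumes [measurable]: "f \<in> borel_measurable W" "g \<in> borel_measurable W"
  shows "(\<lambda>w. U (f w) (g w)) \<in> borel_measurable W"
  unfolding U_def by measurable

section \<open>Bounds, convolution and flux in Lagrangian variables\<close>

lemma L01_average_bound:
  assumes "f \<in> borel_measurable borel" "\<And>m. \<bar>f m\<bar> \<le> (B::real)"
  shows "\<bar>integral\<^sup>L U01 f\<bar> \<le> B"
proof -
  have "\<bar>integral\<^sup>L U01 f\<bar> \<le> (\<integral>m. B \<partial>U01)"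
    by (rule abs_integral_le) (use assms integrable_U01[OF assms] in auto)
  then show ?thesis using L01.prob_space by simp
qed

lemma c_bound: "\<bar>c x t\<bar> \<le> \<omega>_bound"
  unfolding c_def by (rule L01_average_bound) (measurable, rule \<omega>_bounded)

definition u_bound :: real where "u_bound = K + \<omega>_bound"

lemma u_bounded: "\<bar>u x t\<bar> \<le> u_bound"
proof -
  have "\<bar>jump_avg a (N t) x\<bar> \<le> K"
    unfolding jump_avg_def by (rule L01_average_bound) (measurable, rule a_bound)
  then show ?thesis using c_bound[of x t] unfolding u_def u_bound_def by linarith
qed

lemma U_bounded: "\<bar>U m t\<bar> \<le> u_bound"
  unfolding U_def by (rule u_bounded)

text \<open>An integration by parts: the layer cake formula with \<open>a = 1\<close> moves the
  derivative from \<open>\<omega>\<close> to \<open>M\<close>, since the integral of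
  \<open>\<phi> (x - y)\<close> over \<open>y \<ge> q\<close> is
  \<open>\<omega> (x - q)\<close>.\<close>

lemma conv_fun_eq: "0 \<le> t \<Longrightarrow> conv_fun \<phi> M x t = c x t"
proof -
  assume t: "0 \<le> t"
  obtain R where "step_cdf (N t) R" by (rule step_cdf_N')
  then interpret S: step_cdf "N t" R .
  have "(\<integral>m. 1 * indicator {..N t y} m \<partial>U01) = N t y" for y
    unfolding mult_1 Leb01_atMost using S.F_bounds[of y] by simp
  then have "conv_fun \<phi> M x t = (LBINT y. (\<integral>m. 1 * indicator {..N t y} m \<partial>U01) * \<phi> (x - y))"
    by (simp only: conv_fun_def N_eq[OF t] mult.commute)
  also have "\<dots> = (\<integral>m. 1 * (LBINT y. indicator {quantile (N t) m..} y * \<phi> (x - y)) \<partial>U01)"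
    by (rule S.layer_cake[OF \<phi>_shift_integrable, where K=1]) auto
  also have "\<dots> = c x t" by (simp add: \<phi>_tail c_def X_def)
  finally show ?thesis .
qed

lemma integral_LS_N:
  fixes f :: "real \<Rightarrow> real"
  assumes "f \<in> borel_measurable borel" "0 \<le> t"
  shows "integral\<^sup>L (LS (\<lambda>x. M x t)) f = (\<integral>m. f (X m t) \<partial>U01)"
proof -
  obtain R where "step_cdf (N t) R" by (rule step_cdf_N')
  then show ?thesis using step_cdf.integral_LS[of "N t" R f] assms(1) by (simp add: N_eq[OF assms(2)] X_def)
qed

text \<open>Against functions of \<open>X\<close>, the label density \<open>a\<close> acts like its
  jump average, and this average is \<open>U + c\<close> by the definition of
  \<open>u\<close>.\<close>

lemma integral_a_eq_U:
  assumes [measurable]: "g \<in> borel_measurable borel" and g: "\<And>x. \<bar>g x\<bar> \<le> B"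
  shows "(\<integral>m. g (X m t) * a m \<partial>U01) = (\<integral>m. g (X m t) * U m t \<partial>U01) + (\<integral>m. g (X m t) * c (X m t) t \<partial>U01)"
proof -
  obtain R where "step_cdf (N t) R" by (rule step_cdf_N')
  then interpret S: step_cdf "N t" R .
  have B: "0 \<le> B" using order_trans[OF abs_ge_zero g] .
  have "(\<integral>m. g (X m t) * a m \<partial>U01) = (\<integral>m. g (X m t) * jump_avg a (N t) (X m t) \<partial>U01)"
    unfolding X_def by (rule S.integral_jump_avg[OF _ _ a_bound g]) measurable
  also have "\<dots> = (\<integral>m. g (X m t) * U m t + g (X m t) * c (X m t) t \<partial>U01)"
    by (simp add: U_def u_def algebra_simps)
  also have "\<dots> = (\<integral>m. g (X m t) * U m t \<partial>U01) + (\<integral>m. g (X m t) * c (X m t) t \<partial>U01)"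
  proof (rule Bochner_Integration.integral_add)
    show "integrable U01 (\<lambda>m. g (X m t) * U m t)"
      by (rule integrable_U01[where B="B * u_bound"]) (measurable, auto simp: abs_mult intro!: mult_mono g U_bounded B)
    show "integrable U01 (\<lambda>m. g (X m t) * c (X m t) t)"
      by (rule integrable_U01[where B="B * \<omega>_bound"]) (measurable, auto simp: abs_mult intro!: mult_mono g c_bound B)
  qed
  finally show ?thesis .
qed

text \<open>The weak derivative of \<open>A(M)\<close>. Jumps require no separate treatment: the
  layer cake formula attaches to a jump position the integral of \<open>a\<close> over the levels
  jumped over, which is the increment of \<open>A\<close>.\<close>

lemma integral_A_derivative:
  assumes t: "0 \<le> t" and f: "\<And>x. (f has_real_derivative f' x) (at x)" "continuous_on UNIV f'"
    and b: "\<And>x. x \<notin> {l..b} \<Longrightarrow> f x = 0 \<and> f' x = 0"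
  shows "(LBINT x. A (M x t) * f' x) = - (\<integral>m. f (X m t) * a m \<partial>U01)"
proof -
  obtain R where "step_cdf (N t) R" by (rule step_cdf_N')
  then interpret S: step_cdf "N t" R .
  have f'i: "integrable lborel f'"
  proof -
    have eq: "f' = (\<lambda>r. indicator {l..b} r * f' r)" using b by (fastforce simp: indicator_def)
    have "set_integrable lborel {l..b} f'"
      by (rule borel_integrable_atLeastAtMost') (rule continuous_on_subset[OF f(2)], simp)
    then show ?thesis by (subst eq) (simp add: set_integrable_def)
  qed
  have "(LBINT x. A (M x t) * f' x) = (LBINT x. (\<integral>m. a m * indicator {..N t x} m \<partial>U01) * f' x)"
    using S.F_bounds by (simp add: N_eq[OF t] A_eq)
  also have "\<dots> = (\<integral>m. a m * (LBINT x. indicator {quantile (N t) m..} x * f' x) \<partial>U01)"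
    by (rule S.layer_cake[OF f'i a_meas a_bound])
  also have "\<dots> = (\<integral>m. - (f (X m t) * a m) \<partial>U01)"
  proof -
    have "(LBINT x. indicator {q..} x * f' x) = - f q" for q
      by (rule integral_tail_derivative[OF f, of "b + 1"]) (use b in auto)
    then show ?thesis by (simp add: X_def mult.commute)
  qed
  finally show ?thesis by simp
qed

end

section \<open>The weak form of the equation\<close>

lemma interval_measure_add_const: "interval_measure (\<lambda>x. F x + c) = interval_measure F"
  by (simp add: interval_measure_def)

lemma interval_measure_const_null: "emeasure (interval_measure (\<lambda>x. k)) UNIV = 0"
proof -
  have "emeasure (interval_measure (\<lambda>x. k)) (\<Union>n::nat. {- real n<..real n}) = 0"
    by (rule emeasure_UN_eq_0) (auto simp: emeasure_interval_measure_Ioc_eq)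
  moreover have "(\<Union>n::nat. {- real n<..real n}) = UNIV"
  proof -
    have "\<exists>n::nat. - real n < x \<and> x \<le> real n" for x
      using reals_Archimedean2[of "\<bar>x\<bar>"] by (auto intro: less_imp_le simp: abs_less_iff)
        (metis abs_less_iff less_imp_le minus_less_iff)
    then show ?thesis by auto
  qed
  ultimately show ?thesis by simp
qed

text \<open>For \<open>\<alpha>\<close> outside [0,1] one of the truncations of
  \<open>M - \<alpha>\<close> in the entropy inequality is constant, so its measure contributes
  nothing.\<close>

lemma integral_LS_const: "integral\<^sup>L (LS (\<lambda>x. k)) f = (0::real)"
proof (rule integral_eq_zero_AE)
  have "Lim (at_right x) (\<lambda>x. k) = k" for x :: real by (rule tendsto_Lim) auto
  then have "LS (\<lambda>x. k) = interval_measure (\<lambda>x. k)" by (simp add: LS_def)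
  then have "UNIV \<in> null_sets (LS (\<lambda>x. k))"
    using interval_measure_const_null[of k] by (auto simp: null_sets_def)
  then show "AE x in LS (\<lambda>x. k). f x = 0" by (rule AE_I') auto
qed

lemma (in step_cdf) LS_add_const: "LS (\<lambda>x. F x + c) = LS F"
proof -
  have "Lim (at_right x) (\<lambda>x. F x + c) = rlim F x + c" for x
    by (rule tendsto_Lim) (auto intro!: tendsto_intros rlim_tendsto)
  then show ?thesis unfolding LS_def rlim_def[symmetric] by (simp add: interval_measure_add_const)
qed

lemma integrable_mult_bounded:
  fixes h g :: "'a \<Rightarrow> real"
  assumes h: "integrable M h" and [measurable]: "g \<in> borel_measurable M" and g: "\<And>x. \<bar>g x\<bar> \<le> B"
  shows "integrable M (\<lambda>x. h x * g x)"
proof (rule Bochner_Integration.integrable_bound)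
  show "integrable M (\<lambda>x. h x * B)" using h by simp
  show "AE x in M. norm (h x * g x) \<le> norm (h x * B)"
    using g order_trans[OF abs_ge_zero g] by (auto simp: abs_mult intro!: AE_I2 mult_left_mono)
qed (use h in measurable)

lemma integrable_continuous_support:
  fixes f :: "real \<Rightarrow> real"
  assumes f: "continuous_on UNIV f" and b: "\<And>x. x \<notin> {l..b} \<Longrightarrow> f x = 0"
  shows "integrable lborel f"
proof -
  have eq: "f = (\<lambda>r. indicator {l..b} r * f r)" using b by (fastforce simp: indicator_def)
  have "set_integrable lborel {l..b} f"
    by (rule borel_integrable_atLeastAtMost') (rule continuous_on_subset[OF f], simp)
  then show ?thesis by (subst eq) (simp add: set_integrable_def)
qed

lemma integral_derivative_eq_0:
  fixes f f' :: "real \<Rightarrow> real"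
  assumes f: "\<And>x. (f has_real_derivative f' x) (at x)" "continuous_on UNIV f'"
    and b: "\<And>x. x \<notin> {l..b} \<Longrightarrow> f x = 0 \<and> f' x = 0"
  shows "(LBINT x. f' x) = 0"
proof -
  have "(LBINT x. f' x) = (LBINT x. indicator {l - 1..} x * f' x)"
    by (rule Bochner_Integration.integral_cong) (use b in \<open>auto simp: indicator_def\<close>)
  also have "\<dots> = - f (l - 1)"
    by (rule integral_tail_derivative[OF f, of "b + 1"]) (use b in auto)
  also have "\<dots> = 0" using b[of "l - 1"] by simp
  finally show ?thesis .
qed

locale entropy_lagrangian = lagrangian +
  assumes entropy: "\<And>T \<alpha> \<zeta>. 0 < T \<Longrightarrow> test_st T \<zeta> \<Longrightarrow> (\<And>x t. 0 \<le> \<zeta> x t) \<Longrightarrow>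
           0 \<le> integral\<^sup>L lborel (\<lambda>t. integral\<^sup>L lborel (\<lambda>x.
                   \<bar>M x t - \<alpha>\<bar> * pdt \<zeta> x t
                   + sgn (M x t - \<alpha>) * (A (M x t) - A \<alpha>) * pdx \<zeta> x t))
              + integral\<^sup>L lborel (\<lambda>t.
                   integral\<^sup>L (LS (\<lambda>x. max (M x t - \<alpha>) 0)) (\<lambda>x. \<zeta> x t * conv_fun \<phi> M x t)
                 - integral\<^sup>L (LS (\<lambda>x. min (M x t - \<alpha>) 0)) (\<lambda>x. \<zeta> x t * conv_fun \<phi> M x t))"
begin

lemma N_bounds: "0 \<le> N t x" "N t x \<le> 1"
proof -
  obtain R where "step_cdf (N t) R" by (rule step_cdf_N')
  then show "0 \<le> N t x" "N t x \<le> 1" using step_cdf.F_bounds by auto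
qed

lemma N_abs: "\<bar>N t x\<bar> \<le> 1"
  using N_bounds[of t x] by simp

text \<open>Inherited from the \<open>L^1\<close> continuity of \<open>M\<close>, as
  \<open>f\<close> is bounded by 1. Right continuity is what \<open>smooth_pulses\<close> asks for,
  and it makes sense at time 0 too.\<close>

lemma Phi_right_continuous:
  assumes f: "integrable lborel f" "\<And>x. \<bar>f x\<bar> \<le> 1" and t: "0 \<le> t"
  shows "continuous (at_right t) (\<lambda>t. LBINT x. N t x * f x)"
proof -
  have [measurable]: "f \<in> borel_measurable borel" using borel_measurable_integrable[OF f(1)] by simp
  define T where "T = t + 1"
  have T: "0 < T" "t \<in> {0..T}" using t by (auto simp: T_def)
  obtain R where R: "\<And>s. s \<le> T \<Longrightarrow> step_cdf (N s) R" using step_cdf_N[OF T(1)] by blast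
  have le: "\<bar>(LBINT x. N s x * f x) - (LBINT x. N t x * f x)\<bar> \<le> (LBINT x. \<bar>M x s - M x t\<bar>)" if s: "0 \<le> s" "s \<le> T" for s
  proof -
    interpret S: step_cdf "N s" R by (rule R) (use s in simp)
    interpret S': step_cdf "N t" R by (rule R) (use T in simp)
    have i: "integrable lborel (\<lambda>x. N s x * f x)" for s
      using integrable_mult_bounded[OF f(1), of "N s" 1] N_abs by (simp add: mult.commute)
    have i2: "integrable lborel (\<lambda>x. \<bar>N s x - N t x\<bar>)"
    proof (rule Bochner_Integration.integrable_bound)
      show "integrable lborel (indicator {-R..R} :: real \<Rightarrow> real)" by (auto simp: emeasure_lborel_Icc_eq)
      have "\<bar>N s x - N t x\<bar> \<le> indicator {-R..R} x" for x
        using S.lo[of x] S'.lo[of x] S.hi[of x] S'.hi[of x] N_bounds[of s x] N_bounds[of t x] by (auto simp: indicator_def)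
      then show "AE x in lborel. norm \<bar>N s x - N t x\<bar> \<le> norm (indicator {-R..R} x :: real)" by auto
    qed measurable
    have "(LBINT x. N s x * f x) - (LBINT x. N t x * f x) = (LBINT x. N s x * f x - N t x * f x)"
      using i by simp
    also have "\<bar>\<dots>\<bar> \<le> (LBINT x. \<bar>N s x - N t x\<bar>)"
    proof (rule abs_integral_le[OF _ i2])
      fix x
      have "\<bar>N s x - N t x\<bar> * \<bar>f x\<bar> \<le> \<bar>N s x - N t x\<bar> * 1" by (intro mult_left_mono f(2)) auto
      then show "\<bar>N s x * f x - N t x * f x\<bar> \<le> \<bar>N s x - N t x\<bar>" by (simp add: left_diff_distrib[symmetric] abs_mult)
    qed (use i in simp)
    finally show ?thesis using N_eq[of s] N_eq[of t] t s by simp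
  qed
  have "((\<lambda>s. LBINT x. \<bar>M x s - M x t\<bar>) \<longlongrightarrow> 0) (at t within {t..T})"
    using tendsto_within_subset[OF M_cont[OF T]] t by auto
  then have l: "((\<lambda>s. LBINT x. \<bar>M x s - M x t\<bar>) \<longlongrightarrow> 0) (at_right t)"
    by (simp add: at_within_Icc_at_right T_def)
  have "((\<lambda>s. (LBINT x. N s x * f x) - (LBINT x. N t x * f x)) \<longlongrightarrow> 0) (at_right t)"
  proof (rule Lim_null_comparison[OF _ l])
    show "\<forall>\<^sub>F s in at_right t. norm ((LBINT x. N s x * f x) - (LBINT x. N t x * f x)) \<le> (LBINT x. \<bar>M x s - M x t\<bar>)"
      using eventually_at_right_real[of t T] by (auto simp: T_def elim!: eventually_mono intro!: le[unfolded T_def] simp: t order_trans[OF t])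
  qed
  then show ?thesis unfolding continuous_within by (simp add: LIM_zero_iff)
qed

text \<open>\<open>s\<close> is the constant sign of \<open>M - \<alpha>\<close>, so the entropy is
  affine in \<open>M\<close>. The terms with \<open>\<alpha>\<close> and \<open>A \<alpha>\<close>
  carry the factor \<open>\<integral>g'\<close> or \<open>\<integral>f'\<close> and vanish. The two
  admissible pairs give opposite inequalities, hence an equality.\<close>

lemma weak_inequality:
  fixes \<alpha> s :: real
  assumes f: "smooth1 f" "\<And>x. (f has_real_derivative f' x) (at x)" "continuous_on UNIV f'"
      "\<And>x. x \<notin> {l..b} \<Longrightarrow> f x = 0 \<and> f' x = 0" "\<And>x. 0 \<le> f x" "\<And>x. f x \<le> 1"
    and g: "smooth1 g" "\<And>x. (g has_real_derivative g' x) (at x)" "continuous_on UNIV g'"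
      "\<And>x. x \<notin> {ta..tb} \<Longrightarrow> g x = 0 \<and> g' x = 0" "\<And>x. 0 \<le> g x"
    and cd: "0 < ta" "0 < tb"
    and s: "(\<alpha>, s) = (-1, 1) \<or> (\<alpha>, s) = (2, -1)"
  shows "0 \<le> s * ((LBINT t. g' t * (LBINT x. N t x * f x)) - (LBINT t. g t * (\<integral>m. f (X m t) * U m t \<partial>U01)))"
proof -
  define T where "T = tb + 1"
  have T: "0 < T" "tb < T" using cd by (auto simp: T_def)
  let ?\<zeta> = "\<lambda>x t. f x * g t"
  have fc: "continuous_on UNIV f" and gc: "continuous_on UNIV g"
    using smooth1_continuous[OF f(1), of UNIV 0] smooth1_continuous[OF g(1), of UNIV 0] by auto
  note [measurable] = borel_measurable_continuous_onI[OF fc] borel_measurable_continuous_onI[OF gc]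
     borel_measurable_continuous_onI[OF f(3)] borel_measurable_continuous_onI[OF g(3)]
  have fi: "integrable lborel f" "integrable lborel f'" and gi: "integrable lborel g" "integrable lborel g'"
    using integrable_continuous_support[OF fc, of l b] integrable_continuous_support[OF f(3), of l b]
      integrable_continuous_support[OF gc, of ta tb] integrable_continuous_support[OF g(3), of ta tb] f(4) g(4) by auto
  have fb: "\<bar>f x\<bar> \<le> 1" for x using f(5,6) by simp
  have \<zeta>: "test_st T ?\<zeta>" by (rule test_st_tensor[OF f(1) _ g(1)]) (use f(4) g(4) cd T in auto)
  have pdt: "pdt ?\<zeta> x t = f x * g' t" and pdx: "pdx ?\<zeta> x t = f' x * g t" for x t
    unfolding pdt_def pdx_def by (auto intro!: DERIV_imp_deriv DERIV_cmult DERIV_cmult_right f g)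
  define \<Phi> where "\<Phi> t = (LBINT x. N t x * f x)" for t
  define If where "If = (LBINT x. f x)"
  define qa where "qa t = (\<integral>m. f (X m t) * a m \<partial>U01)" for t
  define qc where "qc t = (\<integral>m. f (X m t) * c (X m t) t \<partial>U01)" for t
  define p where "p t = (\<integral>m. f (X m t) * U m t \<partial>U01)" for t
  have [measurable]: "\<Phi> \<in> borel_measurable borel" "qa \<in> borel_measurable borel" "qc \<in> borel_measurable borel" "p \<in> borel_measurable borel"
    unfolding \<Phi>_def[abs_def] qa_def[abs_def] qc_def[abs_def] p_def[abs_def] by measurable
  have Ni: "integrable lborel (\<lambda>x. N t x * f x)" for t
    using integrable_mult_bounded[OF fi(1), of "N t" 1] N_abs by (simp add: mult.commute)
  have \<Phi>b: "\<bar>\<Phi> t\<bar> \<le> (LBINT x. f x)" for t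
    unfolding \<Phi>_def by (rule abs_integral_le[OF Ni fi(1)]) (use f(5) N_abs in \<open>auto simp: abs_mult intro!: mult_left_le_one_le\<close>)
  have qab: "\<bar>qa t\<bar> \<le> K" for t
    unfolding qa_def by (rule L01_average_bound) (measurable, use a_bound fb in \<open>auto simp: abs_mult intro: order_trans[OF mult_left_le_one_le]\<close>)
  have qcb: "\<bar>qc t\<bar> \<le> \<omega>_bound" for t
    unfolding qc_def by (rule L01_average_bound) (measurable, use c_bound fb in \<open>auto simp: abs_mult intro: order_trans[OF mult_left_le_one_le]\<close>)
  have qp: "qa t = p t + qc t" for t
    unfolding qa_def p_def qc_def by (rule integral_a_eq_U[OF _ fb]) measurable
  have pb: "\<bar>p t\<bar> \<le> K + \<omega>_bound" for t using qab[of t] qcb[of t] qp[of t] by linarith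
  have first: "(LBINT x. \<bar>M x t - \<alpha>\<bar> * pdt ?\<zeta> x t + sgn (M x t - \<alpha>) * (A (M x t) - A \<alpha>) * pdx ?\<zeta> x t)
      = s * (g' t * \<Phi> t - \<alpha> * If * g' t - g t * qa t)" for t
  proof (cases "t \<in> {ta..tb}")
    case False
    then show ?thesis using g(4)[of t] by (simp add: pdt pdx)
  next
    case True
    then have t: "0 \<le> t" using cd by simp
    have Ai: "integrable lborel (\<lambda>x. f' x * A (M x t))"
    proof (rule integrable_mult_bounded[OF fi(2)])
      have eq: "A (M x t) = (\<integral>m. a m * indicator {..N t x} m \<partial>U01)" for x
        using N_bounds[of t x] by (simp add: N_eq[OF t] A_eq)
      show "(\<lambda>x. A (M x t)) \<in> borel_measurable lborel"
        unfolding eq indicator_def atMost_iff by measurable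
      show "\<bar>A (M x t)\<bar> \<le> K" for x
        unfolding eq by (rule L01_average_bound) (measurable, use a_bound order_trans[OF abs_ge_zero a_bound] in \<open>auto simp: indicator_def\<close>)
    qed
    have "\<bar>M x t - \<alpha>\<bar> * pdt ?\<zeta> x t + sgn (M x t - \<alpha>) * (A (M x t) - A \<alpha>) * pdx ?\<zeta> x t
       = s * g' t * (N t x * f x) - s * \<alpha> * g' t * f x + (s * g t * (f' x * A (M x t)) - s * g t * A \<alpha> * f' x)" for x
    proof -
      have e: "\<bar>M x t - \<alpha>\<bar> = s * (N t x - \<alpha>)" "sgn (M x t - \<alpha>) = s"
        using s N_bounds[of t x] by (auto simp: N_eq[OF t])
      show ?thesis unfolding e pdt pdx by (simp add: algebra_simps)
    qed
    then have "(LBINT x. \<bar>M x t - \<alpha>\<bar> * pdt ?\<zeta> x t + sgn (M x t - \<alpha>) * (A (M x t) - A \<alpha>) * pdx ?\<zeta> x t)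
       = s * g' t * \<Phi> t - s * \<alpha> * g' t * If + (s * g t * (LBINT x. f' x * A (M x t)) - s * g t * A \<alpha> * (LBINT x. f' x))"
      using Ni[of t] fi Ai by (simp add: \<Phi>_def If_def)
    also have "(LBINT x. f' x) = 0" by (rule integral_derivative_eq_0[OF f(2,3,4)])
    also have "(LBINT x. f' x * A (M x t)) = - qa t"
      using integral_A_derivative[OF t f(2,3,4)] by (simp add: qa_def mult.commute)
    finally show ?thesis by (simp add: algebra_simps)
  qed
  have second: "integral\<^sup>L (LS (\<lambda>x. max (M x t - \<alpha>) 0)) (\<lambda>x. ?\<zeta> x t * conv_fun \<phi> M x t)
                 - integral\<^sup>L (LS (\<lambda>x. min (M x t - \<alpha>) 0)) (\<lambda>x. ?\<zeta> x t * conv_fun \<phi> M x t) = s * (g t * qc t)" for t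
  proof (cases "t \<in> {ta..tb}")
    case False
    then show ?thesis using g(4)[of t] by simp
  next
    case True
    then have t: "0 \<le> t" using cd by simp
    obtain R where "step_cdf (N t) R" by (rule step_cdf_N')
    then interpret S: step_cdf "N t" R .
    have eq: "(\<lambda>x. ?\<zeta> x t * conv_fun \<phi> M x t) = (\<lambda>x. g t * (f x * c x t))"
      by (simp add: conv_fun_eq[OF t] fun_eq_iff)
    \<comment> \<open>One truncation is a translate of \<open>M\<close>, with the same Stieltjes
      measure, and the other is 0; the difference of the two integrals is therefore \<open>s\<close>
      times the integral against the measure of \<open>M\<close>.\<close>
    have LSN: "integral\<^sup>L (LS (\<lambda>x. N t x + k)) (\<lambda>x. ?\<zeta> x t * conv_fun \<phi> M x t) = g t * qc t" for k
      unfolding S.LS_add_const eq by (subst S.integral_LS) (simp_all add: qc_def X_def)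
    from s show ?thesis
    proof
      assume s: "(\<alpha>, s) = (-1, 1)"
      have "(\<lambda>x. max (M x t - \<alpha>) 0) = (\<lambda>x. N t x + 1)" "(\<lambda>x. min (M x t - \<alpha>) 0) = (\<lambda>x. 0)"
        using s N_bounds[of t] by (auto simp: N_eq[OF t] fun_eq_iff max_def min_def) (smt (verit))+
      then show ?thesis using s LSN[of 1] by (simp only: integral_LS_const) simp
    next
      assume s: "(\<alpha>, s) = (2, -1)"
      have "(\<lambda>x. max (M x t - \<alpha>) 0) = (\<lambda>x. 0)" "(\<lambda>x. min (M x t - \<alpha>) 0) = (\<lambda>x. N t x + (-2))"
        using s N_bounds[of t] by (auto simp: N_eq[OF t] fun_eq_iff max_def min_def) (smt (verit))+
      then show ?thesis using s LSN[of "-2"] by (simp only: integral_LS_const) simp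
    qed
  qed
  have i1: "integrable lborel (\<lambda>t. g' t * \<Phi> t)" by (rule integrable_mult_bounded[OF gi(2) _ \<Phi>b]) measurable
  have i2: "integrable lborel (\<lambda>t. g t * qa t)" by (rule integrable_mult_bounded[OF gi(1) _ qab]) measurable
  have i3: "integrable lborel (\<lambda>t. g t * qc t)" by (rule integrable_mult_bounded[OF gi(1) _ qcb]) measurable
  have "0 \<le> (LBINT t. s * (g' t * \<Phi> t - \<alpha> * If * g' t - g t * qa t)) + (LBINT t. s * (g t * qc t))"
    using entropy[OF T(1) \<zeta>, of \<alpha>] f(5) g(5) unfolding first second by simp
  also have "\<dots> = s * ((LBINT t. g' t * \<Phi> t) - \<alpha> * If * (LBINT t. g' t) - (LBINT t. g t * qa t) + (LBINT t. g t * qc t))"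
    using i1 i2 i3 gi by (simp add: algebra_simps)
  also have "(LBINT t. g' t) = 0" by (rule integral_derivative_eq_0[OF g(2,3,4)])
  also have "(LBINT t. g t * p t) = (LBINT t. g t * qa t) - (LBINT t. g t * qc t)"
    using i2 i3 by (subst Bochner_Integration.integral_diff[symmetric]) (auto simp: qp algebra_simps)
  then have "(LBINT t. g' t * \<Phi> t) - \<alpha> * If * 0 - (LBINT t. g t * qa t) + (LBINT t. g t * qc t) = (LBINT t. g' t * \<Phi> t) - (LBINT t. g t * p t)"
    by simp
  finally show ?thesis unfolding \<Phi>_def p_def .
qed

lemma momentum_average_bound:
  assumes [measurable]: "f \<in> borel_measurable borel" and f: "\<And>x. \<bar>f x\<bar> \<le> 1"
  shows "\<bar>\<integral>m. f (X m t) * U m t \<partial>U01\<bar> \<le> u_bound"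
proof (rule L01_average_bound)
  show "\<bar>f (X m t) * U m t\<bar> \<le> u_bound" for m
  proof -
    have "\<bar>f (X m t)\<bar> * \<bar>U m t\<bar> \<le> 1 * u_bound" by (intro mult_mono f U_bounded) auto
    then show ?thesis by (simp add: abs_mult)
  qed
qed measurable

text \<open>The derivatives of time pulses approximating the indicator of \<open>(s,t]\<close>
  evaluate \<open>\<Phi>\<close> at both ends. Test functions vanish near time 0, so this gives the
  identity from a time \<open>s > 0\<close> only; right continuity at 0 then lets \<open>s\<close>
  tend to 0.\<close>

lemma weak_form_smooth:
  assumes f: "smooth1 f" "\<And>x. (f has_real_derivative f' x) (at x)" "continuous_on UNIV f'"
      "\<And>x. x \<notin> {l..b} \<Longrightarrow> f x = 0 \<and> f' x = 0" "\<And>x. 0 \<le> f x" "\<And>x. f x \<le> 1"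
    and t: "0 \<le> t"
  shows "(LBINT x. N t x * f x) - (LBINT x. N 0 x * f x) = - (\<integral>s. (\<integral>m. f (X m s) * U m s \<partial>U01) \<partial>Leb {0..t})"
proof (cases "t = 0")
  case True
  then show ?thesis using integral_Leb_Icc_self[of 0] by simp
next
  case False
  with t have t: "0 < t" by simp
  have fc: "continuous_on UNIV f" using smooth1_continuous[OF f(1), of UNIV 0] by auto
  note [measurable] = borel_measurable_continuous_onI[OF fc]
  have fi: "integrable lborel f"
    using integrable_continuous_support[OF fc, of l b] f(4) by auto
  have fb: "\<bar>f x\<bar> \<le> 1" for x using f(5,6) by simp
  define \<Phi> where "\<Phi> t = (LBINT x. N t x * f x)" for t
  define p where "p t = (\<integral>m. f (X m t) * U m t \<partial>U01)" for t
  have [measurable]: "\<Phi> \<in> borel_measurable borel" "p \<in> borel_measurable borel"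
    unfolding \<Phi>_def[abs_def] p_def[abs_def] by measurable
  have Ni: "integrable lborel (\<lambda>x. N t x * f x)" for t
    using integrable_mult_bounded[OF fi, of "N t" 1] N_abs by (simp add: mult.commute)
  have \<Phi>b: "\<bar>\<Phi> t\<bar> \<le> (LBINT x. f x)" for t
    unfolding \<Phi>_def by (rule abs_integral_le[OF Ni fi]) (use f(5) N_abs in \<open>auto simp: abs_mult intro!: mult_left_le_one_le\<close>)
  have pb: "\<bar>p t\<bar> \<le> u_bound" for t
    unfolding p_def by (rule momentum_average_bound[OF _ fb]) measurable
  have \<Phi>c: "continuous (at_right t) \<Phi>" if "0 \<le> t" for t
    unfolding \<Phi>_def[abs_def] by (rule Phi_right_continuous[OF fi fb that])
  have pI: "integrable (Leb {0..t}) p" for t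
    by (rule borel_measurable_bounded_integrable[OF finite_measure_Leb_Icc _ pb]) simp
  have main: "\<Phi> s - \<Phi> t = (integral\<^sup>L (Leb {0..t}) p - integral\<^sup>L (Leb {0..s}) p)" if s: "0 < s" "s < t" for s
  proof -
    obtain g g' :: "nat \<Rightarrow> real \<Rightarrow> real" where g: "\<And>n. smooth1 (g n)"
    "\<And>n x. (g n has_real_derivative g' n x) (at x)" "\<And>n. continuous_on UNIV (g' n)"
    "\<And>n x. 0 \<le> g n x" "\<And>n x. g n x \<le> 1"
    "\<And>n x. x < s \<or> t + 1 / real (Suc n) < x \<Longrightarrow> g n x = 0 \<and> g' n x = 0"
    "\<And>x. (\<lambda>n. g n x) \<longlonglongrightarrow> indicator {s<..t} x"
    "\<And>\<Phi> B. \<Phi> \<in> borel_measurable borel \<Longrightarrow> (\<And>t. \<bar>\<Phi> t\<bar> \<le> B) \<Longrightarrow> continuous (at_right s) \<Phi> \<Longrightarrow> continuous (at_right t) \<Phi> \<Longrightarrow>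
      (\<lambda>n. LBINT t. g' n t * \<Phi> t) \<longlonglongrightarrow> \<Phi> s - \<Phi> t"
      by (rule smooth_pulses[OF s(2)]) blast
    have g0: "g n x = 0 \<and> g' n x = 0" if "x \<notin> {s..t + 1}" for n x
    proof -
      have "1 / real (Suc n) \<le> 1" by simp
      then show ?thesis using that by (intro g(6)) (simp only: atLeastAtMost_iff, linarith)
    qed
    have [measurable]: "g n \<in> borel_measurable borel" for n
      using smooth1_continuous[OF g(1), of UNIV 0 n] borel_measurable_continuous_onI by auto
    have eq: "(LBINT t. g' n t * \<Phi> t) = (LBINT t. g n t * p t)" for n
    proof -
      have "0 \<le> \<sigma> * ((LBINT t. g' n t * \<Phi> t) - (LBINT t. g n t * p t))" if "(\<alpha>, \<sigma>) = (-1, 1) \<or> (\<alpha>, \<sigma>) = (2, -1)" for \<alpha> \<sigma> :: real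
        unfolding \<Phi>_def p_def
        by (rule weak_inequality[where ta=s and tb="t + 1", OF f g(1,2,3) g0 g(4) _ _ that]) (use s in auto)
      from this[of "-1" 1] this[of 2 "-1"]
      have "(LBINT t. g n t * p t) \<le> (LBINT t. g' n t * \<Phi> t)" "(LBINT t. g' n t * \<Phi> t) \<le> (LBINT t. g n t * p t)"
        by simp_all
      then show ?thesis by (rule antisym[rotated])
    qed
    have "(\<lambda>n. LBINT t. g n t * p t) \<longlonglongrightarrow> (LBINT r. indicator {s<..t} r * p r)"
    proof (rule integral_dominated_convergence[where w="\<lambda>r. indicator {s..t+1} r * u_bound"])
      show "integrable lborel (\<lambda>r. indicator {s..t+1} r * u_bound)"
        by (intro integrable_mult_left integrable_real_indicator) (auto simp: emeasure_lborel_Icc_eq)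
      show "AE r in lborel. norm (g n r * p r) \<le> indicator {s..t+1} r * u_bound" for n
      proof (rule AE_I2)
        fix r
        have "\<bar>g n r\<bar> * \<bar>p r\<bar> \<le> indicator {s..t+1} r * u_bound"
          using g(4)[of n r] g(5)[of n r] g0[of r n] by (intro mult_mono pb) (auto simp: indicator_def)
        then show "norm (g n r * p r) \<le> indicator {s..t+1} r * u_bound" by (simp add: abs_mult)
      qed
      show "AE r in lborel. (\<lambda>n. g n r * p r) \<longlonglongrightarrow> indicator {s<..t} r * p r"
        by (intro AE_I2 tendsto_intros g(7))
    qed measurable
    moreover have "(\<lambda>n. LBINT t. g' n t * \<Phi> t) \<longlonglongrightarrow> \<Phi> s - \<Phi> t"
      by (rule g(8)[OF _ \<Phi>b \<Phi>c \<Phi>c]) (use s in auto)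
    ultimately have "\<Phi> s - \<Phi> t = (LBINT r. indicator {s<..t} r * p r)"
      unfolding eq using LIMSEQ_unique by blast
    then show ?thesis using integral_Leb_Icc_diff(1)[OF pI, of s t t] s by simp
  qed
  have lim0: "((\<lambda>s. integral\<^sup>L (Leb {0..t}) p - integral\<^sup>L (Leb {0..s}) p) \<longlongrightarrow> integral\<^sup>L (Leb {0..t}) p - integral\<^sup>L (Leb {0..0}) p) (at_right 0)"
  proof (intro tendsto_intros)
    have "continuous_on UNIV (\<lambda>t. integral\<^sup>L (Leb {0..t}) p)"
      by (rule continuous_Leb_integral[OF _ pb]) measurable
    then have "((\<lambda>t. integral\<^sup>L (Leb {0..t}) p) \<longlongrightarrow> integral\<^sup>L (Leb {0..0}) p) (at 0)"
      unfolding continuous_on_def by (rule bspec) simp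
    then show "((\<lambda>t. integral\<^sup>L (Leb {0..t}) p) \<longlongrightarrow> integral\<^sup>L (Leb {0..0}) p) (at_right 0)"
      by (rule filterlim_mono) (auto simp: at_le)
  qed
  have "((\<lambda>s. \<Phi> s - \<Phi> t) \<longlongrightarrow> \<Phi> 0 - \<Phi> t) (at_right 0)"
    using \<Phi>c[of 0] by (intro tendsto_intros) (simp add: continuous_within)
  then have "((\<lambda>s. integral\<^sup>L (Leb {0..t}) p - integral\<^sup>L (Leb {0..s}) p) \<longlongrightarrow> \<Phi> 0 - \<Phi> t) (at_right 0)"
  proof (rule Lim_transform_eventually)
    show "\<forall>\<^sub>F s in at_right 0. \<Phi> s - \<Phi> t = integral\<^sup>L (Leb {0..t}) p - integral\<^sup>L (Leb {0..s}) p"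
      using eventually_at_right_real[OF t] by (rule eventually_mono) (use main in auto)
  qed
  from tendsto_unique[OF _ this lim0] have "\<Phi> 0 - \<Phi> t = integral\<^sup>L (Leb {0..t}) p"
    using integral_Leb_Icc_self[of 0 p] by simp
  then show ?thesis unfolding \<Phi>_def p_def by simp
qed

text \<open>The sharp window is what makes the Steklov averages below satisfy an exact integral
  equation in time.\<close>

lemma weak_form:
  assumes ab: "l < r" and t: "0 \<le> t"
  shows "(LBINT x. N t x * indicator {l<..r} x) - (LBINT x. N 0 x * indicator {l<..r} x) =
    - (\<integral>s. (\<integral>m. indicator {l<..r} (X m s) * U m s \<partial>U01) \<partial>Leb {0..t})"
proof -
  obtain f f' :: "nat \<Rightarrow> real \<Rightarrow> real" where f: "\<And>n. smooth1 (f n)"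
    "\<And>n x. (f n has_real_derivative f' n x) (at x)" "\<And>n. continuous_on UNIV (f' n)"
    "\<And>n x. 0 \<le> f n x" "\<And>n x. f n x \<le> 1"
    "\<And>n x. x < l \<or> r + 1 / real (Suc n) < x \<Longrightarrow> f n x = 0 \<and> f' n x = 0"
    "\<And>x. (\<lambda>n. f n x) \<longlonglongrightarrow> indicator {l<..r} x"
    by (rule smooth_pulses[OF ab]) blast
  have f0: "f n x = 0 \<and> f' n x = 0" if "x \<notin> {l..r + 1}" for n x
  proof -
    have "1 / real (Suc n) \<le> 1" by simp
    then show ?thesis using that by (intro f(6)) (simp only: atLeastAtMost_iff, linarith)
  qed
  have [measurable]: "f n \<in> borel_measurable borel" for n
    using smooth1_continuous[OF f(1), of UNIV 0 n] borel_measurable_continuous_onI by auto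
  have fb: "\<bar>f n x\<bar> \<le> 1" for n x using f(4,5)[of n x] by simp
  have lim1: "(\<lambda>n. LBINT x. N t x * f n x) \<longlonglongrightarrow> (LBINT x. N t x * indicator {l<..r} x)" for t
  proof (rule integral_dominated_convergence[where w="indicator {l..r+1}"])
    show "integrable lborel (indicator {l..r+1} :: real \<Rightarrow> real)" by (auto simp: emeasure_lborel_Icc_eq)
    show "AE x in lborel. norm (N t x * f n x) \<le> indicator {l..r+1} x" for n
    proof (rule AE_I2)
      fix x
      have "\<bar>N t x\<bar> * \<bar>f n x\<bar> \<le> 1 * indicator {l..r+1} x"
        using f0[of x n] fb[of n x] by (intro mult_mono N_abs) (auto simp: indicator_def)
      then show "norm (N t x * f n x) \<le> indicator {l..r+1} x" by (simp add: abs_mult)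
    qed
    show "AE x in lborel. (\<lambda>n. N t x * f n x) \<longlonglongrightarrow> N t x * indicator {l<..r} x"
      by (intro AE_I2 tendsto_intros f(7))
  qed measurable
  have lim2: "(\<lambda>n. \<integral>m. f n (X m s) * U m s \<partial>U01) \<longlonglongrightarrow> (\<integral>m. indicator {l<..r} (X m s) * U m s \<partial>U01)" for s
  proof (rule integral_dominated_convergence[where w="\<lambda>_. u_bound"])
    show "AE m in U01. norm (f n (X m s) * U m s) \<le> u_bound" for n
    proof (rule AE_I2)
      fix m
      have "\<bar>f n (X m s)\<bar> * \<bar>U m s\<bar> \<le> 1 * u_bound" by (intro mult_mono fb U_bounded) auto
      then show "norm (f n (X m s) * U m s) \<le> u_bound" by (simp add: abs_mult)
    qed
    show "AE m in U01. (\<lambda>n. f n (X m s) * U m s) \<longlonglongrightarrow> indicator {l<..r} (X m s) * U m s"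
      by (intro AE_I2 tendsto_intros f(7))
    show "integrable U01 (\<lambda>_. u_bound)" by simp
  qed measurable
  have lim3: "(\<lambda>n. \<integral>s. (\<integral>m. f n (X m s) * U m s \<partial>U01) \<partial>Leb {0..t}) \<longlonglongrightarrow>
     (\<integral>s. (\<integral>m. indicator {l<..r} (X m s) * U m s \<partial>U01) \<partial>Leb {0..t})"
  proof (rule integral_dominated_convergence[where w="\<lambda>_. u_bound"])
    show "AE s in Leb {0..t}. norm (\<integral>m. f n (X m s) * U m s \<partial>U01) \<le> u_bound" for n
      by (rule AE_I2, unfold real_norm_def, rule momentum_average_bound[OF _ fb]) measurable
  qed (measurable, auto intro!: lim2)
  have "(\<lambda>n. (LBINT x. N t x * f n x) - (LBINT x. N 0 x * f n x)) \<longlonglongrightarrow> (LBINT x. N t x * indicator {l<..r} x) - (LBINT x. N 0 x * indicator {l<..r} x)"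
    by (intro tendsto_intros lim1)
  moreover have "(LBINT x. N t x * f n x) - (LBINT x. N 0 x * f n x) = - (\<integral>s. (\<integral>m. f n (X m s) * U m s \<partial>U01) \<partial>Leb {0..t})" for n
    by (rule weak_form_smooth[OF f(1,2,3) f0 f(4,5) t])
  ultimately show ?thesis using tendsto_minus[OF lim3] LIMSEQ_unique by (simp only:) blast
qed

end

section \<open>The differential equation of the quantiles\<close>

text \<open>Equality extends from continuous to bounded Borel test functions; testing with
  \<open>sgn (v - w)\<close> makes the integral of the absolute difference vanish.\<close>

lemma AE_eq_if_integral_continuous_eq:
  fixes v w :: "real \<Rightarrow> real"
  assumes [measurable]: "v \<in> borel_measurable borel" "w \<in> borel_measurable borel"
    and b: "\<And>m. \<bar>v m\<bar> \<le> B" "\<And>m. \<bar>w m\<bar> \<le> B"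
    and eq: "\<And>g. continuous_on UNIV g \<Longrightarrow> (\<And>x. \<bar>g x\<bar> \<le> 1) \<Longrightarrow> (\<integral>m. g m * v m \<partial>U01) = (\<integral>m. g m * w m \<partial>U01)"
  shows "AE m in U01. v m = w m"
proof -
  note iv = integrable_U01[OF assms(1) b(1)] and iw = integrable_U01[OF assms(2) b(2)]
  have "(\<integral>m. sgn (v m - w m) * v m \<partial>U01) = (\<integral>m. sgn (v m - w m) * w m \<partial>U01)"
    by (rule weighted_pushforward_eq_borel[where y="\<lambda>x. x" and z="\<lambda>x. x" and B=1, OF _ _ iv iw eq])
       (auto simp: sgn_if)
  moreover have "integrable U01 (\<lambda>m. v m * sgn (v m - w m))" "integrable U01 (\<lambda>m. w m * sgn (v m - w m))"
    by (rule integrable_mult_bounded[OF iv, where B=1] integrable_mult_bounded[OF iw, where B=1]; auto simp: sgn_if)+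
  ultimately have "(\<integral>m. v m * sgn (v m - w m) - w m * sgn (v m - w m) \<partial>U01) = 0"
    by (simp add: mult.commute)
  moreover have "v m * sgn (v m - w m) - w m * sgn (v m - w m) = \<bar>v m - w m\<bar>" for m
    by (auto simp: sgn_if abs_if)
  ultimately have "(\<integral>m. \<bar>v m - w m\<bar> \<partial>U01) = 0" by (simp only:)
  moreover have "integrable U01 (\<lambda>m. \<bar>v m - w m\<bar>)" using iv iw by auto
  ultimately have "AE m in U01. \<bar>v m - w m\<bar> = 0"
    by (subst integral_nonneg_eq_0_iff_AE[symmetric]) auto
  then show ?thesis by (rule eventually_mono) simp
qed

text \<open>The first form is for windows to the right of a point \<open>x\<close>. The second
  appears when \<open>x < X \<le> x + e\<close> is read as a condition on \<open>x\<close>, which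
  exchanges the closed end.\<close>

lemma integral_window_eq_U01:
  fixes h :: "real \<Rightarrow> real"
  assumes [measurable]: "h \<in> borel_measurable borel" and e: "0 < e"
  shows "(LBINT y. h y * indicator {x<..x + e} y) = e * (\<integral>r. h (x + r * e) \<partial>U01)"
    and "(LBINT y. h y * indicator {x..<x + e} y) = e * (\<integral>r. h (x + r * e) \<partial>U01)"
proof -
  have i: "(\<integral>r. h (x + r * e) \<partial>U01) = (LBINT r. indicator {0<..<1} r * h (x + r * e))"
    by (rule integral_Leb) auto
  have "(LBINT y. h y * indicator {x<..x + e} y) = e * (LBINT r. h (x + e * r) * indicator {x<..x + e} (x + e * r))"
    using lborel_integral_real_affine[of e "\<lambda>y. h y * indicator {x<..x + e} y" x] e by simp
  also have "(LBINT r. h (x + e * r) * indicator {x<..x + e} (x + e * r)) = (LBINT r. indicator {0<..<1} r * h (x + r * e))"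
  proof (rule integral_cong_AE)
    show "AE r in lborel. h (x + e * r) * indicator {x<..x + e} (x + e * r) = indicator {0<..<1} r * h (x + r * e)"
      using AE_lborel_singleton[of 1] by (rule eventually_mono) (use e in \<open>auto simp: indicator_def mult.commute zero_less_mult_iff\<close>)
  qed (unfold indicator_def greaterThanAtMost_iff greaterThanLessThan_iff, measurable)
  finally show "(LBINT y. h y * indicator {x<..x + e} y) = e * (\<integral>r. h (x + r * e) \<partial>U01)" unfolding i .
  have "(LBINT y. h y * indicator {x..<x + e} y) = e * (LBINT r. h (x + e * r) * indicator {x..<x + e} (x + e * r))"
    using lborel_integral_real_affine[of e "\<lambda>y. h y * indicator {x..<x + e} y" x] e by simp
  also have "(LBINT r. h (x + e * r) * indicator {x..<x + e} (x + e * r)) = (LBINT r. indicator {0<..<1} r * h (x + r * e))"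
  proof (rule integral_cong_AE)
    show "AE r in lborel. h (x + e * r) * indicator {x..<x + e} (x + e * r) = indicator {0<..<1} r * h (x + r * e)"
      using AE_lborel_singleton[of 0] by (rule eventually_mono) (use e in \<open>auto simp: indicator_def mult.commute zero_le_mult_iff\<close>)
  qed (unfold indicator_def atLeastLessThan_iff greaterThanLessThan_iff, measurable)
  finally show "(LBINT y. h y * indicator {x..<x + e} y) = e * (\<integral>r. h (x + r * e) \<partial>U01)" unfolding i .
qed

section \<open>Steklov averages of the solution\<close>

context entropy_lagrangian begin

lemma Leb_bounded_integral:
  assumes "f \<in> borel_measurable borel" "\<And>s. \<bar>f s\<bar> \<le> (B::real)" "0 \<le> t"
  shows "\<bar>integral\<^sup>L (Leb {0..t}) f\<bar> \<le> B * t"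
  using Leb_integral_Lipschitz[OF assms(1,2), of t 0] integral_Leb_Icc_self[of 0 f] assms(3) by simp

text \<open>Steklov averages in space are absolutely continuous in time, so that the classical chain
  rule applies to them.\<close>

definition steklov :: "nat \<Rightarrow> real \<Rightarrow> real \<Rightarrow> real" where
  "steklov n x s = (\<integral>r. N s (x + r / real (Suc n)) \<partial>U01)"

text \<open>Mean momentum over the averaging window, equal to minus the time derivative of
  \<open>steklov\<close> by \<open>steklov_eq\<close>.\<close>

definition flow :: "nat \<Rightarrow> real \<Rightarrow> real \<Rightarrow> real" where
  "flow n x s = real (Suc n) * (\<integral>m. indicator {x<..x + 1 / real (Suc n)} (X m s) * U m s \<partial>U01)"

lemma steklov_meas [measurable (raw)]:
  assumes [measurable]: "f \<in> borel_measurable W" "g \<in> borel_measurable W"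
  shows "(\<lambda>w. steklov n (f w) (g w)) \<in> borel_measurable W"
  unfolding steklov_def by measurable

lemma flow_meas [measurable (raw)]:
  assumes [measurable]: "f \<in> borel_measurable W" "g \<in> borel_measurable W"
  shows "(\<lambda>w. flow n (f w) (g w)) \<in> borel_measurable W"
  unfolding flow_def indicator_def greaterThanAtMost_iff by measurable

lemma flow_bound: "\<bar>flow n x s\<bar> \<le> real (Suc n) * u_bound"
  unfolding flow_def abs_mult
  by (intro mult_mono momentum_average_bound) (auto simp: indicator_def)

lemma steklov_bounds: "0 \<le> steklov n x s" "steklov n x s \<le> 1"
proof -
  have "\<bar>steklov n x s\<bar> \<le> 1" unfolding steklov_def by (rule L01_average_bound) (measurable, rule N_abs)
  then show "steklov n x s \<le> 1" by simp
  show "0 \<le> steklov n x s" unfolding steklov_def by (rule Bochner_Integration.integral_nonneg) (simp add: N_bounds)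
qed

lemma steklov_eq: "0 \<le> t \<Longrightarrow> steklov n x t = steklov n x 0 + integral\<^sup>L (Leb {0..t}) (\<lambda>s. - flow n x s)"
proof -
  assume t: "0 \<le> t"
  have e: "0 < 1 / real (Suc n)" by simp
  have st: "(LBINT y. N s y * indicator {x<..x + 1 / real (Suc n)} y) = 1 / real (Suc n) * steklov n x s" for s
    using integral_window_eq_U01(1)[OF _ e, of "N s" x] by (simp add: steklov_def del: of_nat_Suc)
  have "1 / real (Suc n) * (steklov n x t - steklov n x 0) = - (\<integral>s. (\<integral>m. indicator {x<..x + 1 / real (Suc n)} (X m s) * U m s \<partial>U01) \<partial>Leb {0..t})"
    using weak_form[OF _ t, of x "x + 1 / real (Suc n)"] e unfolding st by (simp add: right_diff_distrib del: of_nat_Suc)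
  then have "steklov n x t - steklov n x 0 = real (Suc n) * - (\<integral>s. (\<integral>m. indicator {x<..x + 1 / real (Suc n)} (X m s) * U m s \<partial>U01) \<partial>Leb {0..t})"
    by (simp add: field_simps del: of_nat_Suc)
  also have "\<dots> = (\<integral>s. - flow n x s \<partial>Leb {0..t})"
    unfolding flow_def by simp
  finally show ?thesis by simp
qed

lemma steklov_chain_rule:
  assumes G: "\<And>x. (G has_real_derivative g x) (at x)" and g: "continuous_on UNIV g" and t: "0 \<le> t"
  shows "G (steklov n x t) - G (steklov n x 0) = - (\<integral>s. g (steklov n x s) * flow n x s \<partial>Leb {0..t})"
proof -
  have [measurable]: "g \<in> borel_measurable borel" by (rule borel_measurable_continuous_onI[OF g])
  \<comment> \<open>The chain rule expects the integral representation at all real times, so it is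
    imposed by definition; from time 0 on \<open>Y\<close> is the Steklov average.\<close>
  define Y where "Y t = steklov n x 0 + integral\<^sup>L (Leb {0..t}) (\<lambda>s. - flow n x s)" for t
  have Y: "Y t = steklov n x t" if "0 \<le> t" for t unfolding Y_def steklov_eq[OF that] ..
  have fm: "(\<lambda>s. - flow n x s) \<in> borel_measurable borel" by measurable
  have fb: "\<bar>- flow n x s\<bar> \<le> real (Suc n) * u_bound" for s using flow_bound by simp
  have [measurable]: "Y \<in> borel_measurable borel"
    unfolding Y_def[abs_def]
    by (rule borel_measurable_continuous_onI) (intro continuous_intros continuous_Leb_integral[OF fm fb])
  have "G (Y t) - G (Y 0) = (\<integral>s. g (Y s) * - flow n x s \<partial>Leb {0..t})"
    by (rule chain_rule_integral_1[OF fm fb Y_def G g t])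
  also have "\<dots> = (\<integral>s. - (g (steklov n x s) * flow n x s) \<partial>Leb {0..t})"
  proof (rule integral_cong_AE)
    show "AE s in Leb {0..t}. g (Y s) * - flow n x s = - (g (steklov n x s) * flow n x s)"
      using AE_Leb_Icc by (rule eventually_mono) (simp add: Y)
  qed measurable
  finally show ?thesis using t by (simp add: Y)
qed

text \<open>Exchange the order of integration: for a fixed label, the windows that contain
  \<open>X m s\<close> start at \<open>X m s + (\<theta> - 1) / Suc n\<close> with
  \<open>\<theta>\<close> uniform. These are the sliding windows of
  \<open>steklov_tendsto_jump_avg\<close>.\<close>

lemma flow_window:
  assumes [measurable]: "g \<in> borel_measurable borel" and g: "\<And>x. \<bar>g x\<bar> \<le> B" and S: "step_cdf (N s) R"
  shows "(\<integral>x. g (steklov n x s) * flow n x s \<partial>Leb {-R-1..R+1}) =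
    (\<integral>m. U m s * (\<integral>\<theta>. g (\<integral>r. N s (X m s + (\<theta> - 1 + r) / real (Suc n)) \<partial>U01) \<partial>U01) \<partial>U01)"
proof -
  interpret S: step_cdf "N s" R by (rule S)
  let ?e = "1 / real (Suc n)"
  have e: "0 < ?e" "?e \<le> 1" by simp_all
  have B: "0 \<le> B" using order_trans[OF abs_ge_zero g] .
  have "(\<integral>x. g (steklov n x s) * flow n x s \<partial>Leb {-R-1..R+1}) =
     (\<integral>x. (\<integral>m. g (steklov n x s) * real (Suc n) * (indicator {x<..x + ?e} (X m s) * U m s) \<partial>U01) \<partial>Leb {-R-1..R+1})"
    unfolding flow_def by (simp add: mult.assoc)
  also have "\<dots> = (\<integral>m. (\<integral>x. g (steklov n x s) * real (Suc n) * (indicator {x<..x + ?e} (X m s) * U m s) \<partial>Leb {-R-1..R+1}) \<partial>U01)"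
  proof (rule bounded_Fubini[OF finite_measure_Leb_Icc L01.finite_measure, where B="B * real (Suc n) * (1 * u_bound)"])
    show "(\<lambda>(x, m). g (steklov n x s) * real (Suc n) * (indicator {x<..x + ?e} (X m s) * U m s)) \<in> borel_measurable (Leb {-R-1..R+1} \<Otimes>\<^sub>M U01)"
      unfolding indicator_def greaterThanAtMost_iff by measurable
    show "\<bar>g (steklov n x s) * real (Suc n) * (indicator {x<..x + ?e} (X m s) * U m s)\<bar> \<le> B * real (Suc n) * (1 * u_bound)" for x m
      unfolding abs_mult by (intro mult_mono g U_bounded) (auto simp: indicator_def B)
  qed
  also have "\<dots> = (\<integral>m. U m s * (\<integral>\<theta>. g (\<integral>r. N s (X m s + (\<theta> - 1 + r) / real (Suc n)) \<partial>U01) \<partial>U01) \<partial>U01)"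
  proof (rule Bochner_Integration.integral_cong)
    fix m
    have X: "\<bar>X m s\<bar> \<le> R" unfolding X_def by (rule S.quantile_range)
    have "(\<integral>x. g (steklov n x s) * real (Suc n) * (indicator {x<..x + ?e} (X m s) * U m s) \<partial>Leb {-R-1..R+1})
      = (LBINT x. U m s * real (Suc n) * (g (steklov n x s) * indicator {X m s - ?e..<X m s - ?e + ?e} x))"
    proof (subst integral_Leb)
      \<comment> \<open>Since \<open>\<bar>X m s\<bar> \<le> R\<close> and \<open>e \<le> 1\<close>,
        no such starting point is cut off by the interval.\<close>
      have "indicator {-R-1..R+1} x * indicator {x<..x + e} (X m s) = (indicator {X m s - e..<X m s - e + e} x :: real)"
        if "0 < e" "e \<le> 1" for x e
        using X that by (auto simp: indicator_def)
      from this[OF e] show "(LBINT x. indicator {-R-1..R+1} x * (g (steklov n x s) * real (Suc n) * (indicator {x<..x + ?e} (X m s) * U m s))) =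
         (LBINT x. U m s * real (Suc n) * (g (steklov n x s) * indicator {X m s - ?e..<X m s - ?e + ?e} x))"
        by (intro Bochner_Integration.integral_cong refl) (simp only: mult_ac)
    qed (unfold indicator_def greaterThanAtMost_iff, measurable)
    also have "\<dots> = U m s * real (Suc n) * (?e * (\<integral>\<theta>. g (steklov n (X m s - ?e + \<theta> * ?e) s) \<partial>U01))"
      using integral_window_eq_U01(2)[OF _ e(1), of "\<lambda>x. g (steklov n x s)" "X m s - ?e"] by (subst integral_mult_right_zero) simp
    also have "\<dots> = U m s * (\<integral>\<theta>. g (steklov n (X m s - ?e + \<theta> * ?e) s) \<partial>U01)"
      by (simp del: of_nat_Suc)
    also have "\<dots> = U m s * (\<integral>\<theta>. g (\<integral>r. N s (X m s + (\<theta> - 1 + r) / real (Suc n)) \<partial>U01) \<partial>U01)"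
    proof -
      have "X m s - ?e + \<theta> * ?e + r / real (Suc n) = X m s + (\<theta> - 1 + r) / real (Suc n)" for \<theta> r
        by (simp add: diff_divide_distrib add_divide_distrib)
      then show ?thesis unfolding steklov_def by (simp only:)
    qed
    finally show "(\<integral>x. g (steklov n x s) * real (Suc n) * (indicator {x<..x + ?e} (X m s) * U m s) \<partial>Leb {-R-1..R+1}) =
      U m s * (\<integral>\<theta>. g (\<integral>r. N s (X m s + (\<theta> - 1 + r) / real (Suc n)) \<partial>U01) \<partial>U01)" .
  qed simp
  finally show ?thesis .
qed

text \<open>Layer cake for \<open>G(M)\<close>: the level \<open>m\<close> contributes
  \<open>g m\<close> on the part of the interval to the right of \<open>X m s\<close>, whose length
  brings in the quantile.\<close>

lemma integral_antiderivative_rlim: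
  assumes G: "\<And>x. (G has_real_derivative g x) (at x)" and g: "continuous_on UNIV g" and gb: "\<And>x. \<bar>g x\<bar> \<le> B"
    and S: "step_cdf (N s) R"
  shows "(\<integral>x. G (rlim (N s) x) - G 0 \<partial>Leb {-R-1..R+1}) = (\<integral>m. g m * (R + 1 - X m s) \<partial>U01)"
proof -
  interpret S: step_cdf "N s" R by (rule S)
  have [measurable]: "g \<in> borel_measurable borel" by (rule borel_measurable_continuous_onI[OF g])
  have "continuous_on UNIV G" using G by (meson DERIV_isCont continuous_at_imp_continuous_on)
  then have [measurable]: "G \<in> borel_measurable borel" by (rule borel_measurable_continuous_onI)
  have Gp: "G p - G 0 = (\<integral>m. g m * indicator {..p} m \<partial>U01)" if p: "0 \<le> p" "p \<le> 1" for p
  proof -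
    have "G p - G 0 = (LBINT x=0..p. g x)" using interval_integral_antiderivative[OF G g, of 0 p] by (simp add: zero_ereal_def)
    also have "\<dots> = (LBINT x. indicator {0..p} x * g x)"
      using p by (simp add: interval_integral_Icc[of 0 p, unfolded zero_ereal_def[symmetric]] set_lebesgue_integral_def)
    also have "\<dots> = (LBINT x. indicator {0<..<1} x * (g x * indicator {..p} x))"
    proof (rule integral_cong_AE)
      show "AE x in lborel. indicator {0..p} x * g x = indicator {0<..<1} x * (g x * indicator {..p} x)"
        using AE_lborel_singleton[of 0] AE_lborel_singleton[of 1] by eventually_elim (use p in \<open>auto simp: indicator_def\<close>)
    qed measurable
    also have "\<dots> = (\<integral>m. g m * indicator {..p} m \<partial>U01)"
      by (rule integral_Leb[symmetric]) measurable
    finally show ?thesis .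
  qed
  have "(\<integral>x. G (rlim (N s) x) - G 0 \<partial>Leb {-R-1..R+1}) = (LBINT x. indicator {-R-1..R+1} x * (G (rlim (N s) x) - G 0))"
    by (rule integral_Leb) measurable
  also have "\<dots> = (LBINT x. (\<integral>m. g m * indicator {..N s x} m \<partial>U01) * indicator {-R-1..R+1} x)"
  proof (rule integral_cong_AE)
    show "AE x in lborel. indicator {-R-1..R+1} x * (G (rlim (N s) x) - G 0) = (\<integral>m. g m * indicator {..N s x} m \<partial>U01) * indicator {-R-1..R+1} x"
      using S.AE_rlim by (rule eventually_mono) (simp add: Gp N_bounds)
  qed (unfold indicator_def atMost_iff, measurable)
  also have "\<dots> = (\<integral>m. g m * (LBINT x. indicator {quantile (N s) m..} x * indicator {-R-1..R+1} x) \<partial>U01)"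
    by (rule S.layer_cake[OF _ _ gb]) (auto simp: emeasure_lborel_Icc_eq)
  also have "\<dots> = (\<integral>m. g m * (R + 1 - X m s) \<partial>U01)"
  proof (rule Bochner_Integration.integral_cong)
    fix m
    have X: "\<bar>X m s\<bar> \<le> R" unfolding X_def by (rule S.quantile_range)
    have "(LBINT x. indicator {quantile (N s) m..} x * indicator {-R-1..R+1} x) = (LBINT x. indicator {X m s..R+1} x :: real)"
      using X by (intro Bochner_Integration.integral_cong) (auto simp: indicator_def X_def)
    then show "g m * (LBINT x. indicator {quantile (N s) m..} x * indicator {-R-1..R+1} x) = g m * (R + 1 - X m s)"
      using X by simp
  qed simp
  finally show ?thesis .
qed

text \<open>The change in time of the space integral of \<open>G(M)\<close> is computed twice: by
  \<open>integral_antiderivative_rlim\<close> it is the change of the quantiles tested with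
  \<open>g\<close>, and by the chain rule for Steklov averages it is the momentum tested with the
  jump average of \<open>g\<close>.\<close>

lemma quantile_weak_ode:
  assumes g: "continuous_on UNIV g" and gb: "\<And>x. \<bar>g x\<bar> \<le> 1" and t: "0 \<le> t"
  shows "(\<integral>m. g m * (X m t - X m 0) \<partial>U01) = (\<integral>m. g m * (\<integral>s. U m s \<partial>Leb {0..t}) \<partial>U01)"
proof -
  have [measurable]: "g \<in> borel_measurable borel" by (rule borel_measurable_continuous_onI[OF g])
  \<comment> \<open>\<open>step_cdf_N\<close> expects a positive time horizon, hence
    \<open>t + 1\<close>.\<close>
  obtain R where R: "\<And>s. s \<le> t + 1 \<Longrightarrow> step_cdf (N s) R" using step_cdf_N[of "t + 1"] t by auto
  have St: "step_cdf (N t) R" and S0: "step_cdf (N 0) R" using R t by auto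
  have Xb: "\<bar>X m s\<bar> \<le> R" if "s \<le> t + 1" for m s
    unfolding X_def by (rule step_cdf.quantile_range[OF R[OF that]])
  have R0: "0 \<le> R" using step_cdf.R_nonneg[OF St] .
  let ?L = "Leb {-R-1..R+1}"
  obtain G where G: "\<And>x. (G has_real_derivative g x) (at x)"
    using continuous_imp_antiderivative[OF g] by blast
  have Gc: "continuous_on UNIV G" using G by (meson DERIV_isCont continuous_at_imp_continuous_on)
  have [measurable]: "G \<in> borel_measurable borel" by (rule borel_measurable_continuous_onI[OF Gc])
  have "bounded (G ` {0..1})" by (intro compact_imp_bounded compact_continuous_image continuous_on_subset[OF Gc]) auto
  then obtain CG where CG: "\<forall>p\<in>{0..1}. \<bar>G p\<bar> \<le> CG" unfolding bounded_iff by auto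
  have Gst: "\<bar>G (steklov n x s)\<bar> \<le> CG" for n x s using CG steklov_bounds[of n x s] by auto
  have Grl: "\<bar>G (rlim (N s) x)\<bar> \<le> CG" if "s \<le> t + 1" for x s
    using CG step_cdf.rlim_bounds[OF R[OF that], of x] by auto
  have iG: "integrable ?L (\<lambda>x. G (rlim (N s) x))" if "s \<le> t + 1" for s
    by (rule borel_measurable_bounded_integrable[OF finite_measure_Leb_Icc _ Grl[OF that]]) measurable
  have iGst: "integrable ?L (\<lambda>x. G (steklov n x s))" for n s
    by (rule borel_measurable_bounded_integrable[OF finite_measure_Leb_Icc _ Gst]) measurable
  let ?J = "\<lambda>n s m. \<integral>\<theta>. g (\<integral>r. N s (X m s + (\<theta> - 1 + r) / real (Suc n)) \<partial>U01) \<partial>U01"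
  have Jb: "\<bar>?J n s m\<bar> \<le> 1" for n s m by (rule L01_average_bound) (measurable, rule gb)
  have UJb: "\<bar>U m s * ?J n s m\<bar> \<le> u_bound" for n s m
  proof -
    have "\<bar>U m s\<bar> * \<bar>?J n s m\<bar> \<le> u_bound * 1"
      using order_trans[OF abs_ge_zero U_bounded] by (intro mult_mono U_bounded Jb) auto
    then show ?thesis by (simp add: abs_mult)
  qed
  have step: "(\<integral>x. G (steklov n x t) \<partial>?L) - (\<integral>x. G (steklov n x 0) \<partial>?L) = - (\<integral>s. (\<integral>m. U m s * ?J n s m \<partial>U01) \<partial>Leb {0..t})" for n
  proof -
    have "(\<integral>x. G (steklov n x t) \<partial>?L) - (\<integral>x. G (steklov n x 0) \<partial>?L) = (\<integral>x. G (steklov n x t) - G (steklov n x 0) \<partial>?L)"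
      using iGst by simp
    also have "\<dots> = - (\<integral>x. (\<integral>s. g (steklov n x s) * flow n x s \<partial>Leb {0..t}) \<partial>?L)"
      unfolding steklov_chain_rule[OF G g t] by simp
    also have "(\<integral>x. (\<integral>s. g (steklov n x s) * flow n x s \<partial>Leb {0..t}) \<partial>?L) = (\<integral>s. (\<integral>x. g (steklov n x s) * flow n x s \<partial>?L) \<partial>Leb {0..t})"
    proof (rule bounded_Fubini[OF finite_measure_Leb_Icc finite_measure_Leb_Icc, where B="1 * (real (Suc n) * u_bound)"])
      show "\<bar>g (steklov n x s) * flow n x s\<bar> \<le> 1 * (real (Suc n) * u_bound)" for x s
        unfolding abs_mult by (intro mult_mono gb flow_bound) auto
    qed measurable
    also have "\<dots> = (\<integral>s. (\<integral>m. U m s * ?J n s m \<partial>U01) \<partial>Leb {0..t})"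
    proof (rule integral_cong_AE)
      show "AE s in Leb {0..t}. (\<integral>x. g (steklov n x s) * flow n x s \<partial>?L) = (\<integral>m. U m s * ?J n s m \<partial>U01)"
        using AE_Leb_Icc
      proof eventually_elim
        case (elim s)
        then show ?case by (intro flow_window[OF _ gb R]) auto
      qed
      show "(\<lambda>s. \<integral>x. g (steklov n x s) * flow n x s \<partial>?L) \<in> borel_measurable (Leb {0..t})" by measurable
      show "(\<lambda>s. \<integral>m. U m s * ?J n s m \<partial>U01) \<in> borel_measurable (Leb {0..t})" by measurable
    qed
    finally show ?thesis .
  qed
  have limG: "(\<lambda>n. \<integral>x. G (steklov n x s) \<partial>?L) \<longlonglongrightarrow> (\<integral>x. G (rlim (N s) x) \<partial>?L)" if s: "s \<le> t + 1" for s
  proof (rule integral_dominated_convergence[where w="\<lambda>_. CG"])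
    show "AE x in ?L. (\<lambda>n. G (steklov n x s)) \<longlonglongrightarrow> G (rlim (N s) x)"
      unfolding steklov_def
      by (intro AE_I2 continuous_on_tendsto_compose[OF Gc step_cdf.steklov_tendsto_rlim[OF R[OF s]]]) auto
  qed (measurable, use Gst in auto)
  have limJ: "(\<lambda>n. \<integral>m. U m s * ?J n s m \<partial>U01) \<longlonglongrightarrow> (\<integral>m. U m s * jump_avg g (N s) (X m s) \<partial>U01)" if s: "s \<le> t + 1" for s
  proof (rule integral_dominated_convergence[where w="\<lambda>_. u_bound"])
    show "AE m in U01. (\<lambda>n. U m s * ?J n s m) \<longlonglongrightarrow> U m s * jump_avg g (N s) (X m s)"
      by (intro AE_I2 tendsto_intros step_cdf.steklov_tendsto_jump_avg[OF R[OF s] g gb])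
    show "(\<lambda>m. U m s * jump_avg g (N s) (X m s)) \<in> borel_measurable U01" unfolding jump_avg_def by measurable
  qed (measurable, use UJb in auto)
  \<comment> \<open>\<open>U\<close> is a function of the quantile, so the averaging property is now
    used with \<open>g\<close> in the role of \<open>a\<close> to remove the average from
    \<open>g\<close>.\<close>
  have Javg: "(\<integral>m. U m s * jump_avg g (N s) (X m s) \<partial>U01) = (\<integral>m. U m s * g m \<partial>U01)" if s: "s \<le> t + 1" for s
    using step_cdf.integral_jump_avg[OF R[OF s], of g "\<lambda>x. u x s" 1 u_bound] gb u_bounded by (simp add: U_def X_def)
  have limR: "(\<lambda>n. \<integral>s. (\<integral>m. U m s * ?J n s m \<partial>U01) \<partial>Leb {0..t}) \<longlonglongrightarrow> (\<integral>s. (\<integral>m. U m s * g m \<partial>U01) \<partial>Leb {0..t})"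
  proof (rule integral_dominated_convergence[where w="\<lambda>_. u_bound"])
    show "AE s in Leb {0..t}. (\<lambda>n. \<integral>m. U m s * ?J n s m \<partial>U01) \<longlonglongrightarrow> (\<integral>m. U m s * g m \<partial>U01)"
      using AE_Leb_Icc
    proof eventually_elim
      case (elim s)
      then have "s \<le> t + 1" by simp
      from limJ[OF this] show ?case unfolding Javg[OF \<open>s \<le> t + 1\<close>] .
    qed
    show "AE s in Leb {0..t}. norm (\<integral>m. U m s * ?J n s m \<partial>U01) \<le> u_bound" for n
      unfolding real_norm_def by (intro AE_I2 L01_average_bound UJb) measurable
    show "integrable (Leb {0..t}) (\<lambda>_. u_bound)" by (rule LI.integrable_const)
  qed measurable
  have "(\<integral>x. G (rlim (N t) x) \<partial>?L) - (\<integral>x. G (rlim (N 0) x) \<partial>?L) = - (\<integral>s. (\<integral>m. U m s * g m \<partial>U01) \<partial>Leb {0..t})"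
  proof (rule LIMSEQ_unique)
    show "(\<lambda>n. (\<integral>x. G (steklov n x t) \<partial>?L) - (\<integral>x. G (steklov n x 0) \<partial>?L)) \<longlonglongrightarrow> (\<integral>x. G (rlim (N t) x) \<partial>?L) - (\<integral>x. G (rlim (N 0) x) \<partial>?L)"
      using t by (intro tendsto_diff limG) auto
    show "(\<lambda>n. (\<integral>x. G (steklov n x t) \<partial>?L) - (\<integral>x. G (steklov n x 0) \<partial>?L)) \<longlonglongrightarrow> - (\<integral>s. (\<integral>m. U m s * g m \<partial>U01) \<partial>Leb {0..t})"
      unfolding step by (intro tendsto_minus limR)
  qed
  moreover have "(\<integral>x. G (rlim (N t) x) \<partial>?L) - (\<integral>x. G (rlim (N 0) x) \<partial>?L) = (\<integral>m. g m * (X m 0 - X m t) \<partial>U01)"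
  proof -
    have ig: "integrable U01 (\<lambda>m. g m * (R + 1 - X m s))" if s: "s \<le> t + 1" for s
    proof (rule integrable_U01)
      show "\<bar>g m * (R + 1 - X m s)\<bar> \<le> 1 * (2 * R + 1)" for m
        unfolding abs_mult using Xb[OF s, of m] by (intro mult_mono gb) auto
    qed measurable
    have "(\<integral>x. G (rlim (N t) x) \<partial>?L) - (\<integral>x. G (rlim (N 0) x) \<partial>?L) =
      (\<integral>x. G (rlim (N t) x) - G 0 \<partial>?L) - (\<integral>x. G (rlim (N 0) x) - G 0 \<partial>?L)"
      using iG[of t] iG[of 0] t by simp
    also have "\<dots> = (\<integral>m. g m * (R + 1 - X m t) \<partial>U01) - (\<integral>m. g m * (R + 1 - X m 0) \<partial>U01)"
      unfolding integral_antiderivative_rlim[OF G g gb St] integral_antiderivative_rlim[OF G g gb S0] ..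
    also have "\<dots> = (\<integral>m. g m * (R + 1 - X m t) - g m * (R + 1 - X m 0) \<partial>U01)"
      using ig[of t] ig[of 0] t by simp
    finally show ?thesis by (simp add: algebra_simps)
  qed
  moreover have "(\<integral>s. (\<integral>m. U m s * g m \<partial>U01) \<partial>Leb {0..t}) = (\<integral>m. (\<integral>s. U m s * g m \<partial>Leb {0..t}) \<partial>U01)"
  proof (rule bounded_Fubini[OF finite_measure_Leb_Icc L01.finite_measure, where B="u_bound * 1"])
    show "\<bar>U m s * g m\<bar> \<le> u_bound * 1" for s m
      unfolding abs_mult using order_trans[OF abs_ge_zero U_bounded] by (intro mult_mono gb U_bounded) auto
  qed measurable
  ultimately have "(\<integral>m. g m * (X m 0 - X m t) \<partial>U01) = - (\<integral>m. (\<integral>s. U m s * g m \<partial>Leb {0..t}) \<partial>U01)"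
    by simp
  moreover have "(\<integral>m. g m * (X m 0 - X m t) \<partial>U01) = - (\<integral>m. g m * (X m t - X m 0) \<partial>U01)"
    by (subst Bochner_Integration.integral_minus[symmetric]) (simp add: algebra_simps)
  ultimately show ?thesis by (simp add: mult.commute)
qed

text \<open>The exceptional null set of labels may depend on \<open>t\<close>;
  \<open>AE_path\<close> later exchanges the quantifiers.\<close>

lemma quantile_ode:
  assumes t: "0 \<le> t"
  shows "AE m in U01. X m t = X m 0 + (\<integral>s. U m s \<partial>Leb {0..t})"
proof -
  obtain R where R: "\<And>s. s \<le> t + 1 \<Longrightarrow> step_cdf (N s) R" using step_cdf_N[of "t + 1"] t by auto
  have Xb: "\<bar>X m s\<bar> \<le> R" if "s \<le> t + 1" for m s
    unfolding X_def by (rule step_cdf.quantile_range[OF R[OF that]])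
  have "AE m in U01. X m t - X m 0 = (\<integral>s. U m s \<partial>Leb {0..t})"
  proof (rule AE_eq_if_integral_continuous_eq[where B="max (2 * R) (u_bound * t)"])
    show "\<bar>X m t - X m 0\<bar> \<le> max (2 * R) (u_bound * t)" for m
      using Xb[of t m] Xb[of 0 m] t by simp
    have "\<bar>\<integral>s. U m s \<partial>Leb {0..t}\<bar> \<le> u_bound * t" for m
      by (rule Leb_bounded_integral[OF _ U_bounded t]) measurable
    then show "\<bar>\<integral>s. U m s \<partial>Leb {0..t}\<bar> \<le> max (2 * R) (u_bound * t)" for m
      by (simp add: le_max_iff_disj)
  qed (use quantile_weak_ode t in \<open>measurable\<close>)
  then show ?thesis by (rule eventually_mono) simp
qed

end

section \<open>The conservation laws in Lagrangian variables\<close>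

lemma path_integral_test:
  assumes \<zeta>: "test_st T \<zeta>"
    and V: "V \<in> borel_measurable borel" "\<And>r. \<bar>V r\<bar> \<le> C"
    and Y: "\<And>t. Y t = y0 + integral\<^sup>L (Leb {0..t}) V" and t: "0 \<le> t"
  shows "\<zeta> (Y t) t = (\<integral>s. pdx \<zeta> (Y s) s * V s + pdt \<zeta> (Y s) s \<partial>Leb {0..t})"
proof -
  have sm: "smooth2 \<zeta>" using \<zeta> by (simp add: test_st_def)
  show ?thesis
    using chain_rule_integral[OF V Y smooth2_has_derivative[OF sm] smooth2_continuous(2,3)[OF sm] t]
      test_st_outside_time(1)[OF \<zeta>, of 0] by simp
qed

lemma continuous_path:
  fixes V :: "real \<Rightarrow> real"
  assumes "V \<in> borel_measurable borel" "\<And>r. \<bar>V r\<bar> \<le> C"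
    and Y: "\<And>t. Y t = y0 + integral\<^sup>L (Leb {0..t}) V"
  shows "continuous_on UNIV Y"
  unfolding Y by (intro continuous_intros continuous_Leb_integral[OF assms(1,2)])

lemma test_st_meas:
  assumes \<zeta>: "test_st T \<zeta>" and [measurable]: "f \<in> borel_measurable W" "g \<in> borel_measurable W"
  shows "(\<lambda>w. \<zeta> (f w) (g w)) \<in> borel_measurable W" "(\<lambda>w. pdx \<zeta> (f w) (g w)) \<in> borel_measurable W"
    "(\<lambda>w. pdt \<zeta> (f w) (g w)) \<in> borel_measurable W"
proof -
  have sm: "smooth2 \<zeta>" using \<zeta> by (simp add: test_st_def)
  have *: "(\<lambda>w. h (f w) (g w)) \<in> borel_measurable W" if "continuous_on UNIV (\<lambda>p. h (fst p) (snd p))" for h :: "real \<Rightarrow> real \<Rightarrow> real"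
  proof -
    have [measurable]: "(\<lambda>p. h (fst p) (snd p)) \<in> borel_measurable (borel \<Otimes>\<^sub>M borel)"
      unfolding borel_prod by (rule borel_measurable_continuous_onI[OF that])
    have "(\<lambda>p. h (fst p) (snd p)) \<circ> (\<lambda>w. (f w, g w)) \<in> borel_measurable W"
      by (rule measurable_comp[of _ _ "borel \<Otimes>\<^sub>M borel"]) measurable
    then show ?thesis by (simp add: comp_def)
  qed
  show "(\<lambda>w. \<zeta> (f w) (g w)) \<in> borel_measurable W" "(\<lambda>w. pdx \<zeta> (f w) (g w)) \<in> borel_measurable W"
    "(\<lambda>w. pdt \<zeta> (f w) (g w)) \<in> borel_measurable W"
    by (rule * smooth2_continuous[OF sm])+
qed

text \<open>The product rule for \<open>\<zeta> (Y s) s\<close> and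
  \<open>\<omega> (Y s - Y' s)\<close>; the boundary terms vanish because \<open>\<zeta>\<close>
  does at times 0 and \<open>T\<close>.\<close>

lemma (in kernel) path_pair_integral_test:
  assumes \<zeta>: "test_st T \<zeta>" and T: "0 < T"
    and V: "V \<in> borel_measurable borel" "\<And>r. \<bar>V r\<bar> \<le> C"
    and Y: "\<And>t. Y t = y0 + integral\<^sup>L (Leb {0..t}) V"
    and V': "V' \<in> borel_measurable borel" "\<And>r. \<bar>V' r\<bar> \<le> C"
    and Y': "\<And>t. Y' t = y0' + integral\<^sup>L (Leb {0..t}) V'"
  shows "(\<integral>s. (pdx \<zeta> (Y s) s * V s + pdt \<zeta> (Y s) s) * \<omega> (Y s - Y' s) + \<zeta> (Y s) s * (\<phi> (Y s - Y' s) * (V s - V' s)) \<partial>Leb {0..T}) = 0"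
proof -
  note [measurable] = V(1) V'(1) borel_measurable_continuous_onI[OF continuous_path[OF V Y]]
    borel_measurable_continuous_onI[OF continuous_path[OF V' Y']]
  note [measurable (raw)] = test_st_meas[OF \<zeta>]
  obtain B where B: "\<And>x t. \<bar>\<zeta> x t\<bar> \<le> B" "\<And>x t. \<bar>pdx \<zeta> x t\<bar> \<le> B" "\<And>x t. \<bar>pdt \<zeta> x t\<bar> \<le> B"
    using test_st_bounded[OF \<zeta>] by blast
  have B0: "0 \<le> B" "0 \<le> C" "0 \<le> \<phi>_bound" using order_trans[OF abs_ge_zero B(1)] order_trans[OF abs_ge_zero V(2)] order_trans[OF abs_ge_zero \<phi>_bounded] by auto
  define h where "h s = pdx \<zeta> (Y s) s * V s + pdt \<zeta> (Y s) s" for s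
  define k where "k s = \<phi> (Y s - Y' s) * (V s - V' s)" for s
  define H where "H t = 0 + integral\<^sup>L (Leb {0..t}) h" for t
  define L where "L t = \<omega> (Y 0 - Y' 0) + integral\<^sup>L (Leb {0..t}) k" for t
  have VV': "\<bar>V r - V' r\<bar> \<le> 2 * C" for r using V(2)[of r] V'(2)[of r] by linarith
  have hm: "h \<in> borel_measurable borel" and km: "k \<in> borel_measurable borel"
    unfolding h_def[abs_def] k_def[abs_def] by measurable
  have hb: "\<bar>h s\<bar> \<le> B * C + B" for s
  proof -
    have "\<bar>pdx \<zeta> (Y s) s * V s\<bar> \<le> B * C" unfolding abs_mult by (intro mult_mono B V B0) auto
    then show ?thesis using B(3)[of "Y s" s] unfolding h_def by linarith
  qed
  have kb: "\<bar>k s\<bar> \<le> \<phi>_bound * (2 * C)" for s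
    unfolding k_def abs_mult by (intro mult_mono \<phi>_bounded VV' B0) auto
  note [measurable] = hm km borel_measurable_continuous_onI[OF continuous_path[OF hm hb H_def]]
     borel_measurable_continuous_onI[OF continuous_path[OF km kb L_def]]
  have H: "H t = \<zeta> (Y t) t" if "0 \<le> t" for t
    using path_integral_test[OF \<zeta> V Y that] by (simp add: H_def flip: h_def)
  have iV: "integrable (Leb {0..t}) V" "integrable (Leb {0..t}) V'" for t
    by (rule borel_measurable_bounded_integrable[OF finite_measure_Leb_Icc _ V(2)], simp,
        rule borel_measurable_bounded_integrable[OF finite_measure_Leb_Icc _ V'(2)], simp)
  \<comment> \<open>The distance of two paths is itself a path with bounded velocity, so the chain
    rule with the merely Borel \<open>\<phi>\<close> applies to it.\<close>
  have D: "Y t - Y' t = (y0 - y0') + integral\<^sup>L (Leb {0..t}) (\<lambda>s. V s - V' s)" for t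
    using iV by (simp add: Y Y')
  have L: "L t = \<omega> (Y t - Y' t)" if "0 \<le> t" for t
    using bounded_chain_rule[OF _ VV' D \<phi>_meas \<phi>_bounded \<omega>_diff that] by (simp add: L_def flip: k_def)
  have "H T * L T - H 0 * L 0 = (\<integral>s. h s * L s + H s * k s \<partial>Leb {0..T})"
    by (rule product_rule_integral[OF hm hb km kb H_def L_def]) (use T in simp)
  moreover have "H T = 0" "H 0 = 0" using H T test_st_outside_time(1)[OF \<zeta>] by auto
  moreover have "(\<integral>s. h s * L s + H s * k s \<partial>Leb {0..T}) = (\<integral>s. h s * \<omega> (Y s - Y' s) + \<zeta> (Y s) s * k s \<partial>Leb {0..T})"
  proof (rule integral_cong_AE)
    show "AE s in Leb {0..T}. h s * L s + H s * k s = h s * \<omega> (Y s - Y' s) + \<zeta> (Y s) s * k s"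
      using AE_Leb_Icc by (rule eventually_mono) (simp add: H L)
  qed measurable
  ultimately show ?thesis by (simp add: h_def k_def)
qed

text \<open>Translates the time integral over the whole line in \<open>weak_sol\<close> into
  integrals over \<open>[0,T]\<close> for each fixed label.\<close>

lemma time_average:
  fixes H :: "real \<Rightarrow> real \<Rightarrow> real"
  assumes [measurable]: "(\<lambda>(m, s). H m s) \<in> borel_measurable (borel \<Otimes>\<^sub>M borel)"
    and B: "\<And>m s. \<bar>H m s\<bar> \<le> B" and z: "\<And>m s. s \<notin> {0..T} \<Longrightarrow> H m s = 0"
  shows "integrable lborel (\<lambda>s. \<integral>m. H m s \<partial>U01)"
    "(LBINT s. (\<integral>m. H m s \<partial>U01)) = (\<integral>m. (\<integral>s. H m s \<partial>Leb {0..T}) \<partial>U01)"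
proof -
  have b: "\<bar>\<integral>m. H m s \<partial>U01\<bar> \<le> B" for s
  proof -
    have "integrable U01 (\<lambda>m. H m s)" by (rule integrable_U01[OF _ B]) measurable
    then have "\<bar>\<integral>m. H m s \<partial>U01\<bar> \<le> (\<integral>m. B \<partial>U01)" by (rule abs_integral_le) (use B in auto)
    then show ?thesis using L01.prob_space by simp
  qed
  have eq: "(\<integral>m. H m s \<partial>U01) = indicator {0..T} s * (\<integral>m. H m s \<partial>U01)" for s
    using z[of s] by (cases "s \<in> {0..T}") auto
  have i: "integrable (Leb {0..T}) (\<lambda>s. \<integral>m. H m s \<partial>U01)"
    by (rule borel_measurable_bounded_integrable[OF finite_measure_Leb_Icc _ b]) measurable
  show "integrable lborel (\<lambda>s. \<integral>m. H m s \<partial>U01)"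
    using integrable_Leb_subset(2)[OF i, of "{0..T}"] by (subst eq) simp
  have "(LBINT s. (\<integral>m. H m s \<partial>U01)) = (\<integral>s. (\<integral>m. H m s \<partial>U01) \<partial>Leb {0..T})"
  proof -
    have "(\<lambda>s. \<integral>m. H m s \<partial>U01) \<in> borel_measurable borel" by measurable
    from integral_Leb[OF _ this, of "{0..T}"] show ?thesis unfolding eq[symmetric] by simp
  qed
  also have "\<dots> = (\<integral>m. (\<integral>s. H m s \<partial>Leb {0..T}) \<partial>U01)"
    by (rule bounded_Fubini[OF finite_measure_Leb_Icc L01.finite_measure _ B]) measurable
  finally show "(LBINT s. (\<integral>m. H m s \<partial>U01)) = (\<integral>m. (\<integral>s. H m s \<partial>Leb {0..T}) \<partial>U01)" .
qed

section \<open>Identities along trajectories\<close>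

context entropy_lagrangian begin

text \<open>The Lipschitz version of the trajectory of \<open>m\<close>, available for every label
  and all times, to which the integrated chain rules apply.\<close>

definition path :: "real \<Rightarrow> real \<Rightarrow> real" where
  "path m t = X m 0 + integral\<^sup>L (Leb {0..t}) (U m)"

lemma path_meas [measurable (raw)]:
  assumes [measurable]: "f \<in> borel_measurable W" "g \<in> borel_measurable W"
  shows "(\<lambda>w. path (f w) (g w)) \<in> borel_measurable W"
proof -
  \<comment> \<open>The variable upper limit is moved into the integrand, where joint measurability
    is evident.\<close>
  have eq: "integral\<^sup>L (Leb {0..t}) (U m) = (LBINT s. (if 0 \<le> s \<and> s \<le> t then 1 else 0) * U m s)" for t m
    by (subst integral_Leb) (auto intro!: Bochner_Integration.integral_cong simp: indicator_def)
  show ?thesis unfolding path_def eq by measurable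
qed

text \<open>Fubini for null sets turns "for each time, almost every label" into "for almost every
  label, almost every time".\<close>

lemma AE_path: "AE m in U01. AE s in Leb {0..T}. X m s = path m s"
proof -
  interpret P: pair_sigma_finite "Leb {0..T}" U01 ..
  have "AE s in Leb {0..T}. AE m in U01. X m s = path m s"
    using AE_Leb_Icc by (rule eventually_mono) (auto simp: path_def intro!: quantile_ode)
  moreover have "{p \<in> space (Leb {0..T} \<Otimes>\<^sub>M U01). X (snd p) (fst p) = path (snd p) (fst p)} \<in> sets (Leb {0..T} \<Otimes>\<^sub>M U01)"
    by measurable
  ultimately show ?thesis using P.AE_commute[of "\<lambda>s m. X m s = path m s"] by simp
qed

lemma U_meas' [measurable]: "U m \<in> borel_measurable borel"
  by measurable

lemma transport_identity:
  assumes \<zeta>: "test_st T \<zeta>" and T: "0 < T"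
  shows "AE m in U01. (\<integral>s. pdx \<zeta> (X m s) s * U m s + pdt \<zeta> (X m s) s \<partial>Leb {0..T}) = 0"
  using AE_path[of T]
proof eventually_elim
  case (elim m)
  note [measurable (raw)] = test_st_meas[OF \<zeta>]
  have "(\<integral>s. pdx \<zeta> (X m s) s * U m s + pdt \<zeta> (X m s) s \<partial>Leb {0..T}) = (\<integral>s. pdx \<zeta> (path m s) s * U m s + pdt \<zeta> (path m s) s \<partial>Leb {0..T})"
  proof (rule integral_cong_AE)
    show "AE s in Leb {0..T}. pdx \<zeta> (X m s) s * U m s + pdt \<zeta> (X m s) s = pdx \<zeta> (path m s) s * U m s + pdt \<zeta> (path m s) s"
      using elim by eventually_elim simp
  qed measurable
  also have "\<dots> = \<zeta> (path m T) T"
    by (rule path_integral_test[OF \<zeta> U_meas' U_bounded path_def, symmetric]) (use T in simp)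
  finally show ?case using test_st_outside_time(1)[OF \<zeta>, of T] by simp
qed

lemma transport_pair_identity:
  assumes \<zeta>: "test_st T \<zeta>" and T: "0 < T"
  shows "AE m in U01. AE m' in U01. (\<integral>s. (pdx \<zeta> (X m s) s * U m s + pdt \<zeta> (X m s) s) * \<omega> (X m s - X m' s) +
    \<zeta> (X m s) s * (\<phi> (X m s - X m' s) * (U m s - U m' s)) \<partial>Leb {0..T}) = 0"
  using AE_path[of T]
proof eventually_elim
  case (elim m)
  note [measurable (raw)] = test_st_meas[OF \<zeta>]
  show ?case using AE_path[of T]
  proof eventually_elim
    case (elim m')
    have "(\<integral>s. (pdx \<zeta> (X m s) s * U m s + pdt \<zeta> (X m s) s) * \<omega> (X m s - X m' s) +
        \<zeta> (X m s) s * (\<phi> (X m s - X m' s) * (U m s - U m' s)) \<partial>Leb {0..T}) =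
      (\<integral>s. (pdx \<zeta> (path m s) s * U m s + pdt \<zeta> (path m s) s) * \<omega> (path m s - path m' s) +
        \<zeta> (path m s) s * (\<phi> (path m s - path m' s) * (U m s - U m' s)) \<partial>Leb {0..T})"
    proof (rule integral_cong_AE)
      show "AE s in Leb {0..T}. (pdx \<zeta> (X m s) s * U m s + pdt \<zeta> (X m s) s) * \<omega> (X m s - X m' s) +
        \<zeta> (X m s) s * (\<phi> (X m s - X m' s) * (U m s - U m' s)) =
        (pdx \<zeta> (path m s) s * U m s + pdt \<zeta> (path m s) s) * \<omega> (path m s - path m' s) +
        \<zeta> (path m s) s * (\<phi> (path m s - path m' s) * (U m s - U m' s))"
        using \<open>AE s in Leb {0..T}. X m s = path m s\<close> elim by eventually_elim simp
    qed measurable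
    also have "\<dots> = 0"
      by (rule path_pair_integral_test[OF \<zeta> T U_meas' U_bounded path_def U_meas' U_bounded path_def])
    finally show ?case .
  qed
qed

section \<open>The two conservation laws in weak form\<close>

lemma LS_prob_space: "0 \<le> t \<Longrightarrow> prob_space (LS (\<lambda>x. M x t))"
proof -
  assume t: "0 \<le> t"
  obtain R where "step_cdf (N t) R" by (rule step_cdf_N')
  then have "real_distribution (LS (N t))" by (rule step_cdf.real_distribution_LS)
  then show ?thesis by (simp add: N_eq[OF t] real_distribution_def)
qed

lemma LS_sets [simp]: "sets (LS F) = sets borel"
  by (simp add: LS_def)

lemma LS_borel_measurable [simp]: "borel_measurable (LS F) = borel_measurable borel"
  by (intro measurable_cong_sets) auto

text \<open>\<open>weak_sol\<close> demands integrability at all real times, but for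
  \<open>t < 0\<close> nothing is known about \<open>M\<close>; there the integrand has to
  vanish.\<close>

lemma LS_integrable:
  fixes f :: "real \<Rightarrow> real"
  assumes "f \<in> borel_measurable borel" "\<And>x. 0 \<le> t \<Longrightarrow> \<bar>f x\<bar> \<le> B" "\<And>x. t < 0 \<Longrightarrow> f x = 0"
  shows "integrable (LS (\<lambda>x. M x t)) f"
proof (cases "0 \<le> t")
  case True
  then show ?thesis
    using assms by (intro borel_measurable_bounded_integrable[OF prob_space.finite_measure[OF LS_prob_space]]) auto
next
  case False
  then have "f = (\<lambda>_. 0)" using assms(3) by auto
  then show ?thesis by simp
qed

text \<open>In Lagrangian variables the integrand is the time derivative of
  \<open>\<zeta> (X m s) s\<close>, whose integral over \<open>[0,T]\<close> is 0 for almost every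
  label.\<close>

lemma continuity_equation:
  assumes \<zeta>: "test_st T \<zeta>" and T: "0 < T"
  shows "integrable (LS (\<lambda>x. M x t)) (\<lambda>x. pdt \<zeta> x t + u x t * pdx \<zeta> x t)"
    and "integrable lborel (\<lambda>t. integral\<^sup>L (LS (\<lambda>x. M x t)) (\<lambda>x. pdt \<zeta> x t + u x t * pdx \<zeta> x t))"
    and "(LBINT t. integral\<^sup>L (LS (\<lambda>x. M x t)) (\<lambda>x. pdt \<zeta> x t + u x t * pdx \<zeta> x t)) = 0"
proof -
  note [measurable (raw)] = test_st_meas[OF \<zeta>]
  obtain B where B: "\<And>x t. \<bar>\<zeta> x t\<bar> \<le> B" "\<And>x t. \<bar>pdx \<zeta> x t\<bar> \<le> B" "\<And>x t. \<bar>pdt \<zeta> x t\<bar> \<le> B"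
    using test_st_bounded[OF \<zeta>] by blast
  have bd: "\<bar>pdt \<zeta> x t + u x t * pdx \<zeta> x t\<bar> \<le> B + u_bound * B" for x t
  proof -
    have "\<bar>u x t * pdx \<zeta> x t\<bar> \<le> u_bound * B"
      unfolding abs_mult using order_trans[OF abs_ge_zero u_bounded] by (intro mult_mono B u_bounded) auto
    then show ?thesis using B(3)[of x t] by linarith
  qed
  show "integrable (LS (\<lambda>x. M x t)) (\<lambda>x. pdt \<zeta> x t + u x t * pdx \<zeta> x t)"
    by (rule LS_integrable[OF _ bd]) (measurable, simp add: test_st_outside_time[OF \<zeta>])
  define H where "H m s = pdx \<zeta> (X m s) s * U m s + pdt \<zeta> (X m s) s" for m s
  have eq: "integral\<^sup>L (LS (\<lambda>x. M x t)) (\<lambda>x. pdt \<zeta> x t + u x t * pdx \<zeta> x t) = (\<integral>m. H m t \<partial>U01)" for t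
  proof (cases "0 \<le> t")
    case True
    then show ?thesis by (subst integral_LS_N) (measurable, simp_all add: H_def U_def algebra_simps)
  qed (simp add: H_def test_st_outside_time[OF \<zeta>])
  have Hm: "(\<lambda>(m, s). H m s) \<in> borel_measurable (borel \<Otimes>\<^sub>M borel)" unfolding H_def by measurable
  have Hb: "\<bar>H m s\<bar> \<le> B + u_bound * B" for m s
    using bd[of "X m s" s] by (simp add: H_def U_def algebra_simps)
  have Hz: "H m s = 0" if "s \<notin> {0..T}" for m s
    using that test_st_outside_time[OF \<zeta>, of s] by (auto simp: H_def)
  note ta = time_average[OF Hm Hb Hz]
  show "integrable lborel (\<lambda>t. integral\<^sup>L (LS (\<lambda>x. M x t)) (\<lambda>x. pdt \<zeta> x t + u x t * pdx \<zeta> x t))"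
    unfolding eq by (rule ta(1))
  show "(LBINT t. integral\<^sup>L (LS (\<lambda>x. M x t)) (\<lambda>x. pdt \<zeta> x t + u x t * pdx \<zeta> x t)) = 0"
  proof -
    have "(\<integral>m. (\<integral>s. H m s \<partial>Leb {0..T}) \<partial>U01) = 0"
      using transport_identity[OF \<zeta> T] unfolding H_def by (rule integral_eq_zero_AE)
    then show ?thesis unfolding eq using ta(2) by simp
  qed
qed

end

context entropy_lagrangian begin

text \<open>Along a trajectory \<open>\<zeta> * u\<close> is replaced by
  \<open>\<zeta> * (a m - c)\<close>. Since \<open>a m\<close> is constant in time, its part reduces
  to the continuity equation; the part with \<open>c\<close> is an average over \<open>m'\<close> of
  \<open>\<zeta> (X m s) s * \<omega> (X m s - X m' s)\<close>, whose derivative produces the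
  nonlocal source.\<close>

lemma momentum_equation:
  fixes \<zeta> :: "real \<Rightarrow> real \<Rightarrow> real" and T :: real
  assumes \<zeta>: "test_st T \<zeta>" and T: "0 < T"
  defines "h \<equiv> (\<lambda>x t. u x t * pdt \<zeta> x t + (u x t)\<^sup>2 * pdx \<zeta> x t
                      + \<zeta> x t * (integral\<^sup>L (LS (\<lambda>x. M x t)) (\<lambda>y. \<phi> (x - y) * u y t)
                                  - u x t * integral\<^sup>L (LS (\<lambda>x. M x t)) (\<lambda>y. \<phi> (x - y))))"
  shows "integrable (LS (\<lambda>x. M x t)) (\<lambda>x. h x t)"
    and "integrable lborel (\<lambda>t. integral\<^sup>L (LS (\<lambda>x. M x t)) (\<lambda>x. h x t))"
    and "(LBINT t. integral\<^sup>L (LS (\<lambda>x. M x t)) (\<lambda>x. h x t)) = 0"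
proof -
  note [measurable (raw)] = test_st_meas[OF \<zeta>]
  obtain B where B: "\<And>x t. \<bar>\<zeta> x t\<bar> \<le> B" "\<And>x t. \<bar>pdx \<zeta> x t\<bar> \<le> B" "\<And>x t. \<bar>pdt \<zeta> x t\<bar> \<le> B"
    using test_st_bounded[OF \<zeta>] by blast
  have pos: "0 \<le> B" "0 \<le> u_bound" "0 \<le> \<phi>_bound" "0 \<le> \<omega>_bound" "0 \<le> K"
    using order_trans[OF abs_ge_zero B(1)] order_trans[OF abs_ge_zero u_bounded] order_trans[OF abs_ge_zero \<phi>_bounded]
      order_trans[OF abs_ge_zero \<omega>_bounded] order_trans[OF abs_ge_zero a_bound] by auto
  \<comment> \<open>The derivative of \<open>\<zeta>\<close> along the flow; \<open>u * w\<close>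
    gathers both terms of the momentum equation that differentiate \<open>\<zeta>\<close>.\<close>
  define w where "w x t = pdt \<zeta> x t + u x t * pdx \<zeta> x t" for x t
  \<comment> \<open>The two convolutions of the source merged into one weighted velocity
    difference.\<close>
  define \<kappa> where "\<kappa> x t = (\<integral>m. \<phi> (x - X m t) * (U m t - u x t) \<partial>U01)" for x t
  define Bw where "Bw = B + u_bound * B"
  have wb: "\<bar>w x t\<bar> \<le> Bw" for x t
  proof -
    have "\<bar>u x t * pdx \<zeta> x t\<bar> \<le> u_bound * B"
      unfolding abs_mult by (intro mult_mono B u_bounded pos) auto
    then show ?thesis using B(3)[of x t] unfolding w_def Bw_def by linarith
  qed
  have wm [measurable (raw)]: "(\<lambda>z. w (f z) (g z)) \<in> borel_measurable W"
    if "f \<in> borel_measurable W" "g \<in> borel_measurable W" for f g and W :: "'z measure"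
    using that unfolding w_def by measurable
  have \<kappa>m [measurable]: "(\<lambda>x. \<kappa> x t) \<in> borel_measurable borel" for t unfolding \<kappa>_def by measurable
  have diff: "\<bar>U m t - u x t\<bar> \<le> 2 * u_bound" for m x t
    using U_bounded[of m t] u_bounded[of x t] by linarith
  have \<kappa>b: "\<bar>\<kappa> x t\<bar> \<le> \<phi>_bound * (2 * u_bound)" for x t
    unfolding \<kappa>_def
  proof (rule L01_average_bound)
    show "\<bar>\<phi> (x - X m t) * (U m t - u x t)\<bar> \<le> \<phi>_bound * (2 * u_bound)" for m
      unfolding abs_mult by (intro mult_mono \<phi>_bounded diff pos) auto
  qed measurable
  have h_eq: "h x t = u x t * w x t + \<zeta> x t * \<kappa> x t" for x t
  proof (cases "0 \<le> t")
    case True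
    have "integrable U01 (\<lambda>m. \<phi> (x - X m t) * U m t)"
    proof (rule integrable_U01)
      show "\<bar>\<phi> (x - X m t) * U m t\<bar> \<le> \<phi>_bound * u_bound" for m
        unfolding abs_mult by (intro mult_mono \<phi>_bounded U_bounded pos) auto
    qed measurable
    moreover have "integrable U01 (\<lambda>m. \<phi> (x - X m t))"
      by (rule integrable_U01[OF _ \<phi>_bounded]) measurable
    moreover have "integral\<^sup>L (LS (\<lambda>x. M x t)) (\<lambda>y. \<phi> (x - y) * u y t) = (\<integral>m. \<phi> (x - X m t) * U m t \<partial>U01)"
      by (subst integral_LS_N) (use True in \<open>simp_all add: U_def\<close>)
    moreover have "integral\<^sup>L (LS (\<lambda>x. M x t)) (\<lambda>y. \<phi> (x - y)) = (\<integral>m. \<phi> (x - X m t) \<partial>U01)"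
      by (subst integral_LS_N) (use True in simp_all)
    ultimately have "integral\<^sup>L (LS (\<lambda>x. M x t)) (\<lambda>y. \<phi> (x - y) * u y t)
        - u x t * integral\<^sup>L (LS (\<lambda>x. M x t)) (\<lambda>y. \<phi> (x - y)) = \<kappa> x t"
      by (simp add: \<kappa>_def right_diff_distrib mult.commute)
    then show ?thesis unfolding h_def w_def by (simp add: power2_eq_square algebra_simps)
  next
    case False
    then show ?thesis by (simp add: h_def w_def test_st_outside_time[OF \<zeta>])
  qed
  have hb: "\<bar>u x t * w x t + \<zeta> x t * \<kappa> x t\<bar> \<le> u_bound * Bw + B * (\<phi>_bound * (2 * u_bound))" for x t
  proof -
    have "\<bar>u x t * w x t\<bar> \<le> u_bound * Bw"
      unfolding abs_mult by (intro mult_mono u_bounded wb pos) auto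
    moreover have "\<bar>\<zeta> x t * \<kappa> x t\<bar> \<le> B * (\<phi>_bound * (2 * u_bound))"
      unfolding abs_mult by (intro mult_mono B \<kappa>b pos) auto
    ultimately show ?thesis by linarith
  qed
  show "integrable (LS (\<lambda>x. M x t)) (\<lambda>x. h x t)"
    unfolding h_eq by (rule LS_integrable[OF _ hb]) (measurable, simp add: w_def test_st_outside_time[OF \<zeta>])
  \<comment> \<open>Along paths this is the time derivative of
    \<open>\<zeta> (X m s) s * \<omega> (X m s - X m' s)\<close>.\<close>
  define J where "J m m' s = w (X m s) s * \<omega> (X m s - X m' s) + \<zeta> (X m s) s * (\<phi> (X m s - X m' s) * (U m s - U m' s))" for m m' s
  define BJ where "BJ = Bw * \<omega>_bound + B * (\<phi>_bound * (2 * u_bound))"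
  have Jb: "\<bar>J m m' s\<bar> \<le> BJ" for m m' s
  proof -
    have "\<bar>w (X m s) s * \<omega> (X m s - X m' s)\<bar> \<le> Bw * \<omega>_bound"
      unfolding abs_mult using order_trans[OF abs_ge_zero wb] by (intro mult_mono wb \<omega>_bounded) auto
    moreover have "\<bar>\<zeta> (X m s) s * (\<phi> (X m s - X m' s) * (U m s - U m' s))\<bar> \<le> B * (\<phi>_bound * (2 * u_bound))"
      unfolding abs_mult U_def[of m s] using diff[of m' s "X m s"] by (intro mult_mono B \<phi>_bounded pos mult_nonneg_nonneg) (auto simp: abs_minus_commute)
    ultimately show ?thesis unfolding J_def BJ_def by linarith
  qed
  have Jm [measurable (raw)]: "(\<lambda>z. J (f z) (f' z) (g z)) \<in> borel_measurable W"
    if "f \<in> borel_measurable W" "f' \<in> borel_measurable W" "g \<in> borel_measurable W" for f f' g and W :: "'z measure"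
    using that unfolding J_def w_def by measurable
  \<comment> \<open>Formally the time derivative of
    \<open>\<zeta> (X m s) s * (a m - c (X m s) s)\<close>.\<close>
  define H where "H m s = a m * w (X m s) s - (\<integral>m'. J m m' s \<partial>U01)" for m s
  have IJb: "\<bar>\<integral>m'. J m m' s \<partial>U01\<bar> \<le> BJ" for m s
    by (rule L01_average_bound[OF _ Jb]) measurable
  have awb: "\<bar>a m * w (X m s) s\<bar> \<le> K * Bw" for m s
    unfolding abs_mult by (intro mult_mono a_bound wb pos) auto
  have slice: "integral\<^sup>L (LS (\<lambda>x. M x t)) (\<lambda>x. h x t) = (\<integral>m. H m t \<partial>U01)" for t
  proof (cases "0 \<le> t")
    case True
    have m1: "(\<lambda>x. u x t * w x t + \<zeta> x t * \<kappa> x t) \<in> borel_measurable borel" by measurable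
    have "integral\<^sup>L (LS (\<lambda>x. M x t)) (\<lambda>x. h x t) = (\<integral>m. w (X m t) t * U m t + \<zeta> (X m t) t * \<kappa> (X m t) t \<partial>U01)"
      unfolding h_eq integral_LS_N[OF m1 True] by (simp add: U_def mult.commute)
    also have "\<dots> = (\<integral>m. w (X m t) t * U m t \<partial>U01) + (\<integral>m. \<zeta> (X m t) t * \<kappa> (X m t) t \<partial>U01)"
    proof (rule Bochner_Integration.integral_add)
      show "integrable U01 (\<lambda>m. w (X m t) t * U m t)"
      proof (rule integrable_U01)
        show "\<bar>w (X m t) t * U m t\<bar> \<le> Bw * u_bound" for m
          unfolding abs_mult using order_trans[OF abs_ge_zero wb] by (intro mult_mono wb U_bounded) auto
      qed measurable
      show "integrable U01 (\<lambda>m. \<zeta> (X m t) t * \<kappa> (X m t) t)"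
      proof (rule integrable_U01)
        show "\<bar>\<zeta> (X m t) t * \<kappa> (X m t) t\<bar> \<le> B * (\<phi>_bound * (2 * u_bound))" for m
          unfolding abs_mult by (intro mult_mono B \<kappa>b pos) auto
      qed measurable
    qed
    \<comment> \<open>\<open>w\<close> is taken at \<open>X\<close>, so \<open>U\<close> may be
      traded for \<open>a - c\<close>; this replaces a velocity varying in time by a label value
      that does not.\<close>
    also have "(\<integral>m. w (X m t) t * U m t \<partial>U01) = (\<integral>m. w (X m t) t * a m \<partial>U01) - (\<integral>m. w (X m t) t * c (X m t) t \<partial>U01)"
      using integral_a_eq_U[of "\<lambda>x. w x t" Bw t] wb by simp
    also have "\<dots> + (\<integral>m. \<zeta> (X m t) t * \<kappa> (X m t) t \<partial>U01) = (\<integral>m. w (X m t) t * a m - w (X m t) t * c (X m t) t + \<zeta> (X m t) t * \<kappa> (X m t) t \<partial>U01)"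
    proof -
      have 1: "integrable U01 (\<lambda>m. w (X m t) t * a m)"
        by (rule integrable_U01[where B="K * Bw"]) (use awb in \<open>simp_all add: mult.commute\<close>)
      have 2: "integrable U01 (\<lambda>m. w (X m t) t * c (X m t) t)"
      proof (rule integrable_U01)
        show "\<bar>w (X m t) t * c (X m t) t\<bar> \<le> Bw * \<omega>_bound" for m
          unfolding abs_mult using order_trans[OF abs_ge_zero wb] by (intro mult_mono wb c_bound) auto
      qed measurable
      have 3: "integrable U01 (\<lambda>m. \<zeta> (X m t) t * \<kappa> (X m t) t)"
      proof (rule integrable_U01)
        show "\<bar>\<zeta> (X m t) t * \<kappa> (X m t) t\<bar> \<le> B * (\<phi>_bound * (2 * u_bound))" for m
          unfolding abs_mult by (intro mult_mono B \<kappa>b pos) auto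
      qed measurable
      show ?thesis using 1 2 3 by simp
    qed
    also have "\<dots> = (\<integral>m. H m t \<partial>U01)"
    proof (rule Bochner_Integration.integral_cong)
      fix m
      have 1: "integrable U01 (\<lambda>m'. \<omega> (X m t - X m' t))"
        by (rule integrable_U01[OF _ \<omega>_bounded]) measurable
      have 2: "integrable U01 (\<lambda>m'. \<phi> (X m t - X m' t) * (U m' t - U m t))"
      proof (rule integrable_U01)
        show "\<bar>\<phi> (X m t - X m' t) * (U m' t - U m t)\<bar> \<le> \<phi>_bound * (2 * u_bound)" for m'
          unfolding abs_mult U_def[of m t] by (intro mult_mono \<phi>_bounded diff pos) auto
      qed measurable
      have "(\<integral>m'. J m m' t \<partial>U01) = (\<integral>m'. w (X m t) t * \<omega> (X m t - X m' t) - \<zeta> (X m t) t * (\<phi> (X m t - X m' t) * (U m' t - U m t)) \<partial>U01)"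
        unfolding J_def by (simp add: algebra_simps)
      also have "\<dots> = w (X m t) t * c (X m t) t - \<zeta> (X m t) t * \<kappa> (X m t) t"
        using 1 2 by (simp add: c_def \<kappa>_def U_def[of m t])
      finally show "w (X m t) t * a m - w (X m t) t * c (X m t) t + \<zeta> (X m t) t * \<kappa> (X m t) t = H m t"
        by (simp add: H_def mult.commute)
    qed simp
    finally show ?thesis .
  next
    case False
    then have "w x t = 0" "\<zeta> x t = 0" for x by (simp_all add: w_def test_st_outside_time[OF \<zeta>])
    then show ?thesis by (simp add: h_eq H_def J_def)
  qed
  have Hm: "(\<lambda>(m, s). H m s) \<in> borel_measurable (borel \<Otimes>\<^sub>M borel)" unfolding H_def by measurable
  have Hb: "\<bar>H m s\<bar> \<le> K * Bw + BJ" for m s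
    using awb[of m s] IJb[of m s] unfolding H_def by linarith
  have Hz: "H m s = 0" if "s \<notin> {0..T}" for m s
  proof -
    have "w x s = 0" "\<zeta> x s = 0" for x
      using that test_st_outside_time[OF \<zeta>, of s] by (auto simp: w_def)
    then show ?thesis by (simp add: H_def J_def)
  qed
  note ta = time_average[OF Hm Hb Hz]
  show "integrable lborel (\<lambda>t. integral\<^sup>L (LS (\<lambda>x. M x t)) (\<lambda>x. h x t))"
    unfolding slice by (rule ta(1))
  have "AE m in U01. (\<integral>s. H m s \<partial>Leb {0..T}) = 0"
    using transport_identity[OF \<zeta> T] transport_pair_identity[OF \<zeta> T]
  proof eventually_elim
    case (elim m)
    have "(\<integral>s. H m s \<partial>Leb {0..T}) = (\<integral>s. a m * w (X m s) s \<partial>Leb {0..T}) - (\<integral>s. (\<integral>m'. J m m' s \<partial>U01) \<partial>Leb {0..T})"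
      unfolding H_def
    proof (rule Bochner_Integration.integral_diff)
      show "integrable (Leb {0..T}) (\<lambda>s. a m * w (X m s) s)"
        by (rule borel_measurable_bounded_integrable[OF finite_measure_Leb_Icc _ awb]) measurable
      show "integrable (Leb {0..T}) (\<lambda>s. \<integral>m'. J m m' s \<partial>U01)"
        by (rule borel_measurable_bounded_integrable[OF finite_measure_Leb_Icc _ IJb]) measurable
    qed
    also have "(\<integral>s. a m * w (X m s) s \<partial>Leb {0..T}) = a m * (\<integral>s. pdx \<zeta> (X m s) s * U m s + pdt \<zeta> (X m s) s \<partial>Leb {0..T})"
      by (simp add: w_def U_def algebra_simps flip: integral_mult_right_zero)
    also have "\<dots> = 0" using elim(1) by simp
    also have "(\<integral>s. (\<integral>m'. J m m' s \<partial>U01) \<partial>Leb {0..T}) = (\<integral>m'. (\<integral>s. J m m' s \<partial>Leb {0..T}) \<partial>U01)"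
      by (rule bounded_Fubini[OF finite_measure_Leb_Icc L01.finite_measure _ Jb]) measurable
    also have "\<dots> = 0"
    proof (rule integral_eq_zero_AE)
      have "J m m' s = (pdx \<zeta> (X m s) s * U m s + pdt \<zeta> (X m s) s) * \<omega> (X m s - X m' s) + \<zeta> (X m s) s * (\<phi> (X m s - X m' s) * (U m s - U m' s))" for m' s
        by (simp add: J_def w_def U_def[of m s] algebra_simps)
      then show "AE m' in U01. (\<integral>s. J m m' s \<partial>Leb {0..T}) = 0" using elim(2) by simp
    qed
    finally show ?case by simp
  qed
  then have "(\<integral>m. (\<integral>s. H m s \<partial>Leb {0..T}) \<partial>U01) = 0" by (rule integral_eq_zero_AE)
  then show "(LBINT t. integral\<^sup>L (LS (\<lambda>x. M x t)) (\<lambda>x. h x t)) = 0"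
    unfolding slice using ta(2) by simp
qed

section \<open>Continuity in time of mass and momentum\<close>

lemma Pc_LS:
  assumes t: "0 \<le> t"
  shows "Pc (LS (\<lambda>x. M x t))"
proof -
  obtain R where "step_cdf (N t) R" by (rule step_cdf_N')
  then interpret S: step_cdf "N t" R .
  have "emeasure (LS (N t)) (UNIV - {-R..R}) = 0"
  proof -
    have e: "quantile (N t) -` (UNIV - {-R..R}) = {}"
      using S.quantile_range by (auto simp: abs_le_iff) (metis minus_le_iff)
    show ?thesis unfolding S.distr_quantile[symmetric] by (subst emeasure_distr) (simp_all add: e)
  qed
  moreover have "space (LS (N t)) = UNIV" by (simp add: LS_def)
  ultimately show ?thesis
    unfolding Pc_def using LS_prob_space[OF t] by (auto simp: N_eq[OF t] intro!: exI[of _ "{-R..R}"])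
qed

lemma AE_X_Lipschitz:
  assumes "0 \<le> s" "0 \<le> t"
  shows "AE m in U01. \<bar>X m s - X m t\<bar> \<le> u_bound * \<bar>s - t\<bar>"
  using quantile_ode[OF assms(1)] quantile_ode[OF assms(2)]
proof eventually_elim
  case (elim m)
  have "\<bar>integral\<^sup>L (Leb {0..s}) (U m) - integral\<^sup>L (Leb {0..t}) (U m)\<bar> \<le> u_bound * \<bar>s - t\<bar>"
    by (rule Leb_integral_Lipschitz[OF U_meas' U_bounded])
  then show ?case using elim by simp
qed

text \<open>The quantiles at times \<open>s\<close> and \<open>t\<close> couple the two measures,
  and coupled points are at most \<open>u_bound * \<bar>s - t\<bar>\<close> apart.\<close>

lemma integral_LS_Lipschitz:
  assumes f: "\<And>x y. \<bar>f x - f y\<bar> \<le> L * \<bar>x - y\<bar>" and [measurable]: "f \<in> borel_measurable borel" and st: "0 \<le> s" "0 \<le> t"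
  shows "\<bar>integral\<^sup>L (LS (\<lambda>x. M x s)) f - integral\<^sup>L (LS (\<lambda>x. M x t)) f\<bar> \<le> L * (u_bound * \<bar>s - t\<bar>)"
proof -
  have L: "0 \<le> L" using order_trans[OF abs_ge_zero f[of 1 0]] by simp
  obtain R where R: "\<And>r. r \<le> 1 + s + t \<Longrightarrow> step_cdf (N r) R" using step_cdf_N[of "1 + s + t"] st by auto
  have i: "integrable U01 (\<lambda>m. f (X m r))" if "r \<le> 1 + s + t" for r
  proof (rule integrable_U01)
    show "\<bar>f (X m r)\<bar> \<le> \<bar>f 0\<bar> + L * R" for m
    proof -
      have "\<bar>X m r\<bar> \<le> R" unfolding X_def by (rule step_cdf.quantile_range[OF R[OF that]])
      then have "L * \<bar>X m r\<bar> \<le> L * R" using L by (rule mult_left_mono)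
      then show ?thesis using f[of "X m r" 0] by simp
    qed
  qed measurable
  have "\<bar>integral\<^sup>L (LS (\<lambda>x. M x s)) f - integral\<^sup>L (LS (\<lambda>x. M x t)) f\<bar> = \<bar>\<integral>m. f (X m s) - f (X m t) \<partial>U01\<bar>"
    using i[of s] i[of t] st by (simp add: integral_LS_N)
  also have "\<dots> \<le> (\<integral>m. \<bar>f (X m s) - f (X m t)\<bar> \<partial>U01)" by (rule integral_abs_bound)
  also have "\<dots> \<le> (\<integral>m. L * (u_bound * \<bar>s - t\<bar>) \<partial>U01)"
  proof (rule integral_mono_AE)
    show "AE m in U01. \<bar>f (X m s) - f (X m t)\<bar> \<le> L * (u_bound * \<bar>s - t\<bar>)"
      using AE_X_Lipschitz[OF st]
    proof eventually_elim
      case (elim m)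
      show ?case using f[of "X m s" "X m t"] mult_left_mono[OF elim L] by linarith
    qed
  qed (use i[of s] i[of t] st in auto)
  finally show ?thesis using L01.prob_space by simp
qed

lemma W1_le:
  assumes st: "0 \<le> s" "0 \<le> t"
  shows "0 \<le> W1 (LS (\<lambda>x. M x s)) (LS (\<lambda>x. M x t)) \<and> W1 (LS (\<lambda>x. M x s)) (LS (\<lambda>x. M x t)) \<le> u_bound * \<bar>s - t\<bar>"
proof -
  let ?S = "(\<lambda>f. \<bar>integral\<^sup>L (LS (\<lambda>x. M x s)) f - integral\<^sup>L (LS (\<lambda>x. M x t)) f\<bar>) ` {f :: real \<Rightarrow> real. lipschitz_on 1 UNIV f}"
  have le: "y \<le> u_bound * \<bar>s - t\<bar>" if "y \<in> ?S" for y
  proof -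
    obtain f where f: "1-lipschitz_on UNIV f" and y: "y = \<bar>integral\<^sup>L (LS (\<lambda>x. M x s)) f - integral\<^sup>L (LS (\<lambda>x. M x t)) f\<bar>"
      using \<open>y \<in> ?S\<close> by auto
    have "f \<in> borel_measurable borel"
      by (rule borel_measurable_continuous_onI[OF lipschitz_on_continuous_on[OF f]])
    moreover have "\<bar>f x - f y\<bar> \<le> 1 * \<bar>x - y\<bar>" for x y
      using lipschitz_onD[OF f, of x y] by (simp add: dist_real_def)
    ultimately show ?thesis unfolding y using integral_LS_Lipschitz[of f 1 s t] st by simp
  qed
  \<comment> \<open>The zero function shows that the set is nonempty and that its supremum is
    nonnegative; boundedness above is required for the supremum to be meaningful.\<close>
  have "(\<lambda>_. 0) \<in> {f :: real \<Rightarrow> real. 1-lipschitz_on UNIV f}" by (auto intro!: lipschitz_intros lipschitz_onI)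
  then have "\<bar>integral\<^sup>L (LS (\<lambda>x. M x s)) (\<lambda>_. 0::real) - integral\<^sup>L (LS (\<lambda>x. M x t)) (\<lambda>_. 0)\<bar> \<in> ?S" by (rule imageI)
  then have z: "0 \<in> ?S" by simp
  have "bdd_above ?S" using le by (rule bdd_aboveI)
  then have "0 \<le> Sup ?S" using z by (rule cSup_upper[rotated])
  moreover have "Sup ?S \<le> u_bound * \<bar>s - t\<bar>" by (rule cSup_least) (use z le in blast)+
  ultimately show ?thesis unfolding W1_def by simp
qed

lemma W1_tendsto:
  assumes "t \<in> {0..T}"
  shows "((\<lambda>s. W1 (LS (\<lambda>x. M x s)) (LS (\<lambda>x. M x t))) \<longlongrightarrow> 0) (at t within {0..T})"
proof (rule Lim_null_comparison)
  have "((\<lambda>s. u_bound * \<bar>s - t\<bar>) \<longlongrightarrow> u_bound * \<bar>t - t\<bar>) (at t within {0..T})"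
    by (intro tendsto_intros)
  then show "((\<lambda>s. u_bound * \<bar>s - t\<bar>) \<longlongrightarrow> 0) (at t within {0..T})" by simp
  show "\<forall>\<^sub>F s in at t within {0..T}. norm (W1 (LS (\<lambda>x. M x s)) (LS (\<lambda>x. M x t))) \<le> u_bound * \<bar>s - t\<bar>"
    unfolding eventually_at_filter by (rule always_eventually) (use W1_le assms in auto)
qed

end

lemma test1_props:
  assumes "test1 f"
  shows "smooth1 f" "(f has_real_derivative deriv f x) (at x)" "continuous_on UNIV (deriv f)" "f \<in> borel_measurable borel"
    and "\<exists>l b. \<forall>x. x \<notin> {l..b} \<longrightarrow> f x = 0 \<and> deriv f x = 0"
    and "\<exists>L. (\<forall>x. \<bar>f x\<bar> \<le> L) \<and> (\<forall>x y. \<bar>f x - f y\<bar> \<le> L * \<bar>x - y\<bar>)"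
proof -
  show s: "smooth1 f" using assms by (simp add: test1_def smooth1_def)
  show d: "(f has_real_derivative deriv f x) (at x)" for x using smooth1_D[OF s, of 0] by simp
  show dc: "continuous_on UNIV (deriv f)" using smooth1_continuous[OF s, of UNIV 1] by simp
  have fc: "continuous_on A f" for A using smooth1_continuous[OF s, of A 0] by simp
  show "f \<in> borel_measurable borel" by (rule borel_measurable_continuous_onI[OF fc])
  have "bounded (supp1 f)" using assms compact_imp_bounded unfolding test1_def by blast
  then obtain b where b: "\<forall>x\<in>supp1 f. \<bar>x\<bar> \<le> b" unfolding bounded_iff by auto
  have z: "f x = 0 \<and> deriv f x = 0" if x: "x \<notin> supp1 f" for x
  proof
    have f0: "f y = 0" if "y \<notin> supp1 f" for y
      using that subsetD[OF closure_subset[of "{x. f x \<noteq> 0}"], of y] by (auto simp: supp1_def)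
    then show "f x = 0" using x by simp
    have "(f has_real_derivative 0) (at x)"
    proof (rule has_field_derivative_transform_within_open[where S="- supp1 f" and f="\<lambda>_. 0"])
      show "open (- supp1 f)" by (simp add: supp1_def open_Compl)
      show "0 = f y" if "y \<in> - supp1 f" for y using f0[of y] that by simp
    qed (use x in simp_all)
    then show "deriv f x = 0" by (rule DERIV_imp_deriv)
  qed
  have z': "f x = 0 \<and> deriv f x = 0" if "x \<notin> {-b..b}" for x
  proof (rule z, rule notI)
    assume "x \<in> supp1 f"
    from bspec[OF b this] that show False by (simp add: abs_le_iff)
  qed
  then show "\<exists>l b. \<forall>x. x \<notin> {l..b} \<longrightarrow> f x = 0 \<and> deriv f x = 0" by blast
  have "bounded (f ` {-b..b})"
    by (rule compact_imp_bounded[OF compact_continuous_image[OF fc compact_Icc]])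
  moreover have "bounded (deriv f ` {-b..b})"
    by (rule compact_imp_bounded[OF compact_continuous_image[OF continuous_on_subset[OF dc] compact_Icc]]) simp
  ultimately obtain B1 B2 where B: "\<forall>x\<in>{-b..b}. \<bar>f x\<bar> \<le> B1" "\<forall>x\<in>{-b..b}. \<bar>deriv f x\<bar> \<le> B2"
    unfolding bounded_iff by (auto simp del: atLeastAtMost_iff)
  define L where "L = max 0 (max B1 B2)"
  have L: "\<bar>f x\<bar> \<le> L" "\<bar>deriv f x\<bar> \<le> L" for x
  proof -
    have "\<bar>f x\<bar> \<le> L \<and> \<bar>deriv f x\<bar> \<le> L"
    proof (cases "x \<in> {-b..b}")
      case True
      then show ?thesis using bspec[OF B(1) True] bspec[OF B(2) True] unfolding L_def by linarith
    next
      case False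
      then show ?thesis using z'[OF False] unfolding L_def by simp
    qed
    then show "\<bar>f x\<bar> \<le> L" "\<bar>deriv f x\<bar> \<le> L" by auto
  qed
  have "\<bar>f x - f y\<bar> \<le> L * \<bar>x - y\<bar>" for x y
    using field_differentiable_bound[of UNIV f "deriv f" L x y] d L(2) by simp
  with L(1) show "\<exists>L. (\<forall>x. \<bar>f x\<bar> \<le> L) \<and> (\<forall>x y. \<bar>f x - f y\<bar> \<le> L * \<bar>x - y\<bar>)" by blast
qed

context entropy_lagrangian begin

definition momentum :: "real \<Rightarrow> (real \<Rightarrow> real) \<Rightarrow> real" where
  "momentum t f = - integral\<^sup>L lborel (\<lambda>x. A (M x t) * deriv f x)
                 - integral\<^sup>L (LS (\<lambda>x. M x t)) (\<lambda>x. f x * conv_fun \<phi> M x t)"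

text \<open>The first form depends on time only through \<open>X\<close> and \<open>c\<close>, since
  \<open>a\<close> is fixed, and therefore yields continuity at time 0. The second expresses the
  Radon-Nikodym property.\<close>

lemma momentum_eq:
  assumes f: "test1 f" and t: "0 \<le> t"
  shows "momentum t f = (\<integral>m. f (X m t) * a m \<partial>U01) - (\<integral>m. f (X m t) * c (X m t) t \<partial>U01)"
    and "momentum t f = integral\<^sup>L (LS (\<lambda>x. M x t)) (\<lambda>x. f x * u x t)"
proof -
  have [measurable]: "f \<in> borel_measurable borel" by (rule test1_props(4)[OF f])
  obtain l b where lb: "\<And>x. x \<notin> {l..b} \<Longrightarrow> f x = 0 \<and> deriv f x = 0" using test1_props(5)[OF f] by blast
  obtain L where L: "\<And>x. \<bar>f x\<bar> \<le> L" using test1_props(6)[OF f] by blast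
  have "integral\<^sup>L (LS (\<lambda>x. M x t)) (\<lambda>x. f x * conv_fun \<phi> M x t) = (\<integral>m. f (X m t) * c (X m t) t \<partial>U01)"
    unfolding conv_fun_eq[OF t] by (rule integral_LS_N[OF _ t]) measurable
  then show *: "momentum t f = (\<integral>m. f (X m t) * a m \<partial>U01) - (\<integral>m. f (X m t) * c (X m t) t \<partial>U01)"
    using integral_A_derivative[OF t test1_props(2)[OF f] test1_props(3)[OF f] lb] by (simp add: momentum_def)
  have "integral\<^sup>L (LS (\<lambda>x. M x t)) (\<lambda>x. f x * u x t) = (\<integral>m. f (X m t) * U m t \<partial>U01)"
    unfolding U_def by (rule integral_LS_N[OF _ t]) measurable
  also have "\<dots> = momentum t f"
    using integral_a_eq_U[of f L t] L unfolding * by simp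
  finally show "momentum t f = integral\<^sup>L (LS (\<lambda>x. M x t)) (\<lambda>x. f x * u x t)" ..
qed

text \<open>The factor 2 arises because both trajectories in
  \<open>\<omega> (X m t - X m' t)\<close> move.\<close>

lemma AE_c_Lipschitz:
  assumes t: "0 \<le> t"
  shows "AE m in U01. \<bar>c (X m t) t - c (X m 0) 0\<bar> \<le> \<phi>_bound * (2 * (u_bound * t))"
  using AE_X_Lipschitz[OF t order_refl]
proof eventually_elim
  case (elim m)
  have i: "integrable U01 (\<lambda>m'. \<omega> (X m r - X m' r))" for r
    by (rule integrable_U01[OF _ \<omega>_bounded]) measurable
  have "\<bar>c (X m t) t - c (X m 0) 0\<bar> = \<bar>\<integral>m'. \<omega> (X m t - X m' t) - \<omega> (X m 0 - X m' 0) \<partial>U01\<bar>"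
    using i by (simp add: c_def)
  also have "\<dots> \<le> (\<integral>m'. \<bar>\<omega> (X m t - X m' t) - \<omega> (X m 0 - X m' 0)\<bar> \<partial>U01)" by (rule integral_abs_bound)
  also have "\<dots> \<le> (\<integral>m'. \<phi>_bound * (2 * (u_bound * t)) \<partial>U01)"
  proof (rule integral_mono_AE)
    show "AE m' in U01. \<bar>\<omega> (X m t - X m' t) - \<omega> (X m 0 - X m' 0)\<bar> \<le> \<phi>_bound * (2 * (u_bound * t))"
      using AE_X_Lipschitz[OF t order_refl]
    proof eventually_elim
      case (elim m')
      have "\<bar>(X m t - X m' t) - (X m 0 - X m' 0)\<bar> \<le> 2 * (u_bound * t)"
        using elim \<open>\<bar>X m t - X m 0\<bar> \<le> u_bound * \<bar>t - 0\<bar>\<close> t unfolding diff_zero abs_of_nonneg[OF t] by linarith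
      then have "\<phi>_bound * \<bar>(X m t - X m' t) - (X m 0 - X m' 0)\<bar> \<le> \<phi>_bound * (2 * (u_bound * t))"
        using order_trans[OF abs_ge_zero \<phi>_bounded] by (intro mult_left_mono)
      then show ?case using \<omega>_Lipschitz[of "X m t - X m' t" "X m 0 - X m' 0"] by linarith
    qed
  qed (use i in auto)
  finally show ?case using L01.prob_space by simp
qed

lemma momentum_tendsto:
  assumes f: "test1 f"
  shows "((\<lambda>t. momentum t f) \<longlongrightarrow> momentum 0 f) (at_right 0)"
proof -
  have [measurable]: "f \<in> borel_measurable borel" by (rule test1_props(4)[OF f])
  obtain L where L: "\<And>x. \<bar>f x\<bar> \<le> L" "\<And>x y. \<bar>f x - f y\<bar> \<le> L * \<bar>x - y\<bar>" using test1_props(6)[OF f] by blast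
  have pos: "0 \<le> L" "0 \<le> u_bound"
    using order_trans[OF abs_ge_zero L(1)] order_trans[OF abs_ge_zero u_bounded] by auto
  have i1: "integrable U01 (\<lambda>m. f (X m t) * a m)" and i2: "integrable U01 (\<lambda>m. f (X m t) * c (X m t) t)" for t
  proof -
    have b: "\<bar>f (X m t) * a m\<bar> \<le> L * K" "\<bar>f (X m t) * c (X m t) t\<bar> \<le> L * \<omega>_bound" for m
      using mult_mono[OF L(1)[of "X m t"] a_bound[of m]] mult_mono[OF L(1)[of "X m t"] c_bound[of "X m t" t]] pos
      by (simp_all add: abs_mult)
    show "integrable U01 (\<lambda>m. f (X m t) * a m)" by (rule integrable_U01[OF _ b(1)]) measurable
    show "integrable U01 (\<lambda>m. f (X m t) * c (X m t) t)" by (rule integrable_U01[OF _ b(2)]) measurable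
  qed
  \<comment> \<open>The first summand accounts for the motion of \<open>X\<close> inside
    \<open>f\<close>, with \<open>\<bar>a - c\<bar> \<le> K + \<omega>_bound\<close>; the second for
    the change of \<open>c\<close>.\<close>
  define E where "E t = (L * (u_bound * t)) * (K + \<omega>_bound) + L * (\<phi>_bound * (2 * (u_bound * t)))" for t
  have le: "\<bar>momentum t f - momentum 0 f\<bar> \<le> E t" if t: "0 \<le> t" for t
  proof -
    define D where "D m = (f (X m t) * a m - f (X m t) * c (X m t) t) - (f (X m 0) * a m - f (X m 0) * c (X m 0) 0)" for m
    have iD: "integrable U01 D"
      unfolding D_def[abs_def] by (intro Bochner_Integration.integrable_diff i1 i2)
    have eq: "momentum t f - momentum 0 f = integral\<^sup>L U01 D"
      unfolding momentum_eq(1)[OF f t] momentum_eq(1)[OF f order_refl] D_def[abs_def]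
      by (simp only: Bochner_Integration.integral_diff Bochner_Integration.integrable_diff i1 i2)
    have "\<bar>integral\<^sup>L U01 D\<bar> \<le> (\<integral>m. \<bar>D m\<bar> \<partial>U01)"
      by (rule integral_abs_bound)
    also have "\<dots> \<le> (\<integral>m. E t \<partial>U01)"
    proof (rule integral_mono_AE)
      show "AE m in U01. \<bar>D m\<bar> \<le> E t"
        using AE_c_Lipschitz[OF t] AE_X_Lipschitz[OF t order_refl]
      proof eventually_elim
        case (elim m)
        have "D m = (f (X m t) - f (X m 0)) * (a m - c (X m t) t) - f (X m 0) * (c (X m t) t - c (X m 0) 0)"
          by (simp add: D_def algebra_simps)
        moreover have "\<bar>(f (X m t) - f (X m 0)) * (a m - c (X m t) t)\<bar> \<le> (L * (u_bound * t)) * (K + \<omega>_bound)"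
          unfolding abs_mult
        proof (rule mult_mono)
          show "\<bar>f (X m t) - f (X m 0)\<bar> \<le> L * (u_bound * t)"
            using order_trans[OF L(2) mult_left_mono[OF elim(2) pos(1)]] t by simp
          show "\<bar>a m - c (X m t) t\<bar> \<le> K + \<omega>_bound" using a_bound[of m] c_bound[of "X m t" t] by linarith
          show "0 \<le> L * (u_bound * t)" by (intro mult_nonneg_nonneg pos t)
        qed simp
        moreover have "\<bar>f (X m 0) * (c (X m t) t - c (X m 0) 0)\<bar> \<le> L * (\<phi>_bound * (2 * (u_bound * t)))"
          unfolding abs_mult by (rule mult_mono[OF L(1) elim(1) pos(1) abs_ge_zero])
        ultimately show ?case unfolding E_def by linarith
      qed
      show "integrable U01 (\<lambda>m. \<bar>D m\<bar>)" using iD by (rule integrable_abs)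
    qed simp
    finally show ?thesis unfolding eq using L01.prob_space by simp
  qed
  have E0: "(E \<longlongrightarrow> 0) (at_right 0)"
  proof -
    obtain k where E: "E = (\<lambda>t. t * k)"
    proof
      show "E = (\<lambda>t. t * (L * u_bound * (K + \<omega>_bound) + L * \<phi>_bound * 2 * u_bound))"
        by (simp add: E_def fun_eq_iff algebra_simps)
    qed
    have "((\<lambda>t. t * k) \<longlongrightarrow> 0 * k) (at_right 0)"
      by (rule tendsto_mult[OF tendsto_ident_at tendsto_const])
    then show ?thesis unfolding E by simp
  qed
  have "((\<lambda>t. momentum t f - momentum 0 f) \<longlongrightarrow> 0) (at_right 0)"
  proof (rule Lim_null_comparison[OF _ E0])
    show "\<forall>\<^sub>F t in at_right 0. norm (momentum t f - momentum 0 f) \<le> E t"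
      using eventually_at_right_less[of 0] by (rule eventually_mono) (simp add: le)
  qed
  then show ?thesis by (simp add: LIM_zero_iff)
qed

lemma mass_tendsto:
  assumes f: "test1 f"
  shows "((\<lambda>t. integral\<^sup>L (LS (\<lambda>x. M x t)) f) \<longlongrightarrow> integral\<^sup>L (LS (\<lambda>x. M x 0)) f) (at_right 0)"
proof -
  obtain L where L: "\<And>x y. \<bar>f x - f y\<bar> \<le> L * \<bar>x - y\<bar>" using test1_props(6)[OF f] by blast
  have "((\<lambda>t. L * (u_bound * \<bar>t - 0\<bar>)) \<longlongrightarrow> L * (u_bound * \<bar>0 - 0\<bar>)) (at_right 0)"
    by (intro tendsto_intros)
  then have l: "((\<lambda>t. L * (u_bound * \<bar>t - 0\<bar>)) \<longlongrightarrow> 0) (at_right 0)" by simp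
  have "((\<lambda>t. integral\<^sup>L (LS (\<lambda>x. M x t)) f - integral\<^sup>L (LS (\<lambda>x. M x 0)) f) \<longlongrightarrow> 0) (at_right 0)"
  proof (rule Lim_null_comparison[OF _ l])
    show "\<forall>\<^sub>F t in at_right 0. norm (integral\<^sup>L (LS (\<lambda>x. M x t)) f - integral\<^sup>L (LS (\<lambda>x. M x 0)) f) \<le> L * (u_bound * \<bar>t - 0\<bar>)"
      using eventually_at_right_less[of 0]
    proof (rule eventually_mono)
      fix t :: real assume "0 < t"
      then show "norm (integral\<^sup>L (LS (\<lambda>x. M x t)) f - integral\<^sup>L (LS (\<lambda>x. M x 0)) f) \<le> L * (u_bound * \<bar>t - 0\<bar>)"
        unfolding real_norm_def by (intro integral_LS_Lipschitz[OF L test1_props(4)[OF f]]) auto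
    qed
  qed
  then show ?thesis by (simp add: LIM_zero_iff)
qed

lemma weak_sol_LS:
  assumes \<rho>0: "LS (\<lambda>x. M x 0) = \<rho>0" and P0: "\<And>f. test1 f \<Longrightarrow> momentum 0 f = P0 f"
  shows "weak_sol \<phi> (\<lambda>t. LS (\<lambda>x. M x t)) momentum \<rho>0 P0"
  unfolding weak_sol_def Let_def
proof (intro conjI)
  show "\<forall>T>0. \<forall>t\<in>{0..T}. Pc (LS (\<lambda>x. M x t)) \<and> ((\<lambda>s. W1 (LS (\<lambda>x. M x s)) (LS (\<lambda>x. M x t))) \<longlongrightarrow> 0) (at t within {0..T})"
    using Pc_LS W1_tendsto by auto
  show "\<forall>f. test1 f \<longrightarrow> ((\<lambda>t. integral\<^sup>L (LS (\<lambda>x. M x t)) f) \<longlongrightarrow> integral\<^sup>L \<rho>0 f) (at_right 0) \<and>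
        ((\<lambda>t. momentum t f) \<longlongrightarrow> P0 f) (at_right 0)"
  proof (intro allI impI conjI)
    fix f :: "real \<Rightarrow> real" assume f: "test1 f"
    show "((\<lambda>t. integral\<^sup>L (LS (\<lambda>x. M x t)) f) \<longlongrightarrow> integral\<^sup>L \<rho>0 f) (at_right 0)"
      using mass_tendsto[OF f] unfolding \<rho>0 .
    show "((\<lambda>t. momentum t f) \<longlongrightarrow> P0 f) (at_right 0)"
      using momentum_tendsto[OF f] unfolding P0[OF f] .
  qed
  have um: "(\<lambda>x. u x t) \<in> borel_measurable borel" for t by measurable
  show "\<exists>u :: real \<Rightarrow> real \<Rightarrow> real.
        (\<forall>t\<ge>0. (\<lambda>x. u x t) \<in> borel_measurable (LS (\<lambda>x. M x t)) \<and>
                (\<exists>C. AE x in LS (\<lambda>x. M x t). \<bar>u x t\<bar> \<le> C) \<and>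
                (\<forall>f. test1 f \<longrightarrow> momentum t f = integral\<^sup>L (LS (\<lambda>x. M x t)) (\<lambda>x. f x * u x t))) \<and>
        (\<forall>T>0. \<forall>\<zeta>. test_st T \<zeta> \<longrightarrow>
              ((\<forall>t. integrable (LS (\<lambda>x. M x t)) (\<lambda>x. pdt \<zeta> x t + u x t * pdx \<zeta> x t)) \<and>
              integrable lborel (\<lambda>t. integral\<^sup>L (LS (\<lambda>x. M x t)) (\<lambda>x. pdt \<zeta> x t + u x t * pdx \<zeta> x t)) \<and>
              integral\<^sup>L lborel (\<lambda>t. integral\<^sup>L (LS (\<lambda>x. M x t)) (\<lambda>x. pdt \<zeta> x t + u x t * pdx \<zeta> x t)) = 0) \<and>
              (\<forall>t. integrable (LS (\<lambda>x. M x t)) (\<lambda>x. u x t * pdt \<zeta> x t + (u x t)\<^sup>2 * pdx \<zeta> x t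
                      + \<zeta> x t * (integral\<^sup>L (LS (\<lambda>x. M x t)) (\<lambda>y. \<phi> (x - y) * u y t)
                                  - u x t * integral\<^sup>L (LS (\<lambda>x. M x t)) (\<lambda>y. \<phi> (x - y))))) \<and>
              integrable lborel (\<lambda>t. integral\<^sup>L (LS (\<lambda>x. M x t)) (\<lambda>x. u x t * pdt \<zeta> x t + (u x t)\<^sup>2 * pdx \<zeta> x t
                      + \<zeta> x t * (integral\<^sup>L (LS (\<lambda>x. M x t)) (\<lambda>y. \<phi> (x - y) * u y t)
                                  - u x t * integral\<^sup>L (LS (\<lambda>x. M x t)) (\<lambda>y. \<phi> (x - y))))) \<and>
              integral\<^sup>L lborel (\<lambda>t. integral\<^sup>L (LS (\<lambda>x. M x t)) (\<lambda>x. u x t * pdt \<zeta> x t + (u x t)\<^sup>2 * pdx \<zeta> x t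
                      + \<zeta> x t * (integral\<^sup>L (LS (\<lambda>x. M x t)) (\<lambda>y. \<phi> (x - y) * u y t)
                                  - u x t * integral\<^sup>L (LS (\<lambda>x. M x t)) (\<lambda>y. \<phi> (x - y))))) = 0)"
  proof (rule exI[of _ u], intro conjI allI impI)
    show "(\<lambda>x. u x t) \<in> borel_measurable (LS (\<lambda>x. M x t))" for t by (simp add: um)
    show "\<exists>C. AE x in LS (\<lambda>x. M x t). \<bar>u x t\<bar> \<le> C" for t
      by (rule exI[of _ u_bound]) (simp add: u_bounded)
    show "momentum t f = integral\<^sup>L (LS (\<lambda>x. M x t)) (\<lambda>x. f x * u x t)" if "0 \<le> t" "test1 f" for t f
      by (rule momentum_eq(2)[OF that(2,1)])
  qed ((rule continuity_equation momentum_equation, assumption, assumption)+)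
qed

end

section \<open>Initial data\<close>

text \<open>Compact support supplies \<open>R\<close>; right continuity of the distribution function
  makes it equal to its own \<open>rlim\<close>, and uniqueness of a law with given distribution
  function recovers \<open>\<mu>\<close>.\<close>

lemma quantile_cdf:
  assumes \<mu>: "Pc \<mu>"
  obtains R where "step_cdf (cdf \<mu>) R" "rlim (cdf \<mu>) = cdf \<mu>" "LS (cdf \<mu>) = \<mu>"
proof -
  interpret \<mu>: prob_space \<mu> using \<mu> by (simp add: Pc_def)
  have sets: "sets \<mu> = sets borel" using \<mu> by (simp add: Pc_def)
  then have space: "space \<mu> = UNIV" using sets_eq_imp_space_eq[of \<mu> borel] by simp
  have rd: "real_distribution \<mu>"
    by (simp add: real_distribution_def real_distribution_axioms_def \<mu>.prob_space_axioms sets)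
  interpret rd: real_distribution \<mu> by (rule rd)
  obtain C where C: "compact C" "emeasure \<mu> (space \<mu> - C) = 0" using \<mu> by (auto simp: Pc_def)
  obtain R where R: "\<forall>x\<in>C. \<bar>x\<bar> \<le> R" using compact_imp_bounded[OF C(1)] unfolding bounded_iff by auto
  have Cs: "C \<in> sets borel" using C(1) by (simp add: compact_imp_closed)
  have null: "measure \<mu> S = 0" if "S \<in> sets borel" "S \<inter> C = {}" for S
  proof -
    have "emeasure \<mu> S \<le> emeasure \<mu> (space \<mu> - C)"
      by (rule emeasure_mono) (use that Cs space sets in auto)
    then show ?thesis using C(2) by (simp add: measure_def)
  qed
  have S: "step_cdf (cdf \<mu>) R"
  proof
    show "mono (cdf \<mu>)" by (intro monoI rd.cdf_nondecreasing)
    show "cdf \<mu> x = 0" if "x < - R" for x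
      unfolding cdf_def by (rule null) (use R that in \<open>force+\<close>)
    show "cdf \<mu> x = 1" if "R < x" for x
    proof -
      have "measure \<mu> {x<..} = 0" by (rule null) (use R that in \<open>force+\<close>)
      moreover have "measure \<mu> {x<..} = 1 - measure \<mu> {..x}"
        using \<mu>.prob_compl[of "{..x}"] sets space by (simp add: Compl_eq_Diff_UNIV[symmetric])
      ultimately show ?thesis by (simp add: cdf_def)
    qed
  qed
  interpret S: step_cdf "cdf \<mu>" R by (rule S)
  have rl: "rlim (cdf \<mu>) x = cdf \<mu> x" for x
  proof (rule tendsto_unique[OF _ S.rlim_tendsto])
    show "(cdf \<mu> \<longlongrightarrow> cdf \<mu> x) (at_right x)"
      using rd.cdf_is_right_cont[of x] by (simp add: continuous_within)
  qed simp
  then have rl': "rlim (cdf \<mu>) = cdf \<mu>" by auto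
  have "LS (cdf \<mu>) = \<mu>"
    by (rule cdf_unique[OF S.real_distribution_LS rd]) (simp add: S.cdf_LS rl')
  then show ?thesis using that S rl' by blast
qed

theorem theorem4p4:
  fixes \<omega> \<phi> :: "real \<Rightarrow> real" and \<rho>0 :: "real measure" and u0 :: "real \<Rightarrow> real"
    and M0 \<psi>0 Minv A :: "real \<Rightarrow> real"
  assumes H: "hypH \<omega> \<phi>"
    and rho0: "Pc \<rho>0"
    and u0_meas: "u0 \<in> borel_measurable \<rho>0"
    and u0_bdd: "\<exists>C. AE x in \<rho>0. \<bar>u0 x\<bar> \<le> C"
    and M0_def: "M0 = (\<lambda>x. measure \<rho>0 {..x})"
    and psi0_def: "\<psi>0 = (\<lambda>x. u0 x + conv_meas \<omega> \<rho>0 x)"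
    and Minv_def: "Minv = (\<lambda>m. Inf {x. m \<le> M0 x})"
    and A_def: "A = (\<lambda>m. LBINT m'=0..m. \<psi>0 (Minv m'))"
  shows "(\<exists>L. lipschitz_on L {0..1} A) \<and>
    (\<forall>M. entropy_sol \<phi> A M0 M \<longrightarrow>
       weak_sol \<phi> (\<lambda>t. LS (\<lambda>x. M x t))
         (\<lambda>t f. - integral\<^sup>L lborel (\<lambda>x. A (M x t) * deriv f x)
                 - integral\<^sup>L (LS (\<lambda>x. M x t)) (\<lambda>x. f x * conv_fun \<phi> M x t))
         \<rho>0 (\<lambda>f. integral\<^sup>L \<rho>0 (\<lambda>x. f x * u0 x)))"
proof -
  interpret kernel \<omega> \<phi> by unfold_locales (rule H)
  have sets0: "sets \<rho>0 = sets borel" using rho0 by (simp add: Pc_def)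
  interpret \<rho>0: prob_space \<rho>0 using rho0 by (simp add: Pc_def)
  have M0: "M0 = cdf \<rho>0" by (simp add: M0_def cdf_def fun_eq_iff)
  obtain R where S: "step_cdf M0 R" and rl: "rlim M0 = M0" and LS0: "LS M0 = \<rho>0"
    using quantile_cdf[OF rho0] unfolding M0 by blast
  interpret S: step_cdf M0 R by (rule S)
  have u0m [measurable]: "u0 \<in> borel_measurable borel"
    using u0_meas measurable_cong_sets[OF sets0 refl] by blast
  have cm: "conv_meas \<omega> \<rho>0 x = (\<integral>m. \<omega> (x - quantile M0 m) \<partial>U01)" for x
    unfolding conv_meas_def by (subst LS0[symmetric], rule S.integral_LS) measurable
  have \<psi>m [measurable]: "\<psi>0 \<in> borel_measurable borel"
    unfolding psi0_def cm by measurable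
  obtain C where C: "AE x in \<rho>0. \<bar>u0 x\<bar> \<le> C" using u0_bdd by blast
  have AEu: "AE m in U01. \<bar>u0 (quantile M0 m)\<bar> \<le> C"
    using C unfolding LS0[symmetric] S.distr_quantile[symmetric] by (subst (asm) AE_distr_iff) simp_all
  \<comment> \<open>Bounds \<open>\<psi>0\<close> almost everywhere; \<open>max 0 C\<close> gives
    nonnegativity without an argument about \<open>C\<close>.\<close>
  define K where "K = max 0 C + \<omega>_bound"
  have K0: "0 \<le> K" using order_trans[OF abs_ge_zero \<omega>_bounded] by (simp add: K_def)
  have cmb: "\<bar>conv_meas \<omega> \<rho>0 x\<bar> \<le> \<omega>_bound" for x
  proof -
    have i: "integrable U01 (\<lambda>m. \<omega> (x - quantile M0 m))" by (rule integrable_U01[OF _ \<omega>_bounded]) measurable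
    have "\<bar>\<integral>m. \<omega> (x - quantile M0 m) \<partial>U01\<bar> \<le> (\<integral>m. \<omega>_bound \<partial>U01)"
      by (rule abs_integral_le[OF i]) (use \<omega>_bounded in auto)
    then show ?thesis unfolding cm using L01.prob_space by simp
  qed
  \<comment> \<open>\<open>\<psi>0\<close> is bounded only almost everywhere with respect to
    \<open>\<rho>0\<close>; truncation gives a density bounded at every level, changed only on a
    null set.\<close>
  define a where "a m = max (- K) (min K (\<psi>0 (quantile M0 m)))" for m
  have am [measurable]: "a \<in> borel_measurable borel" unfolding a_def[abs_def] by measurable
  have ab: "\<bar>a m\<bar> \<le> K" for m using K0 unfolding a_def by auto
  have a\<psi>: "AE m in U01. a m = \<psi>0 (quantile M0 m)"
    using AEu
  proof eventually_elim
    case (elim m)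
    have "\<bar>\<psi>0 (quantile M0 m)\<bar> \<le> K"
      using elim cmb[of "quantile M0 m"] unfolding psi0_def K_def by linarith
    then show ?case unfolding a_def by auto
  qed
  have Minv: "Minv m = quantile M0 m" if "0 < m" "m < 1" for m
    using that by (simp add: Minv_def quantile_def rl)
  \<comment> \<open>Outside (0,1) \<open>Minv\<close> is an infimum over the whole line for
    \<open>m \<le> 0\<close>, over the empty set for \<open>m > 1\<close>, and a single value at 1;
    constants suffice for measurability.\<close>
  have Mm: "Minv \<in> borel_measurable borel"
  proof -
    have "Minv = (\<lambda>m. if 0 < m \<and> m < 1 then quantile M0 m else if m = 1 then Minv 1 else if m \<le> 0 then Inf UNIV else Inf {})"
    proof
      fix m
      have "{x. m \<le> M0 x} = UNIV" if "m \<le> 0" using S.F_bounds(1) that order_trans by auto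
      moreover have "{x. m \<le> M0 x} = {}" if "1 < m" using S.F_bounds(2) that by (auto simp: not_le intro: le_less_trans)
      ultimately show "Minv m = (if 0 < m \<and> m < 1 then quantile M0 m else if m = 1 then Minv 1 else if m \<le> 0 then Inf UNIV else Inf {})"
        using Minv[of m] by (auto simp: Minv_def not_less)
    qed
    also have "\<dots> \<in> borel_measurable borel" by measurable
    finally show ?thesis .
  qed
  note [measurable] = Mm
  \<comment> \<open>\<open>Minv\<close> agrees with the quantile on (0,1); the endpoints 0 and 1 and
    the truncation in \<open>a\<close> affect null sets only.\<close>
  have A_eq: "A p = (\<integral>m. a m * indicator {..p} m \<partial>U01)" if p: "p \<in> {0..1}" for p
  proof -
    have "A p = (LBINT m. indicator {0..p} m * \<psi>0 (Minv m))"
      using p by (simp add: A_def interval_integral_Icc[of 0 p, unfolded zero_ereal_def[symmetric]] set_lebesgue_integral_def)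
    also have "\<dots> = (LBINT m. indicator {0<..<1} m * (a m * indicator {..p} m))"
    proof (rule integral_cong_AE)
      have "AE m in lborel. m \<in> {0<..<1} \<longrightarrow> a m = \<psi>0 (quantile M0 m)"
        using a\<psi> by (subst (asm) AE_Leb) auto
      then show "AE m in lborel. indicator {0..p} m * \<psi>0 (Minv m) = indicator {0<..<1} m * (a m * indicator {..p} m)"
        using AE_lborel_singleton[of 0] AE_lborel_singleton[of 1]
        by eventually_elim (use p in \<open>auto simp: indicator_def Minv\<close>)
    qed measurable
    also have "\<dots> = (\<integral>m. a m * indicator {..p} m \<partial>U01)"
      by (rule integral_Leb[symmetric]) measurable
    finally show ?thesis .
  qed
  have lip: "\<bar>A p - A q\<bar> \<le> K * \<bar>p - q\<bar>" if "p \<in> {0..1}" "q \<in> {0..1}" for p q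
    using that
  proof (induction q p rule: linorder_wlog)
    case (le q p)
    have i: "integrable U01 (\<lambda>m. a m * indicator {..r} m)" for r
      by (rule integrable_U01[where B=K]) (use ab K0 in \<open>auto simp: indicator_def\<close>)
    have j: "integrable U01 (indicator {..r} :: real \<Rightarrow> real)" for r
      by (rule integrable_U01[where B=1]) (auto simp: indicator_def)
    have "A p - A q = (\<integral>m. a m * indicator {..p} m - a m * indicator {..q} m \<partial>U01)"
      using le i by (simp add: A_eq)
    also have "\<bar>\<dots>\<bar> \<le> (\<integral>m. K * (indicator {..p} m - indicator {..q} m) \<partial>U01)"
    proof (rule abs_integral_le)
      show "integrable U01 (\<lambda>m. K * (indicator {..p} m - indicator {..q} m))"
        using j[of p] j[of q] by simp
      show "\<bar>a m * indicator {..p} m - a m * indicator {..q} m\<bar> \<le> K * (indicator {..p} m - indicator {..q} m)" for m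
        using ab[of m] K0 le by (auto simp: indicator_def)
    qed (use i in simp)
    also have "\<dots> = K * (integral\<^sup>L U01 (indicator {..p}) - integral\<^sup>L U01 (indicator {..q}))"
      using j[of p] j[of q] by (subst integral_mult_right_zero) (simp only: Bochner_Integration.integral_diff)
    also have "\<dots> = K * \<bar>p - q\<bar>" unfolding Leb01_atMost using le by simp
    finally show ?case .
  qed (simp add: abs_minus_commute)
  show ?thesis
  proof (intro conjI allI impI)
    show "\<exists>L. L-lipschitz_on {0..1} A"
      by (rule exI[of _ K], rule lipschitz_onI) (use lip K0 in \<open>auto simp: dist_real_def\<close>)
    fix M assume E: "entropy_sol \<phi> A M0 M"
    interpret entropy_lagrangian \<omega> \<phi> M a A K
    proof
      show "(\<lambda>p. M (fst p) (snd p)) \<in> borel_measurable borel" using E by (simp add: entropy_sol_def)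
      show "mono (\<lambda>x. M x t)" if "0 \<le> t" for t
        using E that unfolding entropy_sol_def by (auto dest!: spec[of _ "t + 1"])
      show "\<exists>R>0. \<forall>t\<in>{0..T}. \<forall>x. (x < -R \<longrightarrow> M x t = 0) \<and> (R < x \<longrightarrow> M x t = 1)" if "0 < T" for T
        using E that unfolding entropy_sol_def by blast
      show "((\<lambda>s. LBINT x. \<bar>M x s - M x t\<bar>) \<longlongrightarrow> 0) (at t within {0..T})" if "0 < T" "t \<in> {0..T}" for T t
        using E that unfolding entropy_sol_def by blast
      show "a \<in> borel_measurable borel" by (rule am)
      show "\<bar>a m\<bar> \<le> K" for m by (rule ab)
      show "A p = (\<integral>m. a m * indicator {..p} m \<partial>U01)" if "p \<in> {0..1}" for p by (rule A_eq[OF that])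
      show "0 \<le> integral\<^sup>L lborel (\<lambda>t. integral\<^sup>L lborel (\<lambda>x.
                   \<bar>M x t - \<alpha>\<bar> * pdt \<zeta> x t
                   + sgn (M x t - \<alpha>) * (A (M x t) - A \<alpha>) * pdx \<zeta> x t))
              + integral\<^sup>L lborel (\<lambda>t.
                   integral\<^sup>L (LS (\<lambda>x. max (M x t - \<alpha>) 0)) (\<lambda>x. \<zeta> x t * conv_fun \<phi> M x t)
                 - integral\<^sup>L (LS (\<lambda>x. min (M x t - \<alpha>) 0)) (\<lambda>x. \<zeta> x t * conv_fun \<phi> M x t))"
        if "0 < T" "test_st T \<zeta>" "\<And>x t. 0 \<le> \<zeta> x t" for T \<alpha> \<zeta>
        using E that unfolding entropy_sol_def by blast
    qed
    have M00: "(\<lambda>x. M x 0) = M0" using E by (auto simp: entropy_sol_def)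
    have X0: "X m 0 = quantile M0 m" for m by (simp add: X_def N_eq M00)
    have c0: "c x 0 = conv_meas \<omega> \<rho>0 x" for x by (simp add: c_def cm X0)
    \<comment> \<open>At time 0 the density \<open>a\<close> is itself almost everywhere a function
      of the quantile, and subtracting \<open>c\<close> from \<open>\<psi>0\<close> leaves
      \<open>u0\<close>.\<close>
    have P0: "momentum 0 f = integral\<^sup>L \<rho>0 (\<lambda>x. f x * u0 x)" if f: "test1 f" for f
    proof -
      have [measurable]: "f \<in> borel_measurable borel" by (rule test1_props(4)[OF f])
      obtain L where L: "\<And>x. \<bar>f x\<bar> \<le> L" using test1_props(6)[OF f] by blast
      have L0: "0 \<le> L" using order_trans[OF abs_ge_zero L] .
      have i1: "integrable U01 (\<lambda>m. f (X m 0) * a m)"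
      proof (rule integrable_U01)
        show "\<bar>f (X m 0) * a m\<bar> \<le> L * K" for m unfolding abs_mult by (rule mult_mono[OF L ab L0 abs_ge_zero])
      qed measurable
      have i2: "integrable U01 (\<lambda>m. f (X m 0) * c (X m 0) 0)"
      proof (rule integrable_U01)
        show "\<bar>f (X m 0) * c (X m 0) 0\<bar> \<le> L * \<omega>_bound" for m unfolding abs_mult by (rule mult_mono[OF L c_bound L0 abs_ge_zero])
      qed measurable
      have "momentum 0 f = (\<integral>m. f (X m 0) * a m - f (X m 0) * c (X m 0) 0 \<partial>U01)"
        unfolding momentum_eq(1)[OF f order_refl] using i1 i2 by (rule Bochner_Integration.integral_diff[symmetric])
      also have "\<dots> = (\<integral>m. f (quantile M0 m) * u0 (quantile M0 m) \<partial>U01)"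
      proof (rule integral_cong_AE)
        show "AE m in U01. f (X m 0) * a m - f (X m 0) * c (X m 0) 0 = f (quantile M0 m) * u0 (quantile M0 m)"
          using a\<psi> by eventually_elim (simp add: X0 c0 psi0_def algebra_simps)
      qed measurable
      also have "\<dots> = integral\<^sup>L \<rho>0 (\<lambda>x. f x * u0 x)"
        by (subst LS0[symmetric], rule S.integral_LS[symmetric]) measurable
      finally show ?thesis .
    qed
    have "weak_sol \<phi> (\<lambda>t. LS (\<lambda>x. M x t)) momentum \<rho>0 (\<lambda>f. integral\<^sup>L \<rho>0 (\<lambda>x. f x * u0 x))"
      by (rule weak_sol_LS) (use LS0 M00 P0 in auto)
    then show "weak_sol \<phi> (\<lambda>t. LS (\<lambda>x. M x t))
         (\<lambda>t f. - integral\<^sup>L lborel (\<lambda>x. A (M x t) * deriv f x)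
                 - integral\<^sup>L (LS (\<lambda>x. M x t)) (\<lambda>x. f x * conv_fun \<phi> M x t))
         \<rho>0 (\<lambda>f. integral\<^sup>L \<rho>0 (\<lambda>x. f x * u0 x))"
      unfolding momentum_def[abs_def] .
  qed
qed

end
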